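(* Let $X_1$ and $X_2$ be complex Banach spaces and let $X_1\tilde{\otimes}X_2$ be a tensor product of $X_1$ and $X_2$ relative to the dual pairings $\langle X_1,X_1'\rangle$ and $\langle X_2,X_2'\rangle$. Let $S=(S_1,\ldots,S_n)$ and $T=(T_1,\ldots,T_m)$ be tuples of commuting bounded linear operators on $X_1$ and $X_2$ respectively, and let $(S\otimes I,I\otimes T)=(S_1\otimes I,\ldots,S_n\otimes I,I\otimes T_1,\ldots,I\otimes T_m)$, an $(n+m)$-tuple of commuting operators on $X_1\tilde{\otimes}X_2$. Then: (i) $\sigma_{\Phi_-}(S)\times\sigma_\delta(T)\cup\sigma_\delta(S)\times\sigma_{\Phi_-}(T)\subseteq\sigma_{\Phi_-}(S\otimes I,I\otimes T)\subseteq sp_{\delta e}(S\otimes I,I\otimes T)\subseteq sp_{\delta e}(S)\times sp_\delta(T)\cup sp_\delta(S)\times sp_{\delta e}(T)$; (ii) $\sigma_{\Phi_+}(S)\times\sigma_\pi(T)\cup\sigma_\pi(S)\times\sigma_{\Phi_+}(T)\subseteq\sigma_{\Phi_+}(S\otimes I,I\otimes T)\subseteq sp_{\pi e}(S\otimes I,I\otimes T)\subseteq sp_{\pi e}(S)\times sp_\pi(T)\cup sp_\pi(S)\times sp_{\pi e}(T)$. In addition, if $X_1$ and $X_2$ are Hilbert spaces, all the inclusions in (i) and (ii) are equalities.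
   Context: Joint spectra. Let $X$ be a complex Banach space and $T=(T_1,\ldots,T_n)$ an $n$-tuple of commuting bounded linear operators on $X$. $R(\cdot)$ and $N(\cdot)$ denote range and null space. For $\lambda\in\mathbb{C}^n$, $T-\lambda=(T_1-\lambda_1I,\ldots,T_n-\lambda_nI)$. Define $\hat{T}\colon X^n\to X$, $\hat{T}(x_1,\ldots,x_n)=T_1x_1+\cdots+T_nx_n$, and $\tilde{T}\colon X\to X^n$, $\tilde{T}(x)=(T_1x,\ldots,T_nx)$. A subspace of a Banach space has a direct complement if there is a closed subspace such that the whole space is the direct sum of the two. - $\sigma_{\Phi_-}(T)=\{\lambda\in\mathbb{C}^n:\operatorname{codim}R(\widehat{T-\lambda})=\infty\}$ (lower semi-Fredholm spectrum). - $\sigma_{\Phi_+}(T)=\{\lambda\in\mathbb{C}^n:\dim N(\widetilde{T-\lambda})=\infty$ or $R(\widetilde{T-\lambda})$ is not closed$\}$ (upper semi-Fredholm spectrum). - $\sigma_\delta(T)=\{\lambda\in\mathbb{C}^n: R(\widehat{T-\lambda})\ne X\}$ (defect spectrum). - $\sigma_\pi(T)=\{\lambda\in\mathbb{C}^n: N(\widetilde{T-\lambda})\ne0$ or $R(\widetilde{T-\lambda})$ is not closed$\}$ (approximate point spectrum). - $\mathcal{C}_-(T)=\{\lambda\in\mathbb{C}^n: N(\widehat{T-\lambda})$ has no direct complement in $X^n\}$ and $\mathcal{C}_+(T)=\{\lambda\in\mathbb{C}^n: R(\widetilde{T-\lambda})$ has no direct complement in $X^n\}$. - $sp_\delta(T)=\sigma_\delta(T)\cup\mathcal{C}_-(T)$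 and $sp_{\delta e}(T)=\sigma_{\Phi_-}(T)\cup\mathcal{C}_-(T)$ (split defect and essential split defect spectra). - $sp_\pi(T)=\sigma_\pi(T)\cup\mathcal{C}_+(T)$ and $sp_{\pi e}(T)=\sigma_{\Phi_+}(T)\cup\mathcal{C}_+(T)$ (split approximate point and essential split approximate point spectra). Tensor product (in the sense of Eschmeier). $\mathrm{L}(X)$ is the algebra of bounded linear operators on $X$, and $X'$ is the dual space. A tensor product of $X_1$ and $X_2$ relative to $\langle X_1,X_1'\rangle$ and $\langle X_2,X_2'\rangle$ is a Banach space $X_1\tilde{\otimes}X_2$ together with continuous bilinear mappings $X_1\times X_2\to X_1\tilde{\otimes}X_2$, $(x,y)\mapsto x\otimes y$, and $\mathrm{L}(X_1)\times\mathrm{L}(X_2)\to\mathrm{L}(X_1\tilde{\otimes}X_2)$, $(A,B)\mapsto A\otimes B$, such that for all vectors $x\in X_1$, $y\in X_2$, functionals $u\in X_1'$, $v\in X_2'$ and operators: (T1) $\|x\otimes y\|=\|x\|\,\|y\|$; (T2) $(A\otimes B)(x\otimes y)=(Ax)\otimes(By)$; (T3) $(A_1\otimes B_1)\circ(A_2\otimes B_2)=(A_1A_2)\otimes(B_1B_2)$ and $I\otimes I=I$; (T4) $\operatorname{Im}(f_{x,u}\otimes I)\subseteq\{x\otimes y':y'\in X_2\}$ and $\operatorname{Im}(I\otimes f_{y,v})\subseteq\{x'\otimes y:x'\in X_1\}$, where $f_{x,u}\in\mathrm{L}(X_1)$ is $z\mapsto u(z)x$ and $f_{y,v}\in\mathrm{L}(X_2)$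 is $z\mapsto v(z)y$. *)

theory Defs
  imports "HOL-Analysis.Analysis" "HOL-Library.Extended_Nat"
begin

class complex_vector = real_vector +
  fixes scaleC :: "complex \<Rightarrow> 'a \<Rightarrow> 'a"  (infixr "*\<^sub>C" 75)
  assumes scaleC_add_right: "c *\<^sub>C (x + y) = c *\<^sub>C x + c *\<^sub>C y"
    and scaleC_add_left: "(c + d) *\<^sub>C x = c *\<^sub>C x + d *\<^sub>C x"
    and scaleC_scaleC: "c *\<^sub>C d *\<^sub>C x = (c * d) *\<^sub>C x"
    and scaleC_of_real: "complex_of_real r *\<^sub>C x = r *\<^sub>R x"

class complex_normed_vector = complex_vector + real_normed_vector +
  assumes norm_scaleC: "norm (c *\<^sub>C x) = cmod c * norm x"

class complex_banach = complex_normed_vector + banach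

global_interpretation complex_vector:
  vector_space "scaleC :: complex \<Rightarrow> 'a \<Rightarrow> 'a::complex_vector"
proof
  fix c d :: complex and x y :: 'a
  show "c *\<^sub>C (x + y) = c *\<^sub>C x + c *\<^sub>C y" by (rule scaleC_add_right)
  show "(c + d) *\<^sub>C x = c *\<^sub>C x + d *\<^sub>C x" by (rule scaleC_add_left)
  show "c *\<^sub>C d *\<^sub>C x = (c * d) *\<^sub>C x" by (rule scaleC_scaleC)
  show "1 *\<^sub>C x = x" using scaleC_of_real[of 1 x] by simp
qed

instantiation complex :: complex_banach
begin
definition scaleC_complex :: "complex \<Rightarrow> complex \<Rightarrow> complex" where
  "scaleC_complex c z = c * z"
instance
  by standard (simp_all add: scaleC_complex_def algebra_simps norm_mult scaleR_conv_of_real)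
end

instantiation vec :: (complex_vector, finite) complex_vector
begin
definition scaleC_vec :: "complex \<Rightarrow> 'a ^ 'b \<Rightarrow> 'a ^ 'b" where
  "scaleC_vec c x = (\<chi> i. c *\<^sub>C (x $ i))"
instance
  by standard (simp_all add: scaleC_vec_def vec_eq_iff scaleC_add_right scaleC_add_left
      scaleC_scaleC scaleC_of_real)
end

instance vec :: (complex_normed_vector, finite) complex_normed_vector
  by standard (simp add: scaleC_vec_def norm_vec_def norm_scaleC L2_set_right_distrib)

instance vec :: (complex_banach, finite) complex_banach ..

definition bounded_clinear ::
  "('a::complex_normed_vector \<Rightarrow> 'b::complex_normed_vector) \<Rightarrow> bool" where
  "bounded_clinear f \<longleftrightarrow> bounded_linear f \<and> (\<forall>c x. f (c *\<^sub>C x) = c *\<^sub>C f x)"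

text \<open>The space is a Hilbert space if its given norm is induced by an inner product
  (linear in the first argument).\<close>

definition hilbert_space :: "'a::complex_banach itself \<Rightarrow> bool" where
  "hilbert_space _ \<longleftrightarrow> (\<exists>ip :: 'a \<Rightarrow> 'a \<Rightarrow> complex.
     (\<forall>x y z. ip (x + y) z = ip x z + ip y z) \<and>
     (\<forall>c x y. ip (c *\<^sub>C x) y = c * ip x y) \<and>
     (\<forall>x y. ip y x = cnj (ip x y)) \<and>
     (\<forall>x. ip x x = complex_of_real ((norm x)\<^sup>2)))"

definition cdimension :: "'a::complex_vector set \<Rightarrow> enat" where
  "cdimension V =
     (SUP B \<in> {B. finite B \<and> B \<subseteq> V \<and> complex_vector.independent B}. enat (card B))"

text \<open>For a subspace \<open>V\<close> this is the dimension of the quotient by \<open>V\<close>: the sets \<open>B\<close> are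
  those on which the quotient map is injective with linearly independent image.\<close>

definition ccodimension :: "'a::complex_vector set \<Rightarrow> enat" where
  "ccodimension V =
     (SUP B \<in> {B. finite B \<and> complex_vector.independent B \<and> complex_vector.span B \<inter> V \<subseteq> {0}}.
        enat (card B))"

definition has_direct_complement :: "'a::complex_normed_vector set \<Rightarrow> bool" where
  "has_direct_complement M \<longleftrightarrow>
     (\<exists>N. complex_vector.subspace N \<and> closed N \<and> M \<inter> N = {0} \<and>
          {x + y | x y. x \<in> M \<and> y \<in> N} = UNIV)"

text \<open>An \<open>n\<close>-tuple is a family over a finite index type \<open>'n\<close>, the space \<open>X\<^sup>n\<close> is \<open>'a ^ 'n\<close>, and
  an \<open>(n+m)\<close>-tuple is indexed by \<open>'n + 'm\<close>.\<close>

definition commuting_tuple :: "('n::finite \<Rightarrow> 'a::complex_normed_vector \<Rightarrow> 'a) \<Rightarrow> bool" where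
  "commuting_tuple T \<longleftrightarrow> (\<forall>i. bounded_clinear (T i)) \<and> (\<forall>i j. T i \<circ> T j = T j \<circ> T i)"

definition shift_tuple ::
  "('n::finite \<Rightarrow> 'a::complex_normed_vector \<Rightarrow> 'a) \<Rightarrow> complex ^ 'n \<Rightarrow> 'n \<Rightarrow> 'a \<Rightarrow> 'a" where
  "shift_tuple T l = (\<lambda>i x. T i x - (l $ i) *\<^sub>C x)"

definition row_op ::
  "('n::finite \<Rightarrow> 'a::complex_normed_vector \<Rightarrow> 'a) \<Rightarrow> 'a ^ 'n \<Rightarrow> 'a" where
  "row_op T x = (\<Sum>i\<in>UNIV. T i (x $ i))"

definition col_op ::
  "('n::finite \<Rightarrow> 'a::complex_normed_vector \<Rightarrow> 'a) \<Rightarrow> 'a \<Rightarrow> 'a ^ 'n" where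
  "col_op T x = (\<chi> i. T i x)"

definition null_space :: "('a \<Rightarrow> 'b::zero) \<Rightarrow> 'a set" where
  "null_space f = {x. f x = 0}"

context
  fixes T :: "'n::finite \<Rightarrow> 'a::complex_banach \<Rightarrow> 'a"
begin

definition \<sigma>\<Phi>_minus :: "(complex ^ 'n) set" where
  "\<sigma>\<Phi>_minus = {l. ccodimension (range (row_op (shift_tuple T l))) = \<infinity>}"

definition \<sigma>\<Phi>_plus :: "(complex ^ 'n) set" where
  "\<sigma>\<Phi>_plus = {l. cdimension (null_space (col_op (shift_tuple T l))) = \<infinity> \<or>
                \<not> closed (range (col_op (shift_tuple T l)))}"

definition \<sigma>\<delta> :: "(complex ^ 'n) set" where
  "\<sigma>\<delta> = {l. range (row_op (shift_tuple T l)) \<noteq> UNIV}"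

definition \<sigma>\<pi> :: "(complex ^ 'n) set" where
  "\<sigma>\<pi> = {l. null_space (col_op (shift_tuple T l)) \<noteq> {0} \<or>
           \<not> closed (range (col_op (shift_tuple T l)))}"

definition C_minus :: "(complex ^ 'n) set" where
  "C_minus = {l. \<not> has_direct_complement (null_space (row_op (shift_tuple T l)))}"

definition C_plus :: "(complex ^ 'n) set" where
  "C_plus = {l. \<not> has_direct_complement (range (col_op (shift_tuple T l)))}"

definition sp\<delta> :: "(complex ^ 'n) set" where
  "sp\<delta> = \<sigma>\<delta> \<union> C_minus"

definition sp\<delta>e :: "(complex ^ 'n) set" where
  "sp\<delta>e = \<sigma>\<Phi>_minus \<union> C_minus"

definition sp\<pi> :: "(complex ^ 'n) set" where
  "sp\<pi> = \<sigma>\<pi> \<union> C_plus"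

definition sp\<pi>e :: "(complex ^ 'n) set" where
  "sp\<pi>e = \<sigma>\<Phi>_plus \<union> C_plus"

end

text \<open>The Cartesian product of subsets of \<open>\<complex>\<^sup>n\<close> and \<open>\<complex>\<^sup>m\<close>, viewed in \<open>\<complex>\<^sup>n\<^sup>+\<^sup>m\<close>.\<close>

definition vec_times ::
  "(complex ^ 'n) set \<Rightarrow> (complex ^ 'm) set \<Rightarrow> (complex ^ ('n::finite + 'm::finite)) set"
  (infixr "\<times>\<^sub>v" 80) where
  "A \<times>\<^sub>v B = {\<chi> k. case k of Inl i \<Rightarrow> a $ i | Inr j \<Rightarrow> b $ j | a b. a \<in> A \<and> b \<in> B}"

definition rank_one_op ::
  "'a::complex_normed_vector \<Rightarrow> ('a \<Rightarrow> complex) \<Rightarrow> 'a \<Rightarrow> 'a" where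
  "rank_one_op x u = (\<lambda>z. u z *\<^sub>C x)"

text \<open>\<open>tv\<close> is the tensor product of vectors, \<open>tp\<close> that of operators. The values of \<open>tp\<close> matter
  only on bounded complex-linear operators. Continuity of the bilinear map \<open>tp\<close> is its
  boundedness for the operator norms.\<close>

locale banach_tensor_product =
  fixes tv :: "'a::complex_banach \<Rightarrow> 'b::complex_banach \<Rightarrow> 'c::complex_banach"
    and tp :: "('a \<Rightarrow> 'a) \<Rightarrow> ('b \<Rightarrow> 'b) \<Rightarrow> 'c \<Rightarrow> 'c"
  assumes tv_bilinear: "bounded_bilinear tv"
    and tv_scaleC_left: "tv (c *\<^sub>C x) y = c *\<^sub>C tv x y"
    and tv_scaleC_right: "tv x (c *\<^sub>C y) = c *\<^sub>C tv x y"
    and tp_bounded_clinear: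
      "bounded_clinear A \<Longrightarrow> bounded_clinear B \<Longrightarrow> bounded_clinear (tp A B)"
    and tp_add_left:
      "bounded_clinear A \<Longrightarrow> bounded_clinear A' \<Longrightarrow> bounded_clinear B \<Longrightarrow>
        tp (\<lambda>x. A x + A' x) B = (\<lambda>z. tp A B z + tp A' B z)"
    and tp_add_right:
      "bounded_clinear A \<Longrightarrow> bounded_clinear B \<Longrightarrow> bounded_clinear B' \<Longrightarrow>
        tp A (\<lambda>y. B y + B' y) = (\<lambda>z. tp A B z + tp A B' z)"
    and tp_scaleC_left:
      "bounded_clinear A \<Longrightarrow> bounded_clinear B \<Longrightarrow>
        tp (\<lambda>x. c *\<^sub>C A x) B = (\<lambda>z. c *\<^sub>C tp A B z)"
    and tp_scaleC_right:
      "bounded_clinear A \<Longrightarrow> bounded_clinear B \<Longrightarrow>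
        tp A (\<lambda>y. c *\<^sub>C B y) = (\<lambda>z. c *\<^sub>C tp A B z)"
    and tp_bounded:
      "\<exists>K. \<forall>A B. bounded_clinear A \<longrightarrow> bounded_clinear B \<longrightarrow>
        onorm (tp A B) \<le> K * (onorm A * onorm B)"
    and T1: "norm (tv x y) = norm x * norm y"
    and T2: "bounded_clinear A \<Longrightarrow> bounded_clinear B \<Longrightarrow> tp A B (tv x y) = tv (A x) (B y)"
    and T3_comp:
      "bounded_clinear A1 \<Longrightarrow> bounded_clinear B1 \<Longrightarrow> bounded_clinear A2 \<Longrightarrow> bounded_clinear B2 \<Longrightarrow>
        tp A1 B1 \<circ> tp A2 B2 = tp (A1 \<circ> A2) (B1 \<circ> B2)"
    and T3_id: "tp id id = id"
    and T4_left: "bounded_clinear u \<Longrightarrow> range (tp (rank_one_op x u) id) \<subseteq> range (\<lambda>y'. tv x y')"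
    and T4_right: "bounded_clinear v \<Longrightarrow> range (tp id (rank_one_op y v)) \<subseteq> range (\<lambda>x'. tv x' y)"

definition tensor_tuple ::
  "(('a \<Rightarrow> 'a) \<Rightarrow> ('b \<Rightarrow> 'b) \<Rightarrow> 'c \<Rightarrow> 'c) \<Rightarrow> ('n \<Rightarrow> 'a \<Rightarrow> 'a) \<Rightarrow> ('m \<Rightarrow> 'b \<Rightarrow> 'b) \<Rightarrow> 'n + 'm \<Rightarrow> 'c \<Rightarrow> 'c" where
  "tensor_tuple tp S T k = (case k of Inl i \<Rightarrow> tp (S i) id | Inr j \<Rightarrow> tp id (T j))"

lemma bounded_clinear_id: "bounded_clinear id"
  by (simp add: bounded_clinear_def id_def)

lemma (in banach_tensor_product) commuting_tuple_tensor:
  assumes "commuting_tuple S" and "commuting_tuple T"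
  shows "commuting_tuple (tensor_tuple tp S T)"
proof -
  have S: "bounded_clinear (S i)" "S i \<circ> S i' = S i' \<circ> S i" for i i'
    using assms(1) by (auto simp: commuting_tuple_def)
  have T: "bounded_clinear (T j)" "T j \<circ> T j' = T j' \<circ> T j" for j j'
    using assms(2) by (auto simp: commuting_tuple_def)
  have "tensor_tuple tp S T k \<circ> tensor_tuple tp S T k' =
        tensor_tuple tp S T k' \<circ> tensor_tuple tp S T k" for k k'
    by (cases k; cases k') (simp_all add: tensor_tuple_def T3_comp bounded_clinear_id S T)
  moreover have "bounded_clinear (tensor_tuple tp S T k)" for k
    by (cases k) (simp_all add: tensor_tuple_def tp_bounded_clinear bounded_clinear_id S T)
  ultimately show ?thesis by (simp add: commuting_tuple_def)
qed

end

(* By shifting the tuples everything is reduced to the point 0. A tuple of operators is then upper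
   (lower) semi-Fredholm iff it, respectively its transpose on functionals, is bounded below up to
   finitely many functionals (vectors). The first inclusions follow by testing the estimate for
   the tensor tuple on x (x) y, respectively on u (x) v, where the factor y (v) is almost
   annihilated by its tuple. For the last inclusions, the split conditions say that the row or column
   is invertible up to finite rank: sum S_i R_i = 1 - P and sum T_j R'_j = 1 - Q give
   sum (S_i (x) 1)(R_i (x) 1) + sum (1 (x) T_j)(P (x) R'_j) = 1 - P (x) Q, and P (x) Q has finite
   rank or vanishes. On Hilbert spaces closed subspaces are complemented, so both outer sets agree. *)

theory Submission
  imports Defs
begin

section \<open>Bounded complex-linear maps\<close>

text \<open>The axioms give neither density of the elementary tensors nor functionals u (x) v. Both
  gaps are bridged by (T4): I (x) f_{y,v} maps everything into X_1 (x) y, a copy of X_1 by (T1).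
  Hence slicing along v is a bounded operator into X_1, and u composed with it serves as u (x) v.
  The same axiom bounds the rank of P (x) Q, whose values on elementary tensors alone would not
  determine it. On the lower side the transpose never appears as an operator: its role is taken by
  estimates on functionals \<open>w\<close>, and the way back from such an estimate to the
  codimension of a range uses norming functionals and the geometric series of the open mapping
  theorem. The almost annihilated factor must be small against the constant of the estimate and the
  number of operators, so that its contribution is absorbed on the left-hand side. In the split
  part, a tuple of which nothing is known gets the trivial parametrix 0 with remainder
  \<open>id\<close>, harmless when the other remainder vanishes. In the Hilbert case X_1 (x) X_2 is
  not known to be Hilbert: the sets of the tensor tuple are squeezed between outer sets that
  coincide.\<close>

lemma bounded_clinearI:
  assumes "\<And>x y. f (x + y) = f x + f y" and "\<And>c x. f (c *\<^sub>C x) = c *\<^sub>C f x"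
    and "\<And>x. norm (f x) \<le> norm x * K"
  shows "bounded_clinear f"
proof -
  have "f (r *\<^sub>R x) = r *\<^sub>R f x" for r x
    using assms(2)[of "complex_of_real r" x] by (simp add: scaleC_of_real)
  then show ?thesis
    unfolding bounded_clinear_def using assms by (auto intro!: bounded_linear_intro[where K=K])
qed

lemma
  assumes "bounded_clinear f"
  shows bounded_clinear_bounded_linear: "bounded_linear f"
    and bounded_clinear_scaleC: "f (c *\<^sub>C x) = c *\<^sub>C f x"
    and bounded_clinear_add: "f (x + y) = f x + f y"
    and bounded_clinear_diff: "f (x - y) = f x - f y"
    and bounded_clinear_zero: "f 0 = 0"
    and bounded_clinear_sum: "f (sum g I) = (\<Sum>i\<in>I. f (g i))"
  using assms by (auto simp: bounded_clinear_def linear_simps bounded_linear.linear linear_sum)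

lemma
  assumes "bounded_clinear f"
  shows bounded_clinear_onorm: "norm (f x) \<le> onorm f * norm x"
    and bounded_clinear_onorm_nonneg: "0 \<le> onorm f"
  using assms by (auto simp: bounded_clinear_def onorm onorm_pos_le)

lemma bounded_clinear_compose:
  assumes "bounded_clinear f" "bounded_clinear g"
  shows "bounded_clinear (\<lambda>x. f (g x))"
  using assms bounded_linear_compose[of f g] by (auto simp: bounded_clinear_def)

lemma bounded_clinear_comp:
  "bounded_clinear f \<Longrightarrow> bounded_clinear g \<Longrightarrow> bounded_clinear (f \<circ> g)"
  using bounded_clinear_compose by (simp add: comp_def)

lemma bounded_clinear_const_zero: "bounded_clinear (\<lambda>x. 0)"
  by (auto intro!: bounded_clinearI[where K=0])

lemma bounded_clinear_ident: "bounded_clinear (\<lambda>x. x)"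
  using bounded_clinear_id by (simp add: id_def)

lemma bounded_clinear_plus:
  "bounded_clinear f \<Longrightarrow> bounded_clinear g \<Longrightarrow> bounded_clinear (\<lambda>x. f x + g x)"
  by (auto simp: bounded_clinear_def scaleC_add_right intro: bounded_linear_add)

lemma bounded_clinear_minus:
  "bounded_clinear f \<Longrightarrow> bounded_clinear g \<Longrightarrow> bounded_clinear (\<lambda>x. f x - g x)"
  by (auto simp: bounded_clinear_def complex_vector.scale_right_diff_distrib
      intro: bounded_linear_sub)

lemma bounded_clinear_sums:
  "(\<And>i. i \<in> I \<Longrightarrow> bounded_clinear (f i)) \<Longrightarrow> bounded_clinear (\<lambda>x. \<Sum>i\<in>I. f i x)"
  by (auto simp: bounded_clinear_def complex_vector.scale_sum_right intro: bounded_linear_sum)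

lemma bounded_clinear_scaleC_right: "bounded_clinear (\<lambda>x. c *\<^sub>C x)"
  by (rule bounded_clinearI[where K="cmod c"])
     (simp_all add: scaleC_add_right scaleC_scaleC mult.commute norm_scaleC)

lemma bounded_clinear_cmul:
  "bounded_clinear f \<Longrightarrow> bounded_clinear (\<lambda>x. c *\<^sub>C f x)"
  by (rule bounded_clinear_compose[OF bounded_clinear_scaleC_right])

lemma bounded_clinear_scaleC_left:
  assumes "bounded_clinear u" shows "bounded_clinear (\<lambda>z. u z *\<^sub>C x)"
proof (rule bounded_clinearI[where K="onorm u * norm x"])
  show "norm (u z *\<^sub>C x) \<le> norm z * (onorm u * norm x)" for z
    using mult_right_mono[OF bounded_clinear_onorm[OF assms, of z] norm_ge_zero[of x]]
    by (simp add: norm_scaleC mult_ac)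
qed (simp_all add: bounded_clinear_add[OF assms]
  bounded_clinear_scaleC[OF assms] scaleC_add_left scaleC_scaleC scaleC_complex_def)

lemma bounded_clinear_rank_one: "bounded_clinear u \<Longrightarrow> bounded_clinear (rank_one_op x u)"
  unfolding rank_one_op_def by (rule bounded_clinear_scaleC_left)

lemma bounded_clinear_vec_nth: "bounded_clinear (\<lambda>x. x $ i)"
  by (rule bounded_clinearI[where K=1]) (auto simp: scaleC_vec_def Finite_Cartesian_Product.norm_nth_le)

lemma bounded_clinear_vec_lambda:
  fixes f :: "'n::finite \<Rightarrow> 'a::complex_normed_vector \<Rightarrow> 'b::complex_normed_vector"
  assumes "\<And>i. bounded_clinear (f i)"
  shows "bounded_clinear (\<lambda>x. \<chi> i. f i x)"
proof (rule bounded_clinearI[where K="\<Sum>i\<in>UNIV. onorm (f i)"])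
  fix x
  have "norm (\<chi> i. f i x) \<le> (\<Sum>i\<in>UNIV. norm (f i x))"
    unfolding norm_vec_def using L2_set_le_sum_abs[of "\<lambda>i. norm (f i x)" UNIV] by simp
  also have "\<dots> \<le> (\<Sum>i\<in>UNIV. onorm (f i) * norm x)"
    by (intro sum_mono bounded_clinear_onorm assms)
  finally show "norm (\<chi> i. f i x) \<le> norm x * (\<Sum>i\<in>UNIV. onorm (f i))"
    by (simp add: sum_distrib_left mult.commute)
qed (simp_all add: vec_eq_iff scaleC_vec_def bounded_clinear_add[OF assms]
  bounded_clinear_scaleC[OF assms])

lemma bounded_clinear_col_op:
  "(\<And>i. bounded_clinear (T i)) \<Longrightarrow> bounded_clinear (col_op T)"
  using bounded_clinear_vec_lambda[of T] by (simp add: col_op_def[abs_def])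

lemma bounded_clinear_row_op:
  "(\<And>i. bounded_clinear (T i)) \<Longrightarrow> bounded_clinear (row_op T)"
  unfolding row_op_def[abs_def]
  by (intro bounded_clinear_sums bounded_clinear_compose[OF _ bounded_clinear_vec_nth])

lemma bounded_clinear_axis: "bounded_clinear (\<lambda>x. axis i x)"
  unfolding axis_def
  by (rule bounded_clinear_vec_lambda, case_tac "ia = i")
     (simp_all add: bounded_clinear_ident bounded_clinear_const_zero)

lemma row_op_axis:
  assumes "\<And>i. bounded_clinear (T i)"
  shows "row_op T (axis i x) = T i x"
proof -
  have "(\<Sum>j\<in>UNIV. T j (axis i x $ j)) = (\<Sum>j\<in>UNIV. if i = j then T j x else 0)"
    by (intro sum.cong) (auto simp: axis_def bounded_clinear_zero[OF assms])
  then show ?thesis by (simp add: row_op_def)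
qed

lemma subspace_real_of_complex:
  "complex_vector.subspace V \<Longrightarrow> subspace V"
  unfolding complex_vector.subspace_def subspace_def
  by (metis scaleC_of_real)

lemma subspace_null_space:
  "bounded_clinear f \<Longrightarrow> complex_vector.subspace (null_space f)"
  by (auto simp: complex_vector.subspace_def null_space_def bounded_clinear_zero
      bounded_clinear_add bounded_clinear_scaleC)

lemma subspace_image:
  assumes f: "bounded_clinear f" and V: "complex_vector.subspace V"
  shows "complex_vector.subspace (f ` V)"
  unfolding complex_vector.subspace_def
proof (intro conjI ballI allI)
  show "0 \<in> f ` V"
    using bounded_clinear_zero[OF f] complex_vector.subspace_0[OF V] by force
  show "x + y \<in> f ` V" if "x \<in> f ` V" "y \<in> f ` V" for x y
    using that bounded_clinear_add[OF f] complex_vector.subspace_add[OF V]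
    by (auto simp: image_iff) metis
  show "c *\<^sub>C x \<in> f ` V" if "x \<in> f ` V" for c x
    using that bounded_clinear_scaleC[OF f] complex_vector.subspace_scale[OF V]
    by (auto simp: image_iff) metis
qed

lemma closed_null_space: "bounded_clinear f \<Longrightarrow> closed (null_space f)"
  unfolding null_space_def
  by (intro closed_Collect_eq linear_continuous_on bounded_clinear_bounded_linear continuous_on_const)

section \<open>The Hahn-Banach theorem\<close>

definition sublinear :: "('a::real_vector \<Rightarrow> real) \<Rightarrow> bool" where
  "sublinear q \<longleftrightarrow> (\<forall>x y. q (x + y) \<le> q x + q y) \<and> (\<forall>t>0. \<forall>x. q (t *\<^sub>R x) = t * q x) \<and> q 0 = 0"

lemma
  assumes q: "sublinear q"
  shows sublinear_add: "q (x + y) \<le> q x + q y"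
    and sublinear_scale: "0 \<le> t \<Longrightarrow> q (t *\<^sub>R x) = t * q x"
    and sublinear_zero: "q 0 = 0"
    and sublinear_neg: "- q (- x) \<le> q x"
proof -
  show add: "q (x + y) \<le> q x + q y" for x y using q by (simp add: sublinear_def)
  show zero: "q 0 = 0" using q by (simp add: sublinear_def)
  show "q (t *\<^sub>R x) = t * q x" if "0 \<le> t"
    using q that by (cases "t = 0") (simp_all add: sublinear_def)
  show "- q (- x) \<le> q x" using add[of x "- x"] zero by simp
qed

text \<open>The bound does not involve \<open>t\<close>, so the infimum that defines
  \<open>directional\<close> below is taken over a set bounded from below.\<close>

lemma sublinear_lower:
  assumes "sublinear q" "0 \<le> t"
  shows "- q (- x) \<le> q (x + t *\<^sub>R y) - t * q y"
proof -
  have "t * q y = q ((x + t *\<^sub>R y) + (- x))"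
    using sublinear_scale[OF assms] by simp
  also have "\<dots> \<le> q (x + t *\<^sub>R y) + q (- x)" by (rule sublinear_add[OF assms(1)])
  finally show ?thesis by simp
qed

text \<open>For sublinear \<open>q\<close> this is the largest sublinear functional below
  \<open>q\<close> whose value at \<open>- y\<close> is at most \<open>- q y\<close>: any such r
  satisfies r x \<le> r (x + t y) + r (- t y) \<le> q (x + t y) - t q y.\<close>

definition directional :: "('a::real_vector \<Rightarrow> real) \<Rightarrow> 'a \<Rightarrow> 'a \<Rightarrow> real" where
  "directional q y x = (INF t\<in>{0..}. q (x + t *\<^sub>R y) - t * q y)"

lemma directional_le:
  assumes "sublinear q" "0 \<le> t"
  shows "directional q y x \<le> q (x + t *\<^sub>R y) - t * q y"
  unfolding directional_def using assms
  by (intro cINF_lower bdd_belowI2[where m="- q (- x)"]) (auto intro: sublinear_lower)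

lemma directional_greatest:
  assumes "\<And>t. 0 \<le> t \<Longrightarrow> m \<le> q (x + t *\<^sub>R y) - t * q y"
  shows "m \<le> directional q y x"
  unfolding directional_def using assms by (intro cINF_greatest) auto

text \<open>Admissible parameters may be added and rescaled: \<open>s\<close> for \<open>a\<close>
  and \<open>t\<close> for \<open>b\<close> give \<open>s + t\<close> for \<open>a + b\<close>, and
  \<open>t\<close> for \<open>x\<close> gives \<open>s * t\<close> for \<open>s x\<close>. The
  infima are then taken one at a time; homogeneity follows from one inequality applied to both
  \<open>s\<close> and \<open>1 / s\<close>.\<close>

lemma sublinear_directional:
  assumes q: "sublinear q"
  shows "sublinear (directional q y)"
  unfolding sublinear_def
proof (intro conjI allI impI)
  let ?d = "directional q y"
  show "?d (a + b) \<le> ?d a + ?d b" for a b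
  proof -
    have *: "?d (a + b) \<le> (q (a + s *\<^sub>R y) - s * q y) + (q (b + t *\<^sub>R y) - t * q y)"
      if "0 \<le> s" "0 \<le> t" for s t
    proof -
      have "?d (a + b) \<le> q ((a + b) + (s + t) *\<^sub>R y) - (s + t) * q y"
        using that by (intro directional_le q) auto
      also have "(a + b) + (s + t) *\<^sub>R y = (a + s *\<^sub>R y) + (b + t *\<^sub>R y)"
        by (simp add: algebra_simps)
      finally show ?thesis
        using sublinear_add[OF q, of "a + s *\<^sub>R y" "b + t *\<^sub>R y"] by (simp add: algebra_simps)
    qed
    have "?d (a + b) - (q (a + s *\<^sub>R y) - s * q y) \<le> ?d b" if "0 \<le> s" for s
      using *[OF that] by (intro directional_greatest) (simp add: algebra_simps)
    then have "?d (a + b) - ?d b \<le> ?d a"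
      by (intro directional_greatest) (simp add: algebra_simps)
    then show ?thesis by simp
  qed
  have scale_le: "?d (s *\<^sub>R x) \<le> s * ?d x" if "0 < s" for s x
  proof -
    have "?d (s *\<^sub>R x) / s \<le> q (x + t *\<^sub>R y) - t * q y" if "0 \<le> t" for t
    proof -
      have "?d (s *\<^sub>R x) \<le> q (s *\<^sub>R x + (s * t) *\<^sub>R y) - (s * t) * q y"
        using \<open>0 < s\<close> that by (intro directional_le q) auto
      also have "s *\<^sub>R x + (s * t) *\<^sub>R y = s *\<^sub>R (x + t *\<^sub>R y)" by (simp add: algebra_simps)
      also have "q (s *\<^sub>R (x + t *\<^sub>R y)) = s * q (x + t *\<^sub>R y)"
        using \<open>0 < s\<close> by (simp add: sublinear_scale[OF q])
      also have "s * q (x + t *\<^sub>R y) - s * t * q y = s * (q (x + t *\<^sub>R y) - t * q y)"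
        by (simp add: algebra_simps)
      finally show ?thesis
        using \<open>0 < s\<close> by (simp add: pos_divide_le_eq mult.commute)
    qed
    then have "?d (s *\<^sub>R x) / s \<le> ?d x" by (rule directional_greatest)
    then show ?thesis using \<open>0 < s\<close> by (simp add: field_simps)
  qed
  show "?d (s *\<^sub>R x) = s * ?d x" if "0 < s" for s x
  proof (rule antisym[OF scale_le[OF that]])
    have "?d ((1 / s) *\<^sub>R (s *\<^sub>R x)) \<le> (1 / s) * ?d (s *\<^sub>R x)"
      using that by (intro scale_le) auto
    then show "s * ?d x \<le> ?d (s *\<^sub>R x)" using that by (simp add: field_simps)
  qed
  show "?d 0 = 0"
  proof (rule antisym)
    show "?d 0 \<le> 0" using directional_le[OF q, of 0 y 0] by (simp add: sublinear_zero[OF q])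
    show "0 \<le> ?d 0" by (intro directional_greatest) (simp add: sublinear_scale[OF q])
  qed
qed

lemma directional_below:
  assumes "sublinear q" shows "directional q y x \<le> q x"
  using directional_le[OF assms, of 0 y x] by simp

lemma directional_neg:
  assumes "sublinear q" shows "directional q y (- y) \<le> - q y"
  using directional_le[OF assms, of 1 y "- y"] by (simp add: sublinear_zero[OF assms])

text \<open>A minimal sublinear functional coincides with its directional modifications, which makes
  it odd and hence linear.\<close>

lemma minimal_sublinear_linear:
  assumes q: "sublinear q" and min: "\<And>r. sublinear r \<Longrightarrow> r \<le> q \<Longrightarrow> r = q"
  shows "linear q"
proof -
  have odd: "q (- y) = - q y" for y
  proof (rule antisym)
    have "directional q y = q"
      using directional_below[OF q] by (intro min sublinear_directional q) (auto simp: le_fun_def)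
    then show "q (- y) \<le> - q y" using directional_neg[OF q, of y] by simp
    show "- q y \<le> q (- y)" using sublinear_neg[OF q, of y] by simp
  qed
  show ?thesis
  proof (rule linearI)
    fix a b
    have "q (- a + - b) \<le> q (- a) + q (- b)" by (rule sublinear_add[OF q])
    then have "q a + q b \<le> q (a + b)" using odd[of "a + b"] by (simp add: odd)
    then show "q (a + b) = q a + q b" using sublinear_add[OF q, of a b] by simp
  next
    fix t :: real and x
    show "q (t *\<^sub>R x) = t *\<^sub>R q x"
    proof (cases "0 \<le> t")
      case True then show ?thesis by (simp add: sublinear_scale[OF q])
    next
      case False
      then have "q ((- t) *\<^sub>R x) = (- t) * q x" by (intro sublinear_scale q) auto
      then show ?thesis using odd[of "t *\<^sub>R x"] by simp
    qed
  qed
qed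

text \<open>The infimum of sublinear functionals is in general not subadditive. In a chain it is,
  because the smaller of \<open>q\<close> and \<open>r\<close> is a single functional that bounds
  both \<open>q a\<close> and \<open>r b\<close> from below. The common lower bound
  \<open>- p (- x)\<close> keeps the infimum meaningful.\<close>

lemma sublinear_Inf_chain:
  assumes C: "\<And>q. q \<in> C \<Longrightarrow> sublinear q \<and> q \<le> p" "C \<noteq> {}"
    and chain: "\<And>q r. q \<in> C \<Longrightarrow> r \<in> C \<Longrightarrow> q \<le> r \<or> r \<le> q"
  shows "sublinear (\<lambda>x. INF q\<in>C. q x)" (is "sublinear ?m")
    and "\<And>q. q \<in> C \<Longrightarrow> (\<lambda>x. INF q\<in>C. q x) \<le> q"
proof -
  have "- p (- x) \<le> q x" if "q \<in> C" for q x
    using sublinear_neg[of q x] C(1)[OF that] le_funD[of q p "- x"] by linarith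
  then have lower: "?m x \<le> q x" if "q \<in> C" for q x
    using that by (intro cINF_lower bdd_belowI2[where m="- p (- x)"]) auto
  have greatest: "m \<le> ?m x" if "\<And>q. q \<in> C \<Longrightarrow> m \<le> q x" for m x
    using that C(2) by (intro cINF_greatest) auto
  show "?m \<le> q" if "q \<in> C" for q
    using lower[OF that] by (simp add: le_fun_def)
  show "sublinear ?m"
    unfolding sublinear_def
  proof (intro conjI allI impI)
    show "?m (a + b) \<le> ?m a + ?m b" for a b
    proof -
      have *: "?m (a + b) \<le> q a + r b" if "q \<in> C" "r \<in> C" for q r
      proof -
        obtain s where s: "s \<in> C" "s \<le> q" "s \<le> r"
          using chain[of q r] \<open>q \<in> C\<close> \<open>r \<in> C\<close> by blast
        have "?m (a + b) \<le> s (a + b)" by (rule lower[OF s(1)])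
        also have "\<dots> \<le> s a + s b" using C(1)[OF s(1)] by (simp add: sublinear_add)
        also have "\<dots> \<le> q a + r b" using s(2,3) by (intro add_mono) (auto simp: le_fun_def)
        finally show ?thesis .
      qed
      have "?m (a + b) - q a \<le> ?m b" if "q \<in> C" for q
        using *[OF that] by (intro greatest) (simp add: algebra_simps)
      then have "?m (a + b) - ?m b \<le> ?m a" by (intro greatest) (simp add: algebra_simps)
      then show ?thesis by simp
    qed
    have scale_le: "?m (s *\<^sub>R x) \<le> s * ?m x" if "0 < s" for s x
    proof -
      have "?m (s *\<^sub>R x) / s \<le> ?m x"
      proof (rule greatest)
        fix q assume q: "q \<in> C"
        have "?m (s *\<^sub>R x) \<le> s * q x"
          using lower[OF q, of "s *\<^sub>R x"] C(1)[OF q] that by (simp add: sublinear_scale)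
        then show "?m (s *\<^sub>R x) / s \<le> q x" using that by (simp add: field_simps)
      qed
      then show ?thesis using that by (simp add: field_simps)
    qed
    show "?m (s *\<^sub>R x) = s * ?m x" if "0 < s" for s x
    proof (rule antisym[OF scale_le[OF that]])
      have "?m ((1 / s) *\<^sub>R (s *\<^sub>R x)) \<le> (1 / s) * ?m (s *\<^sub>R x)"
        using that by (intro scale_le) auto
      then show "s * ?m x \<le> ?m (s *\<^sub>R x)" using that by (simp add: field_simps)
    qed
    have "q 0 = 0" if "q \<in> C" for q using C(1)[OF that] by (simp add: sublinear_zero)
    then have "(\<lambda>q. q 0) ` C = {0}" using C(2) by (auto simp: image_iff)
    then show "?m 0 = 0" by simp
  qed
qed

theorem hahn_banach_sublinear:
  fixes p :: "'a::real_vector \<Rightarrow> real"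
  assumes p: "sublinear p"
  shows "\<exists>f. linear f \<and> f \<le> p"
proof -
  define A where "A = {q. sublinear q \<and> q \<le> p}"
  have "\<exists>m\<in>A. \<forall>a\<in>A. a \<le> m \<longrightarrow> a = m"
  proof (rule predicate_Zorn)
    \<comment> \<open>The order is reversed, so that the maximal element delivered by Zorn's lemma
      is a minimal sublinear functional. The empty chain is bounded by \<open>p\<close> itself,
      since its pointwise infimum would be meaningless.\<close>
    show "partial_order_on A (relation_of (\<lambda>q r. r \<le> q) A)"
      by (rule partial_order_on_relation_ofI) auto
  next
    fix C assume "C \<in> Chains (relation_of (\<lambda>q r. r \<le> q) A)"
    then have C: "C \<subseteq> A" "\<And>q r. q \<in> C \<Longrightarrow> r \<in> C \<Longrightarrow> q \<le> r \<or> r \<le> q"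
      by (auto simp: Chains_def relation_of_def)
    show "\<exists>u\<in>A. \<forall>a\<in>C. u \<le> a"
    proof (cases "C = {}")
      case True then show ?thesis using p by (auto simp: A_def)
    next
      case False
      have CA: "sublinear q \<and> q \<le> p" if "q \<in> C" for q using C(1) that by (auto simp: A_def)
      note m = sublinear_Inf_chain[OF CA False C(2)]
      show ?thesis
        using m False CA by (intro bexI[of _ "\<lambda>x. INF q\<in>C. q x"]) (auto simp: A_def intro: order_trans)
    qed
  qed
  then obtain m where m: "m \<in> A" "\<And>a. a \<in> A \<Longrightarrow> a \<le> m \<Longrightarrow> a = m" by blast
  then have "linear m"
    by (intro minimal_sublinear_linear) (auto simp: A_def)
  then show ?thesis using m(1) by (auto simp: A_def)
qed

text \<open>A linear \<open>f\<close> below \<open>directional p y\<close>, and not merely below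
  \<open>p\<close>, satisfies f (- y) \<le> - p y and hence f y = p y. The norming value at
  \<open>y\<close> is thus obtained without extending a functional from the line through
  \<open>y\<close>.\<close>

theorem hahn_banach_seminorm:
  fixes p :: "'a::complex_vector \<Rightarrow> real"
  assumes add: "\<And>x y. p (x + y) \<le> p x + p y" and scale: "\<And>c x. p (c *\<^sub>C x) = cmod c * p x"
  obtains u where "\<And>x y. u (x + y) = u x + u y" "\<And>c x. u (c *\<^sub>C x) = c * u x"
    "\<And>x. cmod (u x) \<le> p x" "u y = complex_of_real (p y)"
proof -
  have scaleR: "p (t *\<^sub>R x) = \<bar>t\<bar> * p x" for t x
    using scale[of "complex_of_real t" x] by (simp add: scaleC_of_real)
  have p: "sublinear p"
    using add scaleR scaleR[of 0 0] by (auto simp: sublinear_def)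
  obtain f where f: "linear f" "f \<le> directional p y"
    using hahn_banach_sublinear[OF sublinear_directional[OF p]] by blast
  have f_le: "f x \<le> p x" for x
    using f(2) directional_below[OF p, of y x] by (meson le_funD order_trans)
  have "- f y \<le> - p y"
    using le_funD[OF f(2), of "- y"] directional_neg[OF p, of y] by (simp add: linear_neg[OF f(1)])
  then have fy: "f y = p y" using f_le[of y] by simp
  \<comment> \<open>The only complex-linear functional with real part \<open>f\<close>: its
    imaginary part at \<open>x\<close> has to be minus its real part at i x.\<close>
  define u where "u x = Complex (f x) (- f (\<i> *\<^sub>C x))" for x
  have u_add: "u (a + b) = u a + u b" for a b
    by (simp add: u_def complex_eq_iff linear_add[OF f(1)] scaleC_add_right)
  have ux: "c *\<^sub>C x = Re c *\<^sub>R x + Im c *\<^sub>R (\<i> *\<^sub>C x)" for c x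
  proof -
    have "c = complex_of_real (Re c) + complex_of_real (Im c) * \<i>" by (simp add: complex_eq_iff)
    then have "c *\<^sub>C x = (complex_of_real (Re c) + complex_of_real (Im c) * \<i>) *\<^sub>C x" by simp
    then show ?thesis by (simp only: scaleC_add_left scaleC_scaleC[symmetric] scaleC_of_real)
  qed
  have u_scale: "u (c *\<^sub>C x) = c * u x" for c x
  proof -
    have "\<i> *\<^sub>C c *\<^sub>C x = (\<i> * c) *\<^sub>C x" by (simp only: scaleC_scaleC)
    then show ?thesis
      using ux[of c x] ux[of "\<i> * c" x]
      by (simp add: u_def complex_eq_iff linear_add[OF f(1)] linear_diff[OF f(1)] linear_neg[OF f(1)] linear_scale[OF f(1)])
  qed
  have u_le: "cmod (u x) \<le> p x" for x
  proof (cases "u x = 0")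
    case True
    have "0 \<le> p x + p (- x)" using add[of x "- x"] scaleR[of 0 0] by simp
    then show ?thesis using scaleR[of "-1" x] True by simp
  next
    case False
    \<comment> \<open>Rotating \<open>x\<close> by the phase of \<open>u x\<close> makes the value
      real and nonnegative, so that it is a value of \<open>f\<close> and can be compared with the
      seminorm.\<close>
    define c where "c = cnj (u x) / cmod (u x)"
    have "cmod c = 1" using False by (simp add: c_def norm_divide)
    have "u (c *\<^sub>C x) = complex_of_real (cmod (u x))"
      using False by (simp add: u_scale c_def complex_norm_square[symmetric] power2_eq_square mult.commute)
    then have "cmod (u x) = f (c *\<^sub>C x)" by (simp add: u_def complex_eq_iff)
    also have "\<dots> \<le> p (c *\<^sub>C x)" by (rule f_le)
    finally show ?thesis by (simp add: scale \<open>cmod c = 1\<close>)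
  qed
  have "u y = complex_of_real (p y)"
  proof -
    have Re: "Re (u y) = p y" by (simp add: u_def fy)
    have "p y \<ge> 0" using u_le[of y] norm_ge_zero[of "u y"] by linarith
    \<comment> \<open>The real part alone already exhausts the bound \<open>p y\<close> on the
      modulus, which leaves no room for an imaginary part.\<close>
    then have "(Re (u y))\<^sup>2 + (Im (u y))\<^sup>2 \<le> (p y)\<^sup>2"
      using u_le[of y] by (metis cmod_power2 norm_ge_zero power_mono)
    then have "Im (u y) = 0" using Re by simp
    then show ?thesis using Re by (simp add: complex_eq_iff)
  qed
  then show ?thesis using that u_add u_scale u_le by blast
qed

section \<open>Open mappings and finite-dimensional subspaces\<close>

text \<open>The geometric series argument of the open mapping theorem.\<close>

lemma approximate_solution_imp_solution:
  fixes g :: "'e::banach \<Rightarrow> 'x::real_normed_vector"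
  assumes g: "bounded_linear g" and M: "subspace M" "closed M" and N: "subspace N" "g ` M \<subseteq> N"
    and C: "0 \<le> C" "\<And>x. x \<in> N \<Longrightarrow> \<exists>m\<in>M. norm m \<le> C * norm x \<and> norm (x - g m) \<le> norm x / 2"
    and x: "x \<in> N"
  shows "\<exists>m\<in>M. g m = x \<and> norm m \<le> 2 * C * norm x"
proof -
  obtain h where h: "\<And>x. x \<in> N \<Longrightarrow> h x \<in> M \<and> norm (h x) \<le> C * norm x \<and> norm (x - g (h x)) \<le> norm x / 2"
    using C(2) by metis
  \<comment> \<open>The residual after \<open>k\<close> corrections. It stays in \<open>N\<close>
    because \<open>g\<close> maps \<open>M\<close> into \<open>N\<close>, so the approximate
    solution \<open>h\<close> can be applied again, and it is halved each time. \<open>h\<close> is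
    an arbitrary selection; no linearity of it enters.\<close>
  define r where "r k = ((\<lambda>x. x - g (h x)) ^^ k) x" for k
  have r_Suc: "r (Suc k) = r k - g (h (r k))" for k by (simp add: r_def)
  have rN: "r k \<in> N" for k
  proof (induction k)
    case (Suc k)
    have "g (h (r k)) \<in> N" using h[OF Suc] N(2) by blast
    then show ?case using Suc N(1) by (simp add: r_Suc subspace_diff)
  qed (use x in \<open>simp add: r_def\<close>)
  have r_norm: "norm (r k) \<le> norm x * (1/2)^k" for k
  proof (induction k)
    case (Suc k)
    have "norm (r (Suc k)) \<le> norm (r k) / 2" using h[OF rN] by (simp add: r_Suc)
    then show ?case using Suc by simp
  qed (simp add: r_def)
  have h_norm: "norm (h (r k)) \<le> C * norm x * (1/2)^k" for k
    using h[OF rN, of k] mult_left_mono[OF r_norm C(1), of k] by (simp add: mult.assoc)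
  have geo: "(\<lambda>k. C * norm x * (1/2)^k) sums (C * norm x * 2)"
    using sums_mult[OF geometric_sums[of "1/2::real"], of "C * norm x"] by simp
  have summ: "summable (\<lambda>k. norm (h (r k)))"
    by (rule summable_comparison_test'[OF sums_summable[OF geo], of 0]) (use h_norm in simp)
  define m where "m = (\<Sum>k. h (r k))"
  have msums: "(\<lambda>k. h (r k)) sums m"
    unfolding m_def by (rule summable_sums[OF summable_norm_cancel[OF summ]])
  have "m \<in> M"
  proof (rule closed_sequentially[OF M(2)])
    show "(\<lambda>n. \<Sum>k<n. h (r k)) \<longlonglongrightarrow> m" using msums by (simp add: sums_def)
    show "(\<Sum>k<n. h (r k)) \<in> M" for n using h[OF rN] by (intro subspace_sum M(1)) auto
  qed
  moreover have "norm m \<le> 2 * C * norm x"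
  proof -
    have "norm m \<le> (\<Sum>k. norm (h (r k)))" unfolding m_def by (rule summable_norm[OF summ])
    also have "\<dots> \<le> (\<Sum>k. C * norm x * (1/2)^k)"
      by (rule suminf_le[OF h_norm summ sums_summable[OF geo]])
    also have "\<dots> = C * norm x * 2" using geo by (simp add: sums_iff)
    finally show ?thesis by simp
  qed
  moreover have "g m = x"
  proof -
    have "(\<lambda>n. g (\<Sum>k<n. h (r k))) \<longlonglongrightarrow> g m"
      using msums by (intro bounded_linear.tendsto[OF g]) (simp add: sums_def)
    moreover have "g (\<Sum>k<n. h (r k)) = x - r n" for n
    proof (induction n)
      case 0 show ?case by (simp add: r_def linear_simps[OF g])
    next
      case (Suc n) then show ?case by (simp add: r_Suc linear_simps[OF g])
    qed
    moreover have "r \<longlonglongrightarrow> 0"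
    proof (rule Lim_null_comparison)
      show "\<forall>\<^sub>F n in sequentially. norm (r n) \<le> norm x * (1/2)^n" using r_norm by simp
      show "(\<lambda>n. norm x * (1/2)^n) \<longlonglongrightarrow> 0"
        by (intro tendsto_mult_right_zero LIMSEQ_realpow_zero) auto
    qed
    then have "(\<lambda>n. x - r n) \<longlonglongrightarrow> x - 0" by (intro tendsto_diff tendsto_const)
    ultimately show ?thesis by (simp add: LIMSEQ_unique)
  qed
  ultimately show ?thesis by blast
qed

text \<open>Baire's theorem is applied inside the image of \<open>M\<close>, which is complete
  because it is closed. What is returned are preimages of controlled norm, not a linear inverse.
  Working with closed real subspaces lets the result be applied to products such as
  \<open>L \<times> F\<close>, where the map is (l, f) -> A l + f.\<close>

theorem open_mapping:
  fixes g :: "'e::banach \<Rightarrow> 'x::banach"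
  assumes g: "bounded_linear g" and M: "subspace M" "closed M" and cl: "closed (g ` M)"
  obtains C where "0 \<le> C" "\<forall>x\<in>g ` M. \<exists>m\<in>M. g m = x \<and> norm m \<le> C * norm x"
proof -
  let ?N = "g ` M"
  let ?X = "top_of_set ?N"
  have N: "subspace ?N"
    by (rule linear_subspace_image[OF bounded_linear.linear[OF g] M(1)])
  define G where "G k = ?N \<inter> closure (g ` (M \<inter> cball 0 (real k)))" for k
  have "\<exists>k. ?X interior_of G k \<noteq> {}"
  proof (rule ccontr)
    assume empty: "\<nexists>k. ?X interior_of G k \<noteq> {}"
    have "?X interior_of \<Union>(range G) = {}"
    proof (rule Baire_category_alt)
      show "completely_metrizable_space ?X \<or> locally_compact_space ?X \<and> regular_space ?X"
        using completely_metrizable_space_closedin[OF completely_metrizable_space_euclidean closed_closedin[THEN iffD1, OF cl]]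
        by (rule disjI1)
      show "closedin ?X T \<and> ?X interior_of T = {}" if "T \<in> range G" for T
      proof -
        obtain k where k: "T = G k" using \<open>T \<in> range G\<close> by blast
        have "closedin ?X (G k)" unfolding G_def by (intro closedin_closed_Int closed_closure)
        then show ?thesis using empty k by simp
      qed
    qed simp
    moreover have "\<Union>(range G) = ?N"
    proof
      show "?N \<subseteq> \<Union>(range G)"
      proof
        fix x assume "x \<in> ?N"
        then obtain m where m: "m \<in> M" "x = g m" by blast
        obtain k where "norm m \<le> real k" by (rule exE[OF real_arch_simple])
        then have "x \<in> g ` (M \<inter> cball 0 (real k))" using m by (intro image_eqI[of _ _ m]) auto
        then have "x \<in> closure (g ` (M \<inter> cball 0 (real k)))" by (rule subsetD[OF closure_subset])
        then have "x \<in> G k" using \<open>x \<in> ?N\<close> by (simp add: G_def)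
        then show "x \<in> \<Union>(range G)" by blast
      qed
      show "\<Union>(range G) \<subseteq> ?N" unfolding G_def by blast
    qed
    moreover have "?X interior_of ?N = ?N"
      using interior_of_topspace[of ?X] by (simp only: topspace_euclidean_subtopology)
    ultimately have "?N = {}" by simp
    then show False using subspace_0[OF N] by blast
  qed
  then obtain k x0 where "x0 \<in> ?X interior_of G k" by blast
  then obtain T where T: "openin ?X T" "x0 \<in> T" "T \<subseteq> G k" unfolding interior_of_def by blast
  have Tball: "T \<subseteq> ?N \<and> (\<forall>x\<in>T. \<exists>e>0. ball x e \<inter> ?N \<subseteq> T)"
    using openin_contains_ball[THEN iffD1, OF T(1)] .
  have "x0 \<in> ?N" by (rule subsetD[OF conjunct1[OF Tball] T(2)])
  moreover have "\<exists>e>0. ball x0 e \<inter> ?N \<subseteq> T" by (rule bspec[OF conjunct2[OF Tball] T(2)])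
  ultimately obtain r where r: "0 < r" "ball x0 r \<inter> ?N \<subseteq> T" "x0 \<in> ?N" by metis
  have G_approx: "\<exists>m\<in>M. norm m \<le> real k \<and> dist (g m) y < e" if "y \<in> G k" "0 < e" for y e
  proof -
    have "y \<in> closure (g ` (M \<inter> cball 0 (real k)))" using that(1) by (simp add: G_def)
    then have "\<exists>z\<in>g ` (M \<inter> cball 0 (real k)). dist z y < e"
      using that(2) closure_approachable by metis
    then show ?thesis by auto
  qed
  \<comment> \<open>A ball around \<open>x0\<close> is turned into one around 0 by subtracting an
    approximate preimage of \<open>x0\<close> from one of \<open>x0 + x\<close>; this doubles the
    radius \<open>k\<close>, and each of the two errors is allowed e / 2.\<close>
  have approx: "\<exists>m\<in>M. norm m \<le> 2 * real k \<and> norm (x - g m) \<le> e"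
    if x: "x \<in> ?N" "norm x < r" and e: "0 < e" for x e
  proof -
    have "x0 + x \<in> ?N" using subspace_add[OF N r(3) x(1)] .
    moreover have "x0 + x \<in> ball x0 r" using x(2) by (simp add: dist_norm)
    ultimately have "x0 + x \<in> G k" using r(2) T(3) by blast
    from G_approx[OF this, of "e / 2"] e
    obtain m1 where m1: "m1 \<in> M" "norm m1 \<le> real k" "dist (g m1) (x0 + x) < e / 2" by auto
    have "x0 \<in> G k" using T(2,3) by blast
    from G_approx[OF this, of "e / 2"] e
    obtain m2 where m2: "m2 \<in> M" "norm m2 \<le> real k" "dist (g m2) x0 < e / 2" by auto
    have "norm (x - g (m1 - m2)) = norm ((g m2 - x0) - (g m1 - (x0 + x)))"
      by (rule arg_cong[where f=norm]) (simp add: linear_simps[OF g] algebra_simps)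
    also have "\<dots> \<le> norm (g m2 - x0) + norm (g m1 - (x0 + x))" by (rule norm_triangle_ineq4)
    also have "\<dots> \<le> e" using m1(3) m2(3) by (simp add: dist_norm)
    finally show ?thesis
      using m1 m2 norm_triangle_ineq4[of m1 m2] by (intro bexI[of _ "m1 - m2"]) (auto simp: subspace_diff[OF M(1)])
  qed
  \<comment> \<open>A vector is rescaled by s = r / (2 norm x) to norm r / 2, inside the ball. Its
    approximate preimage has norm at most 2 k and error at most r / 4; scaling back turns these into
    (4 k / r) norm x and norm x / 2.\<close>
  define C where "C = 4 * real k / r"
  have C: "0 \<le> C" using r(1) by (simp add: C_def)
  have half: "\<exists>m\<in>M. norm m \<le> C * norm x \<and> norm (x - g m) \<le> norm x / 2" if x: "x \<in> ?N" for x
  proof (cases "x = 0")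
    case True
    then show ?thesis using subspace_0[OF M(1)] by (intro bexI[of _ 0]) (auto simp: linear_simps[OF g])
  next
    case False
    define s where "s = r / (2 * norm x)"
    have s: "0 < s" using False r(1) by (simp add: s_def)
    have "norm (s *\<^sub>R x) = r / 2" using r(1) False by (simp add: s_def)
    then have "s *\<^sub>R x \<in> ?N" "norm (s *\<^sub>R x) < r"
      using subspace_scale[OF N x] r(1) by auto
    from approx[OF this, of "r / 4"] r(1) obtain m
      where m: "m \<in> M" "norm m \<le> 2 * real k" "norm (s *\<^sub>R x - g m) \<le> r / 4" by auto
    have "s *\<^sub>R x - g m = s *\<^sub>R (x - g ((1/s) *\<^sub>R m))"
      using s by (simp add: linear_simps[OF g] algebra_simps)
    then have "s * norm (x - g ((1/s) *\<^sub>R m)) \<le> r / 4" using m(3) s by simp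
    also have "r / 4 = s * (norm x / 2)" using False by (simp add: s_def)
    finally have "norm (x - g ((1/s) *\<^sub>R m)) \<le> norm x / 2" using s by simp
    moreover have "norm ((1/s) *\<^sub>R m) \<le> C * norm x"
    proof -
      have "norm ((1/s) *\<^sub>R m) = (1/s) * norm m" using s by simp
      also have "\<dots> \<le> (1/s) * (2 * real k)" using s m(2) by (intro mult_left_mono) auto
      also have "\<dots> = C * norm x" using False r(1) by (simp add: s_def C_def field_simps)
      finally show ?thesis .
    qed
    ultimately show ?thesis using subspace_scale[OF M(1) m(1)] by blast
  qed
  show ?thesis
    using approximate_solution_imp_solution[OF g M N order_refl C half] C
    by (intro that[of "2 * C"] ballI) auto
qed

text \<open>The distance to \<open>W\<close> is a seminorm below the norm that vanishes on
  \<open>W\<close> and, as \<open>W\<close> is closed, is positive at \<open>b\<close>. A functional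
  norming \<open>b\<close> for this seminorm therefore is bounded, kills \<open>W\<close> and needs
  only to be divided by the distance of \<open>b\<close>.\<close>

lemma functional_vanishing_on_closed_subspace:
  fixes W :: "'a::complex_normed_vector set"
  assumes W: "complex_vector.subspace W" "closed W" and b: "b \<notin> W"
  obtains u :: "'a \<Rightarrow> complex" where "bounded_clinear u" "\<And>x. x \<in> W \<Longrightarrow> u x = 0" "u b = 1"
proof -
  let ?p = "\<lambda>x. infdist x W"
  have ne: "W \<noteq> {}" using complex_vector.subspace_0[OF W(1)] by blast
  have INF: "?p x = (INF w\<in>W. norm (x - w))" for x
    by (simp add: infdist_notempty[OF ne] dist_norm)
  have greatest: "m \<le> ?p x" if "\<And>w. w \<in> W \<Longrightarrow> m \<le> norm (x - w)" for m x
    unfolding INF using ne that by (intro cINF_greatest) auto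
  have lower: "?p x \<le> norm (x - w)" if "w \<in> W" for x w
    using infdist_le[OF that, of x] by (simp add: dist_norm)
  have add: "?p (x + y) \<le> ?p x + ?p y" for x y
  proof -
    have *: "?p (x + y) \<le> norm (x - v) + norm (y - w)" if "v \<in> W" "w \<in> W" for v w
    proof -
      have "?p (x + y) \<le> norm ((x + y) - (v + w))"
        using complex_vector.subspace_add[OF W(1) that] by (rule lower)
      also have "(x + y) - (v + w) = (x - v) + (y - w)" by simp
      finally show ?thesis using norm_triangle_ineq order_trans by blast
    qed
    have "?p (x + y) - norm (x - v) \<le> ?p y" if "v \<in> W" for v
      using *[OF that] by (intro greatest) (simp add: algebra_simps)
    then have "?p (x + y) - ?p y \<le> ?p x" by (intro greatest) (simp add: algebra_simps)
    then show ?thesis by simp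
  qed
  have scale_le: "?p (c *\<^sub>C x) \<le> cmod c * ?p x" if "c \<noteq> 0" for c x
  proof -
    have "?p (c *\<^sub>C x) / cmod c \<le> ?p x"
    proof (rule greatest)
      fix w assume "w \<in> W"
      then have "?p (c *\<^sub>C x) \<le> norm (c *\<^sub>C x - c *\<^sub>C w)"
        using complex_vector.subspace_scale[OF W(1)] by (intro lower)
      also have "c *\<^sub>C x - c *\<^sub>C w = c *\<^sub>C (x - w)"
        by (simp add: complex_vector.scale_right_diff_distrib)
      finally show "?p (c *\<^sub>C x) / cmod c \<le> norm (x - w)"
        using that by (simp add: norm_scaleC pos_divide_le_eq mult.commute)
    qed
    then show ?thesis using that by (simp add: pos_divide_le_eq mult.commute)
  qed
  have scale: "?p (c *\<^sub>C x) = cmod c * ?p x" for c x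
  proof (cases "c = 0")
    case True
    then show ?thesis using complex_vector.subspace_0[OF W(1)] by simp
  next
    case False
    have "?p ((1/c) *\<^sub>C (c *\<^sub>C x)) \<le> cmod (1/c) * ?p (c *\<^sub>C x)"
      using False by (intro scale_le) auto
    then have "cmod c * ?p x \<le> ?p (c *\<^sub>C x)"
      using False by (simp add: norm_divide pos_le_divide_eq mult.commute)
    then show ?thesis using scale_le[OF False, of x] by simp
  qed
  obtain u where u: "\<And>x y. u (x + y) = u x + u y" "\<And>c x. u (c *\<^sub>C x) = c * u x"
    "\<And>x. cmod (u x) \<le> ?p x" "u b = complex_of_real (?p b)"
    by (rule hahn_banach_seminorm[of ?p b, OF add scale]) blast
  have "?p x \<le> norm x" for x
    using lower[OF complex_vector.subspace_0[OF W(1)], of x] by simp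
  then have "cmod (u x) \<le> norm x * 1" for x
    using order_trans[OF u(3)] by simp
  then have "bounded_clinear u"
    by (intro bounded_clinearI[where K=1]) (simp_all add: u(1,2) scaleC_complex_def)
  moreover have "u x = 0" if "x \<in> W" for x using u(3)[of x] that by simp
  moreover have pb: "?p b \<noteq> 0"
    using infdist_pos_not_in_closed[OF W(2) ne b] by simp
  ultimately show ?thesis
    using u(4) bounded_clinear_cmul[of u "1 / complex_of_real (?p b)"]
    by (intro that[of "\<lambda>x. (1 / complex_of_real (?p b)) *\<^sub>C u x"]) (auto simp: scaleC_complex_def)
qed

text \<open>If \<open>u\<close> kills the closed span of \<open>S\<close> and u b = 1, then x - u(x)
  b is continuous in \<open>x\<close>, and the larger span is exactly the preimage of the smaller
  one under this map.\<close>

lemma closed_span_insert: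
  fixes S :: "'a::complex_normed_vector set"
  assumes S: "closed (complex_vector.span S)"
  shows "closed (complex_vector.span (insert b S))"
proof (cases "b \<in> complex_vector.span S")
  case True
  then show ?thesis using S by (simp add: complex_vector.span_redundant)
next
  case False
  obtain u :: "'a \<Rightarrow> complex" where u: "bounded_clinear u" "\<And>x. x \<in> complex_vector.span S \<Longrightarrow> u x = 0" "u b = 1"
    using functional_vanishing_on_closed_subspace[OF complex_vector.subspace_span S False] by blast
  have "complex_vector.span (insert b S) = (\<lambda>x. x - u x *\<^sub>C b) -` complex_vector.span S"
  proof -
    have "k = u x" if "x - k *\<^sub>C b \<in> complex_vector.span S" for x k
      using u(2)[OF that] u(3)
      by (simp add: bounded_clinear_diff[OF u(1)] bounded_clinear_scaleC[OF u(1)] scaleC_complex_def)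
    then show ?thesis by (auto simp: complex_vector.span_insert)
  qed
  moreover have "bounded_clinear (\<lambda>x. x - u x *\<^sub>C b)"
    by (intro bounded_clinear_minus bounded_clinear_ident bounded_clinear_scaleC_left u(1))
  then have "continuous_on UNIV (\<lambda>x. x - u x *\<^sub>C b)"
    by (intro linear_continuous_on bounded_clinear_bounded_linear)
  ultimately show ?thesis using S by (simp add: continuous_closed_vimage continuous_on_eq_continuous_at)
qed

lemma closed_span_Un:
  fixes V :: "'a::complex_normed_vector set"
  assumes "finite B" "closed V" "complex_vector.subspace V"
  shows "closed (complex_vector.span (V \<union> B))"
  using assms(1)
proof (induction B)
  case empty
  then show ?case using assms(2,3) by (simp add: complex_vector.span_eq_iff[THEN iffD2])
next
  case (insert b B)
  then show ?case using closed_span_insert[of "V \<union> B" b] by simp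
qed

lemma closed_span_finite:
  fixes B :: "'a::complex_normed_vector set"
  assumes "finite B" shows "closed (complex_vector.span B)"
  using closed_span_Un[OF assms, of "{0}"] by (simp add: complex_vector.span_insert_0)

text \<open>Each \<open>b\<close> lies outside the span of the remaining basis vectors, which is
  closed, so a bounded functional separates it from them. Later uses need only the reproducing
  formula: the sum on its left is a bounded extension to the whole space of the identity of the
  span.\<close>

lemma dual_basis:
  fixes B :: "'a::complex_normed_vector set"
  assumes B: "finite B" "complex_vector.independent B"
  obtains \<phi> :: "'a \<Rightarrow> 'a \<Rightarrow> complex" where "\<forall>b. bounded_clinear (\<phi> b)"
    "\<forall>x\<in>complex_vector.span B. (\<Sum>b\<in>B. \<phi> b x *\<^sub>C b) = x"
proof -
  have "\<exists>u::'a \<Rightarrow> complex. bounded_clinear u \<and> (b \<in> B \<longrightarrow> (\<forall>x \<in> B - {b}. u x = 0) \<and> u b = 1)" for b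
  proof (cases "b \<in> B")
    case True
    then have "b \<notin> complex_vector.span (B - {b})" using B(2) by (auto simp: complex_vector.dependent_def)
    then obtain u :: "'a \<Rightarrow> complex" where u: "bounded_clinear u" "\<And>x. x \<in> complex_vector.span (B - {b}) \<Longrightarrow> u x = 0" "u b = 1"
      using functional_vanishing_on_closed_subspace[OF complex_vector.subspace_span closed_span_finite, of "B - {b}" b] B(1)
      by blast
    show ?thesis using u(1,3) u(2)[OF complex_vector.span_base] by (intro exI[of _ u]) simp
  next
    case False then show ?thesis using bounded_clinear_const_zero by blast
  qed
  then obtain \<phi> :: "'a \<Rightarrow> 'a \<Rightarrow> complex" where \<phi>': "\<And>b. bounded_clinear (\<phi> b) \<and> (b \<in> B \<longrightarrow> (\<forall>x \<in> B - {b}. \<phi> b x = 0) \<and> \<phi> b b = 1)"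
    using choice[of "\<lambda>b u. bounded_clinear u \<and> (b \<in> B \<longrightarrow> (\<forall>x \<in> B - {b}. u x = 0) \<and> u b = 1)"] by blast
  then have \<phi>: "\<And>b. bounded_clinear (\<phi> b)"
    "\<And>b x. b \<in> B \<Longrightarrow> x \<in> B \<Longrightarrow> \<phi> b x = (if x = b then 1 else 0)"
    by auto
  have "(\<Sum>b\<in>B. \<phi> b x *\<^sub>C b) = x" if "x \<in> complex_vector.span B" for x
    using that
  proof (induction rule: complex_vector.span_induct_alt)
    case base
    then show ?case by (simp add: bounded_clinear_zero[OF \<phi>(1)])
  next
    case (step c x y)
    have "(\<Sum>b\<in>B. \<phi> b x *\<^sub>C b) = (\<Sum>b\<in>B. if x = b then b else 0)"
      using step(1) by (intro sum.cong) (auto simp: \<phi>(2))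
    then have x: "(\<Sum>b\<in>B. \<phi> b x *\<^sub>C b) = x" using step(1) B(1) by simp
    have "(\<Sum>b\<in>B. \<phi> b (c *\<^sub>C x + y) *\<^sub>C b) = c *\<^sub>C (\<Sum>b\<in>B. \<phi> b x *\<^sub>C b) + (\<Sum>b\<in>B. \<phi> b y *\<^sub>C b)"
      by (simp add: bounded_clinear_add[OF \<phi>(1)] bounded_clinear_scaleC[OF \<phi>(1)] scaleC_add_left
          sum.distrib complex_vector.scale_sum_right scaleC_scaleC scaleC_complex_def)
    then show ?case using x step(2) by simp
  qed
  with \<phi>(1) show ?thesis by (intro that allI ballI)
qed

section \<open>Finite dimension and codimension in terms of finite spanning sets\<close>

lemma cdimension_finiteI:
  assumes "finite B" "V \<subseteq> complex_vector.span B"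
  shows "cdimension V \<noteq> \<infinity>"
proof -
  have "cdimension V \<le> enat (card B)"
    unfolding cdimension_def
  proof (rule SUP_least)
    fix A assume "A \<in> {B. finite B \<and> B \<subseteq> V \<and> complex_vector.independent B}"
    then show "enat (card A) \<le> enat (card B)"
      using complex_vector.independent_span_bound[OF assms(1), of A] assms(2) by auto
  qed
  then show ?thesis by (metis enat_ord_simps(5) enat.distinct(2))
qed

lemma cdimension_finiteE:
  assumes V: "complex_vector.subspace V" and fin: "cdimension V \<noteq> \<infinity>"
  obtains B where "finite B" "complex_vector.independent B" "complex_vector.span B = V"
proof -
  obtain n where n: "cdimension V = enat n" using fin by auto
  obtain B where B: "B \<subseteq> V" "complex_vector.independent B" "V \<subseteq> complex_vector.span B"
    by (rule complex_vector.maximal_independent_subset)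
  have "card A \<le> n" if "finite A" "A \<subseteq> B" for A
  proof -
    have "enat (card A) \<le> cdimension V"
      unfolding cdimension_def using that B complex_vector.independent_mono[OF B(2)]
      by (intro SUP_upper) auto
    then show ?thesis by (simp add: n)
  qed
  then have "finite B" using infinite_arbitrarily_large[of B "Suc n"] by force
  moreover have "complex_vector.span B = V"
    using B V by (simp add: complex_vector.span_subspace)
  ultimately show ?thesis using that B(2) by blast
qed

text \<open>Modulo \<open>V\<close>, every \<open>a\<close> in a competing set \<open>A\<close> is
  congruent to some \<open>w a\<close> in the span of \<open>B\<close>. A relation among the
  \<open>w a\<close> puts the corresponding combination of \<open>A\<close> into \<open>V\<close>,
  hence makes it zero. So \<open>w\<close> maps \<open>A\<close> injectively onto an independent
  subset of the span of \<open>B\<close>, which has at most \<open>card B\<close> elements.\<close>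

lemma ccodimension_finiteI:
  assumes V: "complex_vector.subspace V" and B: "finite B" "complex_vector.span (V \<union> B) = UNIV"
  shows "ccodimension V \<noteq> \<infinity>"
proof -
  have "ccodimension V \<le> enat (card B)"
    unfolding ccodimension_def
  proof (rule SUP_least)
    fix A assume "A \<in> {A. finite A \<and> complex_vector.independent A \<and> complex_vector.span A \<inter> V \<subseteq> {0}}"
    then have A: "finite A" "complex_vector.independent A" "complex_vector.span A \<inter> V \<subseteq> {0}" by auto
    have "\<exists>w. w \<in> complex_vector.span B \<and> a - w \<in> V" for a
    proof -
      have "a \<in> complex_vector.span (V \<union> B)" using B(2) by simp
      then obtain v w where "a = v + w" "v \<in> complex_vector.span V" "w \<in> complex_vector.span B"
        unfolding complex_vector.span_Un by blast
      then show ?thesis using V by (intro exI[of _ w]) (simp add: complex_vector.span_eq_iff[THEN iffD2])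
    qed
    then obtain w where w: "\<And>a. w a \<in> complex_vector.span B" "\<And>a. a - w a \<in> V" by metis
    have zero: "c a = 0" if "(\<Sum>a\<in>A. c a *\<^sub>C w a) = 0" "a \<in> A" for c a
    proof -
      have "(\<Sum>a\<in>A. c a *\<^sub>C (a - w a)) \<in> V"
        using w(2) by (intro complex_vector.subspace_sum[OF V] complex_vector.subspace_scale[OF V])
      then have "(\<Sum>a\<in>A. c a *\<^sub>C a) \<in> V"
        using that(1) by (simp add: complex_vector.scale_right_diff_distrib sum_subtractf)
      moreover have "(\<Sum>a\<in>A. c a *\<^sub>C a) \<in> complex_vector.span A"
        by (intro complex_vector.span_sum complex_vector.span_scale complex_vector.span_base)
      ultimately have "(\<Sum>a\<in>A. c a *\<^sub>C a) = 0" using A(3) by blast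
      then show ?thesis by (rule complex_vector.independentD[OF A(2,1) order_refl _ that(2)])
    qed
    have inj: "inj_on w A"
    proof (rule inj_onI, rule ccontr)
      fix a b assume ab: "a \<in> A" "b \<in> A" "w a = w b" "a \<noteq> b"
      let ?c = "\<lambda>x. if x = a then 1 else if x = b then - 1 else (0::complex)"
      have "(\<Sum>x\<in>A. ?c x *\<^sub>C w x) = (\<Sum>x\<in>{a, b}. ?c x *\<^sub>C w x)"
        using ab A(1) by (intro sum.mono_neutral_right) auto
      also have "\<dots> = 0" using ab by simp
      finally show False using zero[of ?c a] ab by simp
    qed
    have "complex_vector.independent (w ` A)"
    proof (rule complex_vector.independent_if_scalars_zero)
      show "f x = 0" if "(\<Sum>x\<in>w ` A. f x *\<^sub>C x) = 0" "x \<in> w ` A" for f x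
        using that zero[of "\<lambda>a. f (w a)"] by (auto simp: sum.reindex[OF inj])
    qed (use A(1) in simp)
    then have "card (w ` A) \<le> card B"
      using complex_vector.independent_span_bound[OF B(1)] w(1) by blast
    then show "enat (card A) \<le> enat (card B)" by (simp add: card_image[OF inj])
  qed
  then show ?thesis by (metis enat_ord_simps(5) enat.distinct(2))
qed

text \<open>Finiteness of the supremum yields an admissible set \<open>B\<close> of largest
  cardinality. A vector outside the span of \<open>V\<close> and \<open>B\<close> could be adjoined
  to \<open>B\<close> while keeping it admissible, so there is none.\<close>

lemma ccodimension_finiteE:
  assumes V: "complex_vector.subspace V" and fin: "ccodimension V \<noteq> \<infinity>"
  obtains B where "finite B" "complex_vector.independent B"
    "complex_vector.span B \<inter> V = {0}" "complex_vector.span (V \<union> B) = UNIV"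
proof -
  let ?P = "\<lambda>B. finite B \<and> complex_vector.independent B \<and> complex_vector.span B \<inter> V \<subseteq> {0}"
  obtain n where n: "ccodimension V = enat n" using fin by auto
  have "card A \<le> n" if "?P A" for A
  proof -
    have "enat (card A) \<le> ccodimension V"
      unfolding ccodimension_def using that by (intro SUP_upper) auto
    then show ?thesis by (simp add: n)
  qed
  moreover have "?P {}" by (simp add: complex_vector.independent_empty)
  ultimately obtain B where B: "?P B" "\<And>A. ?P A \<Longrightarrow> card A \<le> card B"
    using ex_has_greatest_nat[of ?P "{}" card "Suc n"] by (metis le_imp_less_Suc)
  have "x \<in> complex_vector.span (V \<union> B)" for x
  proof (rule ccontr)
    assume x: "x \<notin> complex_vector.span (V \<union> B)"
    then have xB: "x \<notin> complex_vector.span B"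
      using complex_vector.span_mono[of B "V \<union> B"] by blast
    have "v = 0" if v: "v \<in> complex_vector.span (insert x B)" "v \<in> V" for v
    proof -
      obtain k where k: "v - k *\<^sub>C x \<in> complex_vector.span B"
        using v(1) by (auto simp: complex_vector.span_insert)
      have "k = 0"
      proof (rule ccontr)
        assume "k \<noteq> 0"
        have "v \<in> complex_vector.span (V \<union> B)"
          using v(2) by (intro complex_vector.span_base) simp
        moreover have "v - k *\<^sub>C x \<in> complex_vector.span (V \<union> B)"
          using k complex_vector.span_mono[of B "V \<union> B"] by blast
        ultimately have "v - (v - k *\<^sub>C x) \<in> complex_vector.span (V \<union> B)"
          by (rule complex_vector.span_diff)
        then have "k *\<^sub>C x \<in> complex_vector.span (V \<union> B)" by simp
        then have "(1/k) *\<^sub>C (k *\<^sub>C x) \<in> complex_vector.span (V \<union> B)"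
          by (rule complex_vector.span_scale)
        then show False using x \<open>k \<noteq> 0\<close> by (simp add: scaleC_scaleC)
      qed
      then show ?thesis using k v(2) B(1) by auto
    qed
    then have "?P (insert x B)"
      using B(1) complex_vector.independent_insertI[OF xB] by blast
    then have "card (insert x B) \<le> card B" by (rule B(2))
    moreover have "x \<notin> B" using xB complex_vector.span_base by blast
    ultimately show False using B(1) by simp
  qed
  moreover have "complex_vector.span B \<inter> V = {0}"
    using B(1) complex_vector.subspace_0[OF V] complex_vector.span_zero[of B] by blast
  ultimately show ?thesis using that B(1) by blast
qed

lemma cdimension_zero_finite: "cdimension {0} \<noteq> \<infinity>"
  by (rule cdimension_finiteI[OF finite.emptyI]) simp

lemma ccodimension_UNIV_finite: "ccodimension UNIV \<noteq> \<infinity>"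
  by (rule ccodimension_finiteI[OF complex_vector.subspace_UNIV finite.emptyI]) simp

section \<open>Generalized inverses and complemented subspaces\<close>

text \<open>The map (l, f) -> A l + f is a bijection from \<open>L \<times> F\<close> onto the whole
  space, and \<open>W\<close> and \<open>P\<close> are the components of its inverse: linear by
  uniqueness of the decomposition, bounded by the open mapping theorem. Both kinds of parametrix
  below are instances, with \<open>L\<close> a complement of the kernel and \<open>F\<close> one of
  the range.\<close>

lemma inverse_of_direct_decomposition:
  fixes A :: "'e::complex_banach \<Rightarrow> 'x::complex_banach"
  assumes A: "bounded_clinear A"
    and L: "complex_vector.subspace L" "closed L" and F: "complex_vector.subspace F" "closed F"
    and inj: "null_space A \<inter> L = {0}" "A ` L \<inter> F = {0}" and sum: "{x + y |x y. x \<in> A ` L \<and> y \<in> F} = UNIV"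
  obtains W P where "bounded_clinear W" "bounded_clinear P" "\<forall>x. P x \<in> F"
    "\<forall>x. A (W x) + P x = x" "\<forall>l\<in>L. \<forall>f\<in>F. W (A l + f) = l"
proof -
  have uniq: "l = l' \<and> f = f'" if "A l + f = A l' + f'" "l \<in> L" "l' \<in> L" "f \<in> F" "f' \<in> F" for l l' f f'
  proof -
    have "A (l - l') = f' - f" using that(1) by (simp add: bounded_clinear_diff[OF A] algebra_simps)
    moreover have lL: "l - l' \<in> L" and "f' - f \<in> F"
      using that by (auto intro: complex_vector.subspace_diff L F)
    ultimately have "f' - f \<in> A ` L \<inter> F" by (metis IntI imageI)
    then have "f' - f = 0" using inj(2) by blast
    moreover from this have "l - l' \<in> null_space A \<inter> L"
      using \<open>A (l - l') = f' - f\<close> lL by (simp add: null_space_def)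
    ultimately show ?thesis using inj(1) by auto
  qed
  have "\<exists>m. fst m \<in> L \<and> snd m \<in> F \<and> A (fst m) + snd m = x" for x
  proof -
    have "x \<in> {x + y |x y. x \<in> A ` L \<and> y \<in> F}" unfolding sum by simp
    then obtain l f where "l \<in> L" "f \<in> F" "x = A l + f" by blast
    then show ?thesis by (intro exI[of _ "(l, f)"]) simp
  qed
  then obtain h where h: "\<And>x. fst (h x) \<in> L \<and> snd (h x) \<in> F \<and> A (fst (h x)) + snd (h x) = x"
    using choice[of "\<lambda>x m. fst m \<in> L \<and> snd m \<in> F \<and> A (fst m) + snd m = x"] by blast
  define W where "W x = fst (h x)" for x
  define P where "P x = snd (h x)" for x
  have WP: "\<And>x. W x \<in> L" "\<And>x. P x \<in> F" "\<And>x. A (W x) + P x = x"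
    using h by (simp_all add: W_def P_def)
  have WP_eq: "W (A l + f) = l \<and> P (A l + f) = f" if "l \<in> L" "f \<in> F" for l f
    by (rule uniq[OF WP(3) WP(1) that(1) WP(2) that(2)])
  let ?g = "\<lambda>(l, f). A l + f"
  have bl: "bounded_linear ?g"
    unfolding case_prod_beta
    by (intro bounded_linear_add bounded_linear_snd
        bounded_linear_compose[OF bounded_clinear_bounded_linear[OF A] bounded_linear_fst])
  have sub: "subspace (L \<times> F)"
    by (intro subspace_Times subspace_real_of_complex L F)
  have im: "?g ` (L \<times> F) = UNIV"
  proof -
    have "x \<in> ?g ` (L \<times> F)" for x
      using WP by (intro image_eqI[of _ _ "(W x, P x)"]) auto
    then show ?thesis by blast
  qed
  have "closed (?g ` (L \<times> F))" unfolding im by (rule closed_UNIV)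
  then obtain C where "0 \<le> C"
    and C: "\<forall>x\<in>?g ` (L \<times> F). \<exists>m\<in>L \<times> F. ?g m = x \<and> norm m \<le> C * norm x"
    by (rule open_mapping[OF bl sub closed_Times[OF L(2) F(2)]])
  have le: "norm (W x) \<le> norm x * C \<and> norm (P x) \<le> norm x * C" for x
  proof -
    obtain l f where lf: "l \<in> L" "f \<in> F" "A l + f = x" "norm (l, f) \<le> C * norm x"
      using bspec[OF C, of x] unfolding im by auto
    then have "W x = l" "P x = f" using WP_eq[of l f] by auto
    then show ?thesis
      using lf(4) norm_fst_le[of l f] norm_snd_le[of f l] by (simp add: mult.commute)
  qed
  have add: "W (x + y) = W x + W y \<and> P (x + y) = P x + P y" for x y
  proof -
    have "A (W x + W y) + (P x + P y) = (A (W x) + P x) + (A (W y) + P y)"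
      by (simp add: bounded_clinear_add[OF A])
    also have "\<dots> = x + y" by (simp only: WP(3))
    finally show ?thesis
      using WP_eq[of "W x + W y" "P x + P y"] WP(1,2)
        complex_vector.subspace_add[OF L(1)] complex_vector.subspace_add[OF F(1)] by simp
  qed
  have scale: "W (c *\<^sub>C x) = c *\<^sub>C W x \<and> P (c *\<^sub>C x) = c *\<^sub>C P x" for c x
  proof -
    have "A (c *\<^sub>C W x) + c *\<^sub>C P x = c *\<^sub>C (A (W x) + P x)"
      by (simp add: bounded_clinear_scaleC[OF A] scaleC_add_right)
    also have "\<dots> = c *\<^sub>C x" by (simp only: WP(3))
    finally show ?thesis
      using WP_eq[of "c *\<^sub>C W x" "c *\<^sub>C P x"] WP(1,2)
        complex_vector.subspace_scale[OF L(1)] complex_vector.subspace_scale[OF F(1)] by simp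
  qed
  show ?thesis
  proof (rule that)
    show "bounded_clinear W" "bounded_clinear P"
      using add scale le by (auto intro!: bounded_clinearI[where K=C])
  qed (use WP WP_eq in auto)
qed

section \<open>Finite-rank operators and generalized inverses\<close>

definition finite_rank :: "('a \<Rightarrow> 'b::complex_vector) \<Rightarrow> bool" where
  "finite_rank K \<longleftrightarrow> (\<exists>B. finite B \<and> range K \<subseteq> complex_vector.span B)"

lemma finite_rank_compose_right: "finite_rank K \<Longrightarrow> finite_rank (\<lambda>x. K (f x))"
  unfolding finite_rank_def by blast

lemma finite_rank_compose_left:
  assumes f: "bounded_clinear f" and "finite_rank K"
  shows "finite_rank (\<lambda>x. f (K x))"
proof -
  obtain B where B: "finite B" "range K \<subseteq> complex_vector.span B"
    using assms(2) by (auto simp: finite_rank_def)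
  have "f y \<in> complex_vector.span (f ` B)" if "y \<in> complex_vector.span B" for y
    using that
  proof (induction rule: complex_vector.span_induct_alt)
    case base then show ?case by (simp add: bounded_clinear_zero[OF f] complex_vector.span_zero)
  next
    case (step c x y)
    then have "c *\<^sub>C f x + f y \<in> complex_vector.span (f ` B)"
      by (intro complex_vector.span_add complex_vector.span_scale) (simp_all add: complex_vector.span_base)
    then show ?case by (simp add: bounded_clinear_add[OF f] bounded_clinear_scaleC[OF f])
  qed
  then show ?thesis unfolding finite_rank_def using B by (intro exI[of _ "f ` B"]) auto
qed

text \<open>The coordinates with respect to a basis of the range extend to bounded functionals on
  the target space; composed with \<open>K\<close> they become the coefficients. This exhibits
  \<open>K\<close> as a finite sum of the rank-one operators to which (T4) applies.\<close>

lemma finite_rank_representation: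
  fixes K :: "'a::complex_normed_vector \<Rightarrow> 'b::complex_normed_vector"
  assumes K: "bounded_clinear K" "finite_rank K"
  obtains B and u :: "'b \<Rightarrow> 'a \<Rightarrow> complex" where "finite B" "B \<subseteq> range K" "\<forall>b. bounded_clinear (u b)"
    "K = (\<lambda>x. \<Sum>b\<in>B. u b x *\<^sub>C b)"
proof -
  obtain B0 where B0: "finite B0" "range K \<subseteq> complex_vector.span B0"
    using K(2) by (auto simp: finite_rank_def)
  have "complex_vector.subspace (range K)"
    using subspace_image[OF K(1)] complex_vector.subspace_UNIV by blast
  then obtain B where B: "finite B" "complex_vector.independent B" "complex_vector.span B = range K"
    using cdimension_finiteE cdimension_finiteI[OF B0] by metis
  obtain \<phi> :: "'b \<Rightarrow> 'b \<Rightarrow> complex" where \<phi>: "\<forall>b. bounded_clinear (\<phi> b)"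
    "\<forall>x\<in>complex_vector.span B. (\<Sum>b\<in>B. \<phi> b x *\<^sub>C b) = x"
    by (rule dual_basis[OF B(1,2)])
  show ?thesis
  proof (rule that[of B "\<lambda>b x. \<phi> b (K x)"])
    show "B \<subseteq> range K" using B(3) complex_vector.span_superset by blast
    show "\<forall>b. bounded_clinear (\<lambda>x. \<phi> b (K x))"
      by (rule allI, rule bounded_clinear_compose[OF spec[OF \<phi>(1)] K(1)])
    show "K = (\<lambda>x. \<Sum>b\<in>B. \<phi> b (K x) *\<^sub>C b)"
      using \<phi>(2) B(3) by (auto simp: fun_eq_iff)
  qed (rule B(1))
qed

text \<open>\<open>G\<close> reads off the coordinates of a vector with respect to a basis of the
  range of \<open>K\<close> and puts them on chosen preimages of the basis vectors.\<close>

lemma finite_rank_generalized_inverse: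
  fixes K :: "'a::complex_normed_vector \<Rightarrow> 'b::complex_normed_vector"
  assumes K: "bounded_clinear K" "finite_rank K"
  obtains G where "bounded_clinear G" "\<And>x. K (G (K x)) = K x"
proof -
  obtain B0 where B0: "finite B0" "range K \<subseteq> complex_vector.span B0"
    using K(2) by (auto simp: finite_rank_def)
  have "complex_vector.subspace (range K)"
    using subspace_image[OF K(1)] complex_vector.subspace_UNIV by blast
  then obtain B where B: "finite B" "complex_vector.independent B" "complex_vector.span B = range K"
    using cdimension_finiteE cdimension_finiteI[OF B0] by metis
  obtain \<phi> :: "'b \<Rightarrow> 'b \<Rightarrow> complex" where \<phi>: "\<forall>b. bounded_clinear (\<phi> b)"
    "\<forall>x\<in>complex_vector.span B. (\<Sum>b\<in>B. \<phi> b x *\<^sub>C b) = x"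
    by (rule dual_basis[OF B(1,2)])
  have "\<exists>e. b \<in> B \<longrightarrow> K e = b" for b
    using B(3) complex_vector.span_base by (metis imageE)
  then obtain e where e: "\<And>b. b \<in> B \<Longrightarrow> K (e b) = b" by metis
  define G where "G y = (\<Sum>b\<in>B. \<phi> b y *\<^sub>C e b)" for y
  have "bounded_clinear G"
    unfolding G_def by (intro bounded_clinear_sums bounded_clinear_scaleC_left spec[OF \<phi>(1)])
  moreover have "K (G (K x)) = K x" for x
  proof -
    have "K (G (K x)) = (\<Sum>b\<in>B. \<phi> b (K x) *\<^sub>C b)"
      by (simp add: G_def bounded_clinear_sum[OF K(1)] bounded_clinear_scaleC[OF K(1)] e cong: sum.cong)
    then show ?thesis using \<phi>(2) B(3) by auto
  qed
  ultimately show ?thesis using that by blast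
qed

text \<open>If \<open>K = A - A W A\<close> has a generalized inverse \<open>H\<close>, then \<open>W + (1 - W A) H (1 - A W)\<close> is one
  for \<open>A\<close>.\<close>

lemma generalized_inverse_modulo_finite_rank:
  fixes A :: "'a::complex_normed_vector \<Rightarrow> 'b::complex_normed_vector"
  assumes A: "bounded_clinear A" and W: "bounded_clinear W"
    and K: "finite_rank (\<lambda>x. A x - A (W (A x)))"
  obtains G where "bounded_clinear G" "\<And>x. A (G (A x)) = A x"
proof -
  let ?K = "\<lambda>x. A x - A (W (A x))"
  have WA: "bounded_clinear (\<lambda>x. W (A x))" and AW: "bounded_clinear (\<lambda>x. A (W x))"
    by (rule bounded_clinear_compose[OF W A], rule bounded_clinear_compose[OF A W])
  have "bounded_clinear ?K"
    by (rule bounded_clinear_minus[OF A bounded_clinear_compose[OF A WA]])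
  then obtain H where H: "bounded_clinear H" "\<And>x. ?K (H (?K x)) = ?K x"
    using finite_rank_generalized_inverse[OF _ K] by metis
  define G where "G y = W y + (H (y - A (W y)) - W (A (H (y - A (W y)))))" for y
  have Hc: "bounded_clinear (\<lambda>y. H (y - A (W y)))"
    by (rule bounded_clinear_compose[OF H(1) bounded_clinear_minus[OF bounded_clinear_ident AW]])
  have "bounded_clinear G"
    unfolding G_def
    by (rule bounded_clinear_plus[OF W bounded_clinear_minus[OF Hc bounded_clinear_compose[OF WA Hc]]])
  moreover have "A (G (A x)) = A x" for x
    using H(2)[of x] by (simp add: G_def bounded_clinear_add[OF A] bounded_clinear_diff[OF A])
  ultimately show ?thesis using that by blast
qed

text \<open>From A G A = A it follows that G A and A G are bounded idempotents, the first with the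
  kernel of \<open>A\<close>, the second with the range of \<open>A\<close>. Kernels of bounded
  idempotents and of their complementary idempotents are closed and complement each other.\<close>

lemma generalized_inverse_complements:
  fixes A :: "'a::complex_normed_vector \<Rightarrow> 'b::complex_normed_vector"
  assumes A: "bounded_clinear A" and G: "bounded_clinear G" "\<And>x. A (G (A x)) = A x"
  shows "has_direct_complement (null_space A)" "has_direct_complement (range A)" "closed (range A)"
proof -
  have AG: "bounded_clinear (\<lambda>y. A (G y))" by (rule bounded_clinear_compose[OF A G(1)])
  have GA: "bounded_clinear (\<lambda>x. x - G (A x))"
    by (rule bounded_clinear_minus[OF bounded_clinear_ident bounded_clinear_compose[OF G(1) A]])
  have AG': "bounded_clinear (\<lambda>y. y - A (G y))"
    by (rule bounded_clinear_minus[OF bounded_clinear_ident AG])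
  show "has_direct_complement (null_space A)"
    unfolding has_direct_complement_def
  proof (intro exI[of _ "null_space (\<lambda>x. x - G (A x))"] conjI)
    show "null_space A \<inter> null_space (\<lambda>x. x - G (A x)) = {0}"
      by (auto simp: null_space_def bounded_clinear_zero[OF A] bounded_clinear_zero[OF G(1)])
    have "x \<in> {x + y |x y. x \<in> null_space A \<and> y \<in> null_space (\<lambda>x. x - G (A x))}" for x
    proof -
      have "x = (x - G (A x)) + G (A x)" by simp
      moreover have "x - G (A x) \<in> null_space A" "G (A x) \<in> null_space (\<lambda>x. x - G (A x))"
        by (simp_all add: null_space_def bounded_clinear_diff[OF A] G(2))
      ultimately show ?thesis by blast
    qed
    then show "{x + y |x y. x \<in> null_space A \<and> y \<in> null_space (\<lambda>x. x - G (A x))} = UNIV" by blast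
  qed (intro subspace_null_space closed_null_space GA)+
  have ran: "range A = null_space (\<lambda>y. y - A (G y))"
  proof
    show "range A \<subseteq> null_space (\<lambda>y. y - A (G y))" by (auto simp: null_space_def G(2))
    show "null_space (\<lambda>y. y - A (G y)) \<subseteq> range A"
      by (auto simp: null_space_def)
  qed
  show "closed (range A)" unfolding ran by (rule closed_null_space[OF AG'])
  show "has_direct_complement (range A)"
    unfolding has_direct_complement_def
  proof (intro exI[of _ "null_space (\<lambda>y. A (G y))"] conjI)
    show "range A \<inter> null_space (\<lambda>y. A (G y)) = {0}"
      using rangeI[of A 0] by (auto simp: null_space_def G(2) bounded_clinear_zero[OF A] bounded_clinear_zero[OF G(1)])
    have "y \<in> {x + y |x y. x \<in> range A \<and> y \<in> null_space (\<lambda>y. A (G y))}" for y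
    proof -
      have "y = A (G y) + (y - A (G y))" by simp
      moreover have "y - A (G y) \<in> null_space (\<lambda>y. A (G y))"
        by (simp add: null_space_def bounded_clinear_diff[OF A] bounded_clinear_diff[OF G(1)] G(2))
      ultimately show ?thesis by blast
    qed
    then show "{x + y |x y. x \<in> range A \<and> y \<in> null_space (\<lambda>y. A (G y))} = UNIV" by blast
  qed (intro subspace_null_space closed_null_space AG)+
qed

section \<open>Semi-Fredholm estimates\<close>

text \<open>By the open mapping theorem \<open>A z\<close> has a preimage \<open>w\<close> with norm
  controlled by that of \<open>A z\<close>. The difference \<open>z - w\<close> lies in the
  finite-dimensional kernel and is determined by its coordinates, which differ from those of
  \<open>z\<close> by the coordinates of the small vector \<open>w\<close>.\<close>

lemma upper_semi_Fredholm_imp_estimate: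
  fixes A :: "'e::complex_banach \<Rightarrow> 'x::complex_banach"
  assumes A: "bounded_clinear A" and dim: "cdimension (null_space A) \<noteq> \<infinity>" and cl: "closed (range A)"
  obtains B :: "'e set" and \<phi> :: "'e \<Rightarrow> 'e \<Rightarrow> complex" and C where "finite B" "0 \<le> C"
    "\<forall>b. bounded_clinear (\<phi> b)" "\<forall>z. norm z \<le> C * (norm (A z) + (\<Sum>b\<in>B. cmod (\<phi> b z)))"
proof -
  obtain B where B: "finite B" "complex_vector.independent B" "complex_vector.span B = null_space A"
    using cdimension_finiteE[OF subspace_null_space[OF A] dim] .
  obtain \<phi> :: "'e \<Rightarrow> 'e \<Rightarrow> complex" where \<phi>: "\<forall>b. bounded_clinear (\<phi> b)"
    "\<forall>x\<in>complex_vector.span B. (\<Sum>b\<in>B. \<phi> b x *\<^sub>C b) = x"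
    by (rule dual_basis[OF B(1,2)])
  have \<phi>': "bounded_clinear (\<phi> b)" for b using \<phi>(1) by simp
  obtain C where C: "0 \<le> C" "\<forall>x\<in>range A. \<exists>m\<in>UNIV. A m = x \<and> norm m \<le> C * norm x"
    by (rule open_mapping[OF bounded_clinear_bounded_linear[OF A] subspace_UNIV closed_UNIV cl])
  \<comment> \<open>\<open>M\<close> bounds every basis vector and \<open>R\<close> the coordinate
    projection. The estimate obtained is norm z \<le> C norm (A z) + M s + R C norm (A z), with s
    the sum of the moduli of the coordinates of \<open>z\<close>; \<open>C + R * C + M\<close>
    dominates all coefficients in it.\<close>
  define M where "M = (\<Sum>b\<in>B. norm b)"
  define R where "R = (\<Sum>b\<in>B. onorm (\<phi> b) * norm b)"
  have M: "0 \<le> M" and R: "0 \<le> R"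
    by (auto simp: M_def R_def intro!: sum_nonneg mult_nonneg_nonneg bounded_clinear_onorm_nonneg[OF \<phi>'])
  have "norm z \<le> (C + R * C + M) * (norm (A z) + (\<Sum>b\<in>B. cmod (\<phi> b z)))" for z
  proof -
    let ?s = "\<Sum>b\<in>B. cmod (\<phi> b z)"
    obtain w where w: "A w = A z" "norm w \<le> C * norm (A z)" using C(2) by auto
    have "z - w \<in> complex_vector.span B"
      by (simp add: B(3) null_space_def bounded_clinear_diff[OF A] w(1))
    then have "norm (z - w) = norm (\<Sum>b\<in>B. \<phi> b (z - w) *\<^sub>C b)" using \<phi>(2) by simp
    also have "\<dots> \<le> (\<Sum>b\<in>B. cmod (\<phi> b (z - w)) * norm b)"
      by (rule norm_sum[THEN order_trans]) (simp add: norm_scaleC)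
    also have "\<dots> \<le> (\<Sum>b\<in>B. cmod (\<phi> b z) * norm b + cmod (\<phi> b w) * norm b)"
      by (intro sum_mono)
         (simp add: bounded_clinear_diff[OF \<phi>'] distrib_right[symmetric] mult_right_mono norm_triangle_ineq4)
    also have "\<dots> \<le> M * ?s + R * norm w"
      unfolding sum.distrib
    proof (rule add_mono)
      show "(\<Sum>b\<in>B. cmod (\<phi> b z) * norm b) \<le> M * ?s"
        unfolding sum_distrib_left
      proof (rule sum_mono)
        fix b assume "b \<in> B"
        then have "norm b \<le> M" unfolding M_def using B(1) by (intro member_le_sum) auto
        then show "cmod (\<phi> b z) * norm b \<le> M * cmod (\<phi> b z)"
          by (simp add: mult.commute mult_right_mono)
      qed
      show "(\<Sum>b\<in>B. cmod (\<phi> b w) * norm b) \<le> R * norm w"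
        unfolding R_def sum_distrib_right
      proof (rule sum_mono)
        fix b
        show "cmod (\<phi> b w) * norm b \<le> onorm (\<phi> b) * norm b * norm w"
          using mult_right_mono[OF bounded_clinear_onorm[OF \<phi>', of b w] norm_ge_zero[of b]]
          by (simp add: mult_ac)
      qed
    qed
    also have "\<dots> \<le> M * ?s + R * (C * norm (A z))"
      using w(2) R by (simp add: mult_left_mono)
    finally have "norm (z - w) \<le> M * ?s + R * (C * norm (A z))" .
    then have "norm z \<le> C * norm (A z) + M * ?s + R * C * norm (A z)"
      using norm_triangle_ineq[of "z - w" w] w(2) by simp
    moreover have "0 \<le> C * ?s" "0 \<le> R * C * ?s" "0 \<le> M * norm (A z)"
      using C(1) R M by (auto intro!: mult_nonneg_nonneg sum_nonneg)
    ultimately show ?thesis by (simp add: algebra_simps)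
  qed
  then show ?thesis using C(1) R M \<phi>(1) B(1) by (intro that[of B "C + R * C + M" \<phi>]) auto
qed

text \<open>Induction on the number of functionals: on the kernel of \<open>\<phi> i\<close> in
  \<open>V\<close> one summand of the estimate disappears, while \<open>V\<close> exceeds this
  kernel by at most one dimension. One more vector affects neither closedness of the image nor
  finite dimension of the null space. The subspace \<open>V\<close> has to vary for this.\<close>

lemma estimate_imp_closed_image:
  fixes A :: "'e::complex_banach \<Rightarrow> 'x::complex_banach" and \<phi> :: "'i \<Rightarrow> 'e \<Rightarrow> complex"
  assumes A: "bounded_clinear A" and I: "finite I" and \<phi>: "\<And>i. bounded_clinear (\<phi> i)"
    and V: "complex_vector.subspace V" "closed V"
    and est: "\<And>z. z \<in> V \<Longrightarrow> norm z \<le> C * (norm (A z) + (\<Sum>i\<in>I. cmod (\<phi> i z)))"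
  shows "closed (A ` V) \<and> (\<exists>B. finite B \<and> null_space A \<inter> V \<subseteq> complex_vector.span B)"
  using I V est
proof (induction I arbitrary: V)
  case empty
  \<comment> \<open>The sign of \<open>C\<close> is unknown; a positive constant is wanted, so that
    \<open>A\<close> is bounded below on \<open>V\<close> by \<open>1 / D\<close>.\<close>
  define D where "D = \<bar>C\<bar> + 1"
  have est': "norm z \<le> D * norm (A z)" if "z \<in> V" for z
  proof -
    have "norm z \<le> C * norm (A z)" using empty(3)[OF that] by simp
    also have "\<dots> \<le> D * norm (A z)" by (intro mult_right_mono) (auto simp: D_def)
    finally show ?thesis .
  qed
  have D: "0 < D" by (simp add: D_def)
  have "complete (A ` V)"
  proof (rule complete_isometric_image)
    show "0 < 1 / D" using D by simp
    show "subspace V" by (rule subspace_real_of_complex[OF empty(1)])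
    show "bounded_linear A" by (rule bounded_clinear_bounded_linear[OF A])
    show "\<forall>x\<in>V. 1 / D * norm x \<le> norm (A x)"
      using est' D by (simp add: pos_divide_le_eq mult.commute)
    show "complete V" using empty(2) by (simp add: complete_eq_closed)
  qed
  then have "closed (A ` V)" by (simp add: complete_eq_closed)
  moreover have "null_space A \<inter> V \<subseteq> complex_vector.span {}"
    using est' by (fastforce simp: null_space_def)
  ultimately show ?case by blast
next
  case (insert i I)
  show ?case
  proof (cases "\<forall>z\<in>V. \<phi> i z = 0")
    case True
    show ?thesis
    proof (rule insert.IH[OF insert.prems(1,2)])
      show "norm z \<le> C * (norm (A z) + (\<Sum>i\<in>I. cmod (\<phi> i z)))" if "z \<in> V" for z
        using insert.prems(3)[OF that] True that insert.hyps by simp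
    qed
  next
    case False
    let ?W = "V \<inter> null_space (\<phi> i)"
    have W: "complex_vector.subspace ?W" "closed ?W"
      by (intro complex_vector.subspace_inter insert.prems subspace_null_space closed_null_space closed_Int \<phi>)+
    have IH: "closed (A ` ?W) \<and> (\<exists>B. finite B \<and> null_space A \<inter> ?W \<subseteq> complex_vector.span B)"
    proof (rule insert.IH[OF W])
      show "norm z \<le> C * (norm (A z) + (\<Sum>i\<in>I. cmod (\<phi> i z)))" if "z \<in> ?W" for z
        using insert.prems(3)[of z] that insert.hyps by (simp add: null_space_def)
    qed
    have split: "z - \<phi> i z *\<^sub>C e \<in> X \<inter> null_space (\<phi> i)"
      if "complex_vector.subspace X" "z \<in> X" "e \<in> X" "\<phi> i e = 1" for X z e
      using that
      by (simp add: null_space_def bounded_clinear_diff[OF \<phi>] bounded_clinear_scaleC[OF \<phi>]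
          scaleC_complex_def complex_vector.subspace_diff complex_vector.subspace_scale)
    have unit: "\<exists>e\<in>X. \<phi> i e = 1" if X: "complex_vector.subspace X" "z \<in> X" "\<phi> i z \<noteq> 0" for X z
      using X complex_vector.subspace_scale[OF X(1,2), of "1 / \<phi> i z"]
      by (intro bexI[of _ "(1 / \<phi> i z) *\<^sub>C z"]) (simp_all add: bounded_clinear_scaleC[OF \<phi>] scaleC_complex_def)
    obtain e where e: "e \<in> V" "\<phi> i e = 1" using unit[OF insert.prems(1)] False by blast
    have AW: "complex_vector.subspace (A ` ?W)" by (rule subspace_image[OF A W(1)])
    have "A ` V = complex_vector.span (A ` ?W \<union> {A e})"
    proof
      show "A ` V \<subseteq> complex_vector.span (A ` ?W \<union> {A e})"
      proof safe
        fix z assume "z \<in> V"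
        then have "A (z - \<phi> i z *\<^sub>C e) \<in> complex_vector.span (A ` ?W \<union> {A e})"
          using split[OF insert.prems(1) _ e] by (intro complex_vector.span_base) blast
        moreover have "\<phi> i z *\<^sub>C A e \<in> complex_vector.span (A ` ?W \<union> {A e})"
          by (intro complex_vector.span_scale complex_vector.span_base) simp
        ultimately have "A (z - \<phi> i z *\<^sub>C e) + \<phi> i z *\<^sub>C A e \<in> complex_vector.span (A ` ?W \<union> {A e})"
          by (rule complex_vector.span_add)
        then show "A z \<in> complex_vector.span (A ` ?W \<union> {A e})"
          by (simp add: bounded_clinear_diff[OF A] bounded_clinear_scaleC[OF A])
      qed
      show "complex_vector.span (A ` ?W \<union> {A e}) \<subseteq> A ` V"
        using e(1) by (intro complex_vector.span_minimal subspace_image[OF A] insert.prems(1)) auto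
    qed
    then have closed: "closed (A ` V)" using closed_span_Un[OF _ _ AW, of "{A e}"] IH by simp
    obtain B where B: "finite B" "null_space A \<inter> ?W \<subseteq> complex_vector.span B" using IH by blast
    have NV: "complex_vector.subspace (null_space A \<inter> V)"
      by (intro complex_vector.subspace_inter subspace_null_space A insert.prems(1))
    \<comment> \<open>The functional may vanish on the null space inside \<open>V\<close> without
      vanishing on \<open>V\<close>, so the vector that completes the null space is not the vector
      \<open>e\<close> that completes \<open>V\<close>.\<close>
    have "\<exists>B. finite B \<and> null_space A \<inter> V \<subseteq> complex_vector.span B"
    proof (cases "\<forall>z\<in>null_space A \<inter> V. \<phi> i z = 0")
      case True
      then have "null_space A \<inter> V \<subseteq> null_space A \<inter> ?W" by (auto simp: null_space_def)
      then show ?thesis using B by blast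
    next
      case False
      then obtain d where d: "d \<in> null_space A \<inter> V" "\<phi> i d = 1" using unit[OF NV] by blast
      have "z \<in> complex_vector.span (insert d B)" if "z \<in> null_space A \<inter> V" for z
      proof -
        have "z - \<phi> i z *\<^sub>C d \<in> null_space A \<inter> ?W" using split[OF NV that d] by blast
        then show ?thesis using B(2) unfolding complex_vector.span_insert by blast
      qed
      then show ?thesis using B(1) by (intro exI[of _ "insert d B"]) auto
    qed
    then show ?thesis using closed by blast
  qed
qed

lemma estimate_imp_upper_semi_Fredholm:
  fixes A :: "'e::complex_banach \<Rightarrow> 'x::complex_banach" and \<phi> :: "'i \<Rightarrow> 'e \<Rightarrow> complex"
  assumes A: "bounded_clinear A" and I: "finite I" and \<phi>: "\<And>i. bounded_clinear (\<phi> i)"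
    and est: "\<And>z. norm z \<le> C * (norm (A z) + (\<Sum>i\<in>I. cmod (\<phi> i z)))"
  shows "cdimension (null_space A) \<noteq> \<infinity>" "closed (range A)"
proof -
  have *: "closed (range A)" "\<exists>B. finite B \<and> null_space A \<inter> UNIV \<subseteq> complex_vector.span B"
    using estimate_imp_closed_image[OF A I \<phi> complex_vector.subspace_UNIV closed_UNIV est] by blast+
  then show "cdimension (null_space A) \<noteq> \<infinity>" "closed (range A)"
    using cdimension_finiteI by (metis Int_UNIV_right)+
qed

text \<open>Otherwise the estimate holds with an empty family of functionals, which gives closed
  range, and the lower bound itself gives a trivial kernel.\<close>

lemma not_bounded_below_imp_small:
  fixes A :: "'e::complex_banach \<Rightarrow> 'x::complex_banach"
  assumes A: "bounded_clinear A" and "null_space A \<noteq> {0} \<or> \<not> closed (range A)" and "0 < \<epsilon>"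
  shows "\<exists>y. y \<noteq> 0 \<and> norm (A y) \<le> \<epsilon> * norm y"
proof (rule ccontr)
  assume "\<not> ?thesis"
  then have small: "\<epsilon> * norm y \<le> norm (A y)" for y
    by (cases "y = 0") (auto simp: bounded_clinear_zero[OF A] dest!: spec[of _ y])
  have est: "norm y \<le> (1/\<epsilon>) * (norm (A y) + (\<Sum>i\<in>{}. cmod ((\<lambda>_ _. 0) i y)))" for y
    using small[of y] assms(3) by (simp add: pos_le_divide_eq mult.commute)
  have "closed (range A)"
    by (rule estimate_imp_upper_semi_Fredholm(2)[OF A finite.emptyI bounded_clinear_const_zero est])
  moreover have "null_space A = {0}"
  proof -
    have "y = 0" if "A y = 0" for y
      using small[of y] assms(3) that by (simp add: mult_le_0_iff)
    then show ?thesis using bounded_clinear_zero[OF A] by (auto simp: null_space_def)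
  qed
  ultimately show False using assms(2) by blast
qed

section \<open>Lower semi-Fredholm operators through estimates on functionals\<close>

text \<open>Every \<open>x\<close> is A e + p with \<open>p\<close> in the span of \<open>B\<close>
  and both norms at most C norm x. Hence a functional is controlled by its composition with
  \<open>A\<close> and by finitely many values. This is the upper estimate for the transpose of
  \<open>A\<close>, written without a dual space.\<close>

lemma lower_semi_Fredholm_imp_estimate:
  fixes A :: "'e::complex_banach \<Rightarrow> 'x::complex_banach"
  assumes A: "bounded_clinear A" and fin: "ccodimension (range A) \<noteq> \<infinity>"
  obtains B :: "'x set" and C where "finite B" "0 \<le> C"
    "\<forall>w::'x \<Rightarrow> complex. bounded_clinear w \<longrightarrow>
       onorm w \<le> C * (onorm (w \<circ> A) + (\<Sum>b\<in>B. cmod (w b)))"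
proof -
  have ranA: "complex_vector.subspace (range A)"
    by (rule subspace_image[OF A complex_vector.subspace_UNIV])
  obtain B where B: "finite B" "complex_vector.independent B"
    "complex_vector.span B \<inter> range A = {0}" "complex_vector.span (range A \<union> B) = UNIV"
    by (rule ccodimension_finiteE[OF ranA fin])
  obtain \<phi> :: "'x \<Rightarrow> 'x \<Rightarrow> complex" where \<phi>: "\<forall>b. bounded_clinear (\<phi> b)"
    "\<forall>x\<in>complex_vector.span B. (\<Sum>b\<in>B. \<phi> b x *\<^sub>C b) = x"
    by (rule dual_basis[OF B(1,2)])
  have \<phi>': "bounded_clinear (\<phi> b)" for b using \<phi>(1) by simp
  let ?g = "\<lambda>(e, p). A e + p"
  let ?M = "UNIV \<times> complex_vector.span B"
  have bl: "bounded_linear ?g"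
    unfolding case_prod_beta
    by (intro bounded_linear_add bounded_linear_snd
        bounded_linear_compose[OF bounded_clinear_bounded_linear[OF A] bounded_linear_fst])
  have sub: "subspace ?M"
    by (intro subspace_Times subspace_UNIV subspace_real_of_complex complex_vector.subspace_span)
  have im: "?g ` ?M = UNIV"
  proof -
    have "x \<in> ?g ` ?M" for x
    proof -
      have "x \<in> complex_vector.span (range A \<union> B)" by (simp add: B(4))
      then obtain v w where "x = v + w" "v \<in> range A" "w \<in> complex_vector.span B"
        unfolding complex_vector.span_Un complex_vector.span_eq_iff[THEN iffD2, OF ranA] by blast
      then obtain e where "x = A e + w" "w \<in> complex_vector.span B" by blast
      then show ?thesis by (intro image_eqI[of _ _ "(e, w)"]) auto
    qed
    then show ?thesis by blast
  qed
  have "closed (?g ` ?M)" unfolding im by (rule closed_UNIV)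
  then obtain C where C0: "0 \<le> C" and C: "\<forall>x\<in>?g ` ?M. \<exists>m\<in>?M. ?g m = x \<and> norm m \<le> C * norm x"
    by (rule open_mapping[OF bl sub closed_Times[OF closed_UNIV closed_span_finite[OF B(1)]]])
  define R where "R = (\<Sum>b\<in>B. onorm (\<phi> b))"
  have R: "0 \<le> R" unfolding R_def by (intro sum_nonneg bounded_clinear_onorm_nonneg[OF \<phi>'])
  have "onorm w \<le> (C + R * C) * (onorm (w \<circ> A) + (\<Sum>b\<in>B. cmod (w b)))"
    if w: "bounded_clinear w" for w :: "'x \<Rightarrow> complex"
  proof (rule onorm_bound)
    let ?s = "\<Sum>b\<in>B. cmod (w b)"
    have wA: "bounded_clinear (w \<circ> A)" by (rule bounded_clinear_comp[OF w A])
    have nonneg: "0 \<le> onorm (w \<circ> A)" "0 \<le> ?s"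
      by (auto intro: bounded_clinear_onorm_nonneg[OF wA] sum_nonneg)
    then show "0 \<le> (C + R * C) * (onorm (w \<circ> A) + ?s)" using C0 R by simp
    fix x
    obtain e p where ep: "p \<in> complex_vector.span B" "A e + p = x" "norm (e, p) \<le> C * norm x"
      using bspec[OF C, of x] unfolding im by auto
    have e: "norm e \<le> C * norm x" and p: "norm p \<le> C * norm x"
      using ep(3) norm_fst_le[of e p] norm_snd_le[of p e] by auto
    have "w p = (\<Sum>b\<in>B. \<phi> b p * w b)"
    proof -
      have "w (\<Sum>b\<in>B. \<phi> b p *\<^sub>C b) = (\<Sum>b\<in>B. \<phi> b p * w b)"
        by (simp add: bounded_clinear_sum[OF w] bounded_clinear_scaleC[OF w] scaleC_complex_def)
      then show ?thesis using \<phi>(2) ep(1) by simp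
    qed
    then have "cmod (w p) \<le> (\<Sum>b\<in>B. cmod (\<phi> b p) * cmod (w b))"
      using norm_sum[of "\<lambda>b. \<phi> b p * w b" B] by (simp add: norm_mult)
    also have "\<dots> \<le> (\<Sum>b\<in>B. (R * norm p) * cmod (w b))"
    proof (intro sum_mono mult_right_mono norm_ge_zero)
      fix b assume "b \<in> B"
      then have "onorm (\<phi> b) \<le> R"
        unfolding R_def using B(1) by (intro member_le_sum bounded_clinear_onorm_nonneg[OF \<phi>']) auto
      then have "onorm (\<phi> b) * norm p \<le> R * norm p" by (rule mult_right_mono) simp
      then show "cmod (\<phi> b p) \<le> R * norm p"
        using bounded_clinear_onorm[OF \<phi>', of b p] by simp
    qed
    also have "\<dots> = R * norm p * ?s" by (simp add: sum_distrib_left)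
    also have "\<dots> \<le> R * (C * norm x) * ?s"
      using p R nonneg(2) by (intro mult_right_mono mult_left_mono)
    finally have wp: "cmod (w p) \<le> R * (C * norm x) * ?s" .
    have "cmod (w (A e)) \<le> onorm (w \<circ> A) * norm e"
      using bounded_clinear_onorm[OF wA, of e] by simp
    also have "\<dots> \<le> onorm (w \<circ> A) * (C * norm x)" using e nonneg(1) by (rule mult_left_mono)
    finally have we: "cmod (w (A e)) \<le> onorm (w \<circ> A) * (C * norm x)" .
    have "cmod (w x) \<le> onorm (w \<circ> A) * (C * norm x) + R * (C * norm x) * ?s"
      using norm_triangle_ineq[of "w (A e)" "w p"] we wp ep(2) bounded_clinear_add[OF w, of "A e" p]
      by simp
    moreover have "0 \<le> C * norm x * ?s" "0 \<le> R * (C * norm x) * onorm (w \<circ> A)"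
      using C0 R nonneg by auto
    ultimately show "norm (w x) \<le> (C + R * C) * (onorm (w \<circ> A) + ?s) * norm x"
      by (simp add: algebra_simps)
  qed
  then show ?thesis using C0 R B(1) by (intro that[of B "C + R * C"]) auto
qed

text \<open>For large \<open>t\<close>, the seminorm measuring how cheaply \<open>x\<close> is approximated by elements
  \<open>A e + p\<close>, errors being weighted by \<open>t\<close>, is compared with the norm by means of its support
  functionals.\<close>

lemma estimate_imp_lower_semi_Fredholm:
  fixes A :: "'e::complex_banach \<Rightarrow> 'x::complex_banach" and d :: "'i \<Rightarrow> 'x"
  assumes A: "bounded_clinear A" and I: "finite I" and C: "0 \<le> C"
    and est: "\<And>u::'x \<Rightarrow> complex. bounded_clinear u \<Longrightarrow>
       onorm u \<le> C * (onorm (u \<circ> A) + (\<Sum>i\<in>I. cmod (u (d i))))"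
  shows "complex_vector.span (range A \<union> d ` I) = UNIV"
proof -
  let ?F = "complex_vector.span (d ` I)"
  let ?M = "UNIV \<times> ?F"
  let ?g = "\<lambda>(e, p). A e + p"
  have bl: "bounded_linear ?g"
    unfolding case_prod_beta
    by (intro bounded_linear_add bounded_linear_snd
        bounded_linear_compose[OF bounded_clinear_bounded_linear[OF A] bounded_linear_fst])
  have sub: "subspace ?M"
    by (intro subspace_Times subspace_UNIV subspace_real_of_complex complex_vector.subspace_span)
  have clM: "closed ?M"
    by (intro closed_Times closed_UNIV closed_span_finite finite_imageI I)
  \<comment> \<open>\<open>K\<close> bounds the seminorm \<open>p\<close> below and must not depend
    on \<open>t\<close>. Only then can \<open>t\<close> be chosen as 2 (K + 1), so that a total cost
    of at most (K + 1) norm x forces an error of at most norm x / 2.\<close>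
  define K where "K = C * (1 + (\<Sum>i\<in>I. norm (d i)))"
  have K: "0 \<le> K" unfolding K_def using C by (intro mult_nonneg_nonneg add_nonneg_nonneg sum_nonneg) auto
  define t where "t = 2 * (K + 1)"
  have t: "0 < t" using K by (simp add: t_def)
  define c where "c x m = norm (fst m) + norm (snd m) + t * norm (x - A (fst m) - snd m)" for x and m :: "'e \<times> 'x"
  define p where "p x = (INF m\<in>?M. c x m)" for x
  have c_nonneg: "0 \<le> c x m" for x m using t by (simp add: c_def)
  have zM: "(0, 0) \<in> ?M" by (simp add: complex_vector.span_zero)
  have lower: "p x \<le> c x m" if "m \<in> ?M" for x m
    unfolding p_def using that c_nonneg by (intro cINF_lower bdd_belowI2[where m=0])
  have greatest: "b \<le> p x" if "\<And>m. m \<in> ?M \<Longrightarrow> b \<le> c x m" for b x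
    unfolding p_def using that zM by (intro cINF_greatest) auto
  have p_add: "p (x + y) \<le> p x + p y" for x y
  proof -
    have *: "p (x + y) \<le> c x m + c y n" if "m \<in> ?M" "n \<in> ?M" for m n
    proof -
      have "p (x + y) \<le> c (x + y) (m + n)"
        by (rule lower[OF subspace_add[OF sub that]])
      also have "\<dots> \<le> c x m + c y n"
      proof -
        have "x + y - A (fst (m + n)) - snd (m + n) = (x - A (fst m) - snd m) + (y - A (fst n) - snd n)"
          by (simp add: bounded_clinear_add[OF A])
        then have "norm (x + y - A (fst (m + n)) - snd (m + n)) \<le> norm (x - A (fst m) - snd m) + norm (y - A (fst n) - snd n)"
          using norm_triangle_ineq by metis
        then have "t * norm (x + y - A (fst (m + n)) - snd (m + n)) \<le> t * norm (x - A (fst m) - snd m) + t * norm (y - A (fst n) - snd n)"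
          using t by (simp add: distrib_left[symmetric])
        then show ?thesis
          unfolding c_def using norm_triangle_ineq[of "fst m" "fst n"] norm_triangle_ineq[of "snd m" "snd n"]
          by simp
      qed
      finally show ?thesis .
    qed
    have "p (x + y) - c x m \<le> p y" if "m \<in> ?M" for m
      using *[OF that] by (intro greatest) (simp add: algebra_simps)
    then have "p (x + y) - p y \<le> p x" by (intro greatest) (simp add: algebra_simps)
    then show ?thesis by simp
  qed
  have scale_le: "p (a *\<^sub>C x) \<le> cmod a * p x" if "a \<noteq> 0" for a x
  proof -
    have "p (a *\<^sub>C x) / cmod a \<le> p x"
    proof (rule greatest)
      fix m :: "'e \<times> 'x" assume m: "m \<in> ?M"
      have "(a *\<^sub>C fst m, a *\<^sub>C snd m) \<in> ?M" using m by (auto intro: complex_vector.span_scale)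
      then have "p (a *\<^sub>C x) \<le> c (a *\<^sub>C x) (a *\<^sub>C fst m, a *\<^sub>C snd m)" by (rule lower)
      also have "\<dots> = cmod a * c x m"
      proof -
        have "a *\<^sub>C x - A (a *\<^sub>C fst m) - a *\<^sub>C snd m = a *\<^sub>C (x - A (fst m) - snd m)"
          by (simp add: bounded_clinear_scaleC[OF A] complex_vector.scale_right_diff_distrib)
        then have "norm (a *\<^sub>C x - A (a *\<^sub>C fst m) - a *\<^sub>C snd m) = cmod a * norm (x - A (fst m) - snd m)"
          by (simp only: norm_scaleC)
        then show ?thesis by (simp add: c_def norm_scaleC distrib_left mult.left_commute)
      qed
      finally show "p (a *\<^sub>C x) / cmod a \<le> c x m"
        using that by (simp add: pos_divide_le_eq mult.commute)
    qed
    then show ?thesis using that by (simp add: pos_divide_le_eq mult.commute)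
  qed
  have p_scale: "p (a *\<^sub>C x) = cmod a * p x" for a x
  proof (cases "a = 0")
    case True
    have "p 0 \<le> 0" using lower[OF zM, of 0] by (simp add: c_def bounded_clinear_zero[OF A])
    moreover have "0 \<le> p 0" by (rule greatest[OF c_nonneg])
    ultimately show ?thesis using True by simp
  next
    case False
    have "p ((1/a) *\<^sub>C (a *\<^sub>C x)) \<le> cmod (1/a) * p (a *\<^sub>C x)"
      using False by (intro scale_le) auto
    then have "cmod a * p x \<le> p (a *\<^sub>C x)"
      using False by (simp add: norm_divide pos_le_divide_eq mult.commute scaleC_scaleC)
    then show ?thesis using scale_le[OF False, of x] by simp
  qed
  have p_le: "p x \<le> K * norm x" for x
  proof -
    obtain u where u: "\<And>x y. u (x + y) = u x + u y" "\<And>c x. u (c *\<^sub>C x) = c * u x"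
      "\<And>x. cmod (u x) \<le> p x" "u x = complex_of_real (p x)"
      by (rule hahn_banach_seminorm[of p x, OF p_add p_scale]) blast
    \<comment> \<open>The choice e = p = 0 shows that \<open>u\<close> is bounded, but only by
      \<open>t\<close>. The bound by \<open>K\<close> comes from \<open>est\<close> and from the
      points \<open>A e\<close> and \<open>d i\<close>, which are approximated with error 0, so that
      \<open>t\<close> drops out.\<close>
    have "cmod (u y) \<le> norm y * t" for y
      using order_trans[OF u(3) lower[OF zM, of y]] by (simp add: c_def bounded_clinear_zero[OF A] mult.commute)
    then have uc: "bounded_clinear u"
      by (intro bounded_clinearI[where K=t]) (simp_all add: u(1,2) scaleC_complex_def)
    have "cmod (u (A e)) \<le> 1 * norm e" for e
    proof -
      have "cmod (u (A e)) \<le> c (A e) (e, 0)"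
        by (rule order_trans[OF u(3) lower]) (simp add: complex_vector.span_zero)
      then show ?thesis by (simp add: c_def)
    qed
    then have "onorm (u \<circ> A) \<le> 1" by (intro onorm_bound) auto
    moreover have "cmod (u (d i)) \<le> norm (d i)" if "i \<in> I" for i
    proof -
      have "cmod (u (d i)) \<le> c (d i) (0, d i)"
        using that by (intro order_trans[OF u(3) lower]) (auto intro: complex_vector.span_base)
      then show ?thesis by (simp add: c_def bounded_clinear_zero[OF A])
    qed
    then have "(\<Sum>i\<in>I. cmod (u (d i))) \<le> (\<Sum>i\<in>I. norm (d i))" by (rule sum_mono)
    ultimately have "onorm u \<le> K"
      unfolding K_def using C by (intro order_trans[OF est[OF uc]] mult_left_mono add_mono)
    then have "cmod (u x) \<le> K * norm x"
      using bounded_clinear_onorm[OF uc, of x] by (meson mult_right_mono norm_ge_zero order_trans)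
    then show ?thesis using u(4) by simp
  qed
  have approx: "\<exists>m\<in>?M. norm m \<le> (K + 1) * norm x \<and> norm (x - ?g m) \<le> norm x / 2" for x
  proof (cases "x = 0")
    case True
    then show ?thesis using zM by (intro bexI[of _ "(0,0)"]) (auto simp: bounded_clinear_zero[OF A] norm_prod_def)
  next
    case False
    \<comment> \<open>The infimum need not be attained; the gap between \<open>K\<close> and
      \<open>K + 1\<close> provides an actual element for nonzero \<open>x\<close>.\<close>
    have "\<exists>m\<in>?M. c x m \<le> (K + 1) * norm x"
    proof (rule ccontr)
      assume "\<not> ?thesis"
      then have "(K + 1) * norm x \<le> p x" by (intro greatest) (meson linear)
      moreover have "0 < norm x" using False by simp
      ultimately show False using p_le[of x] by (simp add: algebra_simps)
    qed
    then obtain e q where m: "(e, q) \<in> ?M" "norm e + norm q + t * norm (x - A e - q) \<le> (K + 1) * norm x"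
      unfolding c_def by auto
    have "t * (norm x / 2) = (K + 1) * norm x" by (simp add: t_def)
    then have "t * norm (x - A e - q) \<le> t * (norm x / 2)"
      using m(2) norm_ge_zero[of e] norm_ge_zero[of q] by linarith
    then have "norm (x - A e - q) \<le> norm x / 2" using t by simp
    moreover have "norm (e, q) \<le> (K + 1) * norm x"
    proof -
      have "0 \<le> t * norm (x - A e - q)" using t by simp
      then show ?thesis using norm_Pair_le[of e q] m(2) by linarith
    qed
    ultimately show ?thesis using m(1) by (intro bexI[of _ "(e, q)"]) (auto simp: algebra_simps)
  qed
  have K1: "0 \<le> K + 1" using K by simp
  have "x \<in> complex_vector.span (range A \<union> d ` I)" for x
  proof -
    have "\<exists>m\<in>?M. ?g m = x \<and> norm m \<le> 2 * (K + 1) * norm x"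
      by (rule approximate_solution_imp_solution[OF bl sub clM subspace_UNIV subset_UNIV K1 approx UNIV_I])
    then obtain e q where "q \<in> ?F" "x = A e + q" by auto
    moreover have "A e \<in> complex_vector.span (range A)" by (intro complex_vector.span_base) simp
    ultimately show ?thesis unfolding complex_vector.span_Un by blast
  qed
  then show ?thesis by blast
qed

text \<open>Otherwise the estimate on functionals holds with no exceptional vectors at all, and the
  range is everything. This is the dual counterpart of an approximate null vector.\<close>

lemma not_surjective_imp_small:
  fixes A :: "'e::complex_banach \<Rightarrow> 'x::complex_banach"
  assumes A: "bounded_clinear A" and "range A \<noteq> UNIV" and "0 < \<epsilon>"
  shows "\<exists>u::'x \<Rightarrow> complex. bounded_clinear u \<and> 0 < onorm u \<and> onorm (u \<circ> A) \<le> \<epsilon> * onorm u"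
proof (rule ccontr)
  assume neg: "\<not> ?thesis"
  have small: "onorm u \<le> (1/\<epsilon>) * (onorm (u \<circ> A) + (\<Sum>i\<in>{}. cmod (u ((\<lambda>_. 0) i))))" if u: "bounded_clinear u" for u :: "'x \<Rightarrow> complex"
  proof (cases "onorm u = 0")
    case True
    then show ?thesis using bounded_clinear_onorm_nonneg[OF bounded_clinear_comp[OF u A]] assms(3) by simp
  next
    case False
    then have "0 < onorm u" using bounded_clinear_onorm_nonneg[OF u] by simp
    then have "\<epsilon> * onorm u \<le> onorm (u \<circ> A)" using neg u by (meson linear)
    then show ?thesis using assms(3) by (simp add: pos_le_divide_eq mult.commute)
  qed
  have "complex_vector.span (range A \<union> (\<lambda>_. 0) ` {}) = UNIV"
    using assms(3) by (intro estimate_imp_lower_semi_Fredholm[OF A finite.emptyI _ small]) auto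
  moreover have "complex_vector.subspace (range A)"
    by (rule subspace_image[OF A complex_vector.subspace_UNIV])
  ultimately show False using assms(2) by (simp add: complex_vector.span_eq_iff[THEN iffD2])
qed

section \<open>Parametrices of rows and columns\<close>

text \<open>For the row of a shifted tuple this is membership in the complement of the essential
  split defect spectrum. It is phrased for a single operator so that the arguments on parametrices
  need not mention tuples; \<open>upper_split_Fredholm\<close> does the same for columns.\<close>

definition lower_split_Fredholm :: "('e::complex_normed_vector \<Rightarrow> 'x::complex_normed_vector) \<Rightarrow> bool" where
  "lower_split_Fredholm A \<longleftrightarrow>
     ccodimension (range A) \<noteq> \<infinity> \<and> has_direct_complement (null_space A)"

definition upper_split_Fredholm :: "('e::complex_normed_vector \<Rightarrow> 'x::complex_normed_vector) \<Rightarrow> bool" where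
  "upper_split_Fredholm A \<longleftrightarrow>
     cdimension (null_space A) \<noteq> \<infinity> \<and> closed (range A) \<and> has_direct_complement (range A)"

lemma finite_rankI: "finite B \<Longrightarrow> (\<And>x. K x \<in> complex_vector.span B) \<Longrightarrow> finite_rank K"
  unfolding finite_rank_def by blast

lemma finite_rank_zero: "finite_rank (\<lambda>x. 0)"
  by (rule finite_rankI[OF finite.emptyI]) simp

text \<open>On a complement \<open>M\<close> of its kernel \<open>A\<close> is injective with
  unchanged range, and a finite-dimensional \<open>F\<close> complements that range, so inverting
  (m, f) -> A m + f gives \<open>W\<close> and the projection \<open>P\<close> onto
  \<open>F\<close>. If \<open>A\<close> is onto, \<open>F\<close> meets the range only in 0 and
  \<open>P\<close> vanishes.\<close>

lemma lower_parametrix: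
  fixes A :: "'e::complex_banach \<Rightarrow> 'x::complex_banach"
  assumes A: "bounded_clinear A" and fred: "lower_split_Fredholm A"
  obtains W P where "bounded_clinear W" "bounded_clinear P" "finite_rank P"
    "\<forall>x. A (W x) + P x = x" "range A = UNIV \<longrightarrow> P = (\<lambda>x. 0)"
proof -
  have ranA: "complex_vector.subspace (range A)"
    by (rule subspace_image[OF A complex_vector.subspace_UNIV])
  have fin: "ccodimension (range A) \<noteq> \<infinity>" and "has_direct_complement (null_space A)"
    using fred by (auto simp: lower_split_Fredholm_def)
  then obtain M where M: "complex_vector.subspace M" "closed M" "null_space A \<inter> M = {0}"
    "{x + y |x y. x \<in> null_space A \<and> y \<in> M} = UNIV"
    unfolding has_direct_complement_def by blast
  obtain B where B: "finite B" "complex_vector.independent B"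
    "complex_vector.span B \<inter> range A = {0}" "complex_vector.span (range A \<union> B) = UNIV"
    by (rule ccodimension_finiteE[OF ranA fin])
  let ?F = "complex_vector.span B"
  have AM: "A ` M = range A"
  proof
    show "range A \<subseteq> A ` M"
    proof safe
      fix x
      have "x \<in> {x + y |x y. x \<in> null_space A \<and> y \<in> M}" unfolding M(4) by simp
      then obtain n m where "x = n + m" "n \<in> null_space A" "m \<in> M" by blast
      then show "A x \<in> A ` M" by (auto simp: null_space_def bounded_clinear_add[OF A])
    qed
  qed auto
  have sum: "{x + y |x y. x \<in> A ` M \<and> y \<in> ?F} = UNIV"
    using B(4) unfolding AM complex_vector.span_Un complex_vector.span_eq_iff[THEN iffD2, OF ranA] .
  have inter: "A ` M \<inter> ?F = {0}" using B(3) unfolding AM by (simp only: Int_commute)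
  obtain W P where WP: "bounded_clinear W" "bounded_clinear P" "\<forall>x. P x \<in> ?F"
    "\<forall>x. A (W x) + P x = x" "\<forall>l\<in>M. \<forall>f\<in>?F. W (A l + f) = l"
    by (rule inverse_of_direct_decomposition[OF A M(1,2) complex_vector.subspace_span
          closed_span_finite[OF B(1)] M(3) inter sum])
  have "P = (\<lambda>x. 0)" if "range A = UNIV"
  proof
    fix x
    have "P x \<in> ?F \<inter> range A" using WP(3) that by auto
    then show "P x = 0" using B(3) by simp
  qed
  then show ?thesis
    using WP(4) by (intro that[OF WP(1,2) finite_rankI[OF B(1) spec[OF WP(3)]]]) auto
qed

text \<open>The range of \<open>A\<close> together with that of \<open>K\<close> spans everything.
  Moreover A - A V A = K A has finite rank, so \<open>V\<close> can be corrected to a generalized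
  inverse, whose existence splits the kernel.\<close>

lemma lower_parametrix_imp_split:
  fixes A :: "'e::complex_banach \<Rightarrow> 'x::complex_banach"
  assumes A: "bounded_clinear A" and V: "bounded_clinear V" and K: "finite_rank K"
    and AV: "\<And>x. A (V x) + K x = x"
  shows "lower_split_Fredholm A"
proof -
  obtain B where B: "finite B" "range K \<subseteq> complex_vector.span B"
    using K by (auto simp: finite_rank_def)
  have ranA: "complex_vector.subspace (range A)"
    by (rule subspace_image[OF A complex_vector.subspace_UNIV])
  have "x \<in> complex_vector.span (range A \<union> B)" for x
  proof -
    have "A (V x) \<in> complex_vector.span (range A)" by (intro complex_vector.span_base) simp
    moreover have "K x \<in> complex_vector.span B" using B(2) by blast
    ultimately show ?thesis
      unfolding complex_vector.span_Un mem_Collect_eq using AV[of x] by metis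
  qed
  then have "ccodimension (range A) \<noteq> \<infinity>" by (intro ccodimension_finiteI[OF ranA B(1)]) blast
  moreover have "A x - A (V (A x)) = K (A x)" for x using AV[of "A x"] by (simp add: diff_eq_eq add.commute)
  then have "finite_rank (\<lambda>x. A x - A (V (A x)))" using finite_rank_compose_right[OF K, of A] by simp
  then obtain G where "bounded_clinear G" "\<And>x. A (G (A x)) = A x"
    using generalized_inverse_modulo_finite_rank[OF A V] by blast
  then have "has_direct_complement (null_space A)" by (rule generalized_inverse_complements[OF A])
  ultimately show ?thesis by (simp add: lower_split_Fredholm_def)
qed

text \<open>A dual basis of the finite-dimensional kernel gives a bounded projection
  \<open>R\<close> onto it, whose null space is the closed complement on which \<open>A\<close> is
  inverted. The remainder is \<open>R\<close> itself, since \<open>W\<close> returns x - R x from A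
  x = A (x - R x).\<close>

lemma upper_parametrix:
  fixes A :: "'e::complex_banach \<Rightarrow> 'x::complex_banach"
  assumes A: "bounded_clinear A" and fred: "upper_split_Fredholm A"
  obtains W P where "bounded_clinear W" "bounded_clinear P" "finite_rank P"
    "\<forall>x. W (A x) + P x = x" "null_space A = {0} \<longrightarrow> P = (\<lambda>x. 0)"
proof -
  have fin: "cdimension (null_space A) \<noteq> \<infinity>" and "has_direct_complement (range A)"
    using fred by (auto simp: upper_split_Fredholm_def)
  then obtain F where F: "complex_vector.subspace F" "closed F" "range A \<inter> F = {0}"
    "{x + y |x y. x \<in> range A \<and> y \<in> F} = UNIV"
    unfolding has_direct_complement_def by blast
  obtain B where B: "finite B" "complex_vector.independent B" "complex_vector.span B = null_space A"
    by (rule cdimension_finiteE[OF subspace_null_space[OF A] fin])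
  obtain \<phi> :: "'e \<Rightarrow> 'e \<Rightarrow> complex" where \<phi>: "\<forall>b. bounded_clinear (\<phi> b)"
    "\<forall>x\<in>complex_vector.span B. (\<Sum>b\<in>B. \<phi> b x *\<^sub>C b) = x"
    by (rule dual_basis[OF B(1,2)])
  define R where "R x = (\<Sum>b\<in>B. \<phi> b x *\<^sub>C b)" for x
  have R: "bounded_clinear R"
    unfolding R_def by (intro bounded_clinear_sums bounded_clinear_scaleC_left spec[OF \<phi>(1)])
  have R_in: "R x \<in> null_space A" for x
    unfolding R_def B(3)[symmetric]
    by (intro complex_vector.span_sum complex_vector.span_scale complex_vector.span_base)
  have R_id: "R x = x" if "x \<in> null_space A" for x
    using \<phi>(2) that by (simp add: R_def B(3))
  have L: "null_space A \<inter> null_space R = {0}"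
    using R_id by (auto simp: null_space_def bounded_clinear_zero[OF A] bounded_clinear_zero[OF R])
  have split: "x - R x \<in> null_space R" for x
    using R_id[OF R_in] by (simp add: null_space_def bounded_clinear_diff[OF R])
  have A_split: "A (x - R x) = A x" for x
    using R_in by (simp add: null_space_def bounded_clinear_diff[OF A])
  have AL: "A ` null_space R = range A"
    using split A_split by (auto simp: image_iff) metis
  obtain W Q where W: "bounded_clinear W" "bounded_clinear Q" "\<forall>x. Q x \<in> F"
    "\<forall>x. A (W x) + Q x = x" "\<forall>l\<in>null_space R. \<forall>f\<in>F. W (A l + f) = l"
    by (rule inverse_of_direct_decomposition[OF A subspace_null_space[OF R] closed_null_space[OF R] F(1,2) L
          F(3)[folded AL] F(4)[folded AL]])
  have "W (A x) + R x = x" for x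
    using bspec[OF bspec[OF W(5) split] complex_vector.subspace_0[OF F(1)], of x] by (simp add: A_split)
  moreover have "finite_rank R"
    using R_in B(1,3) by (intro finite_rankI[of B]) auto
  moreover have "R = (\<lambda>x. 0)" if "null_space A = {0}" using R_in that by auto
  ultimately show ?thesis using that W(1) R by blast
qed

text \<open>On the kernel of \<open>A\<close> the remainder \<open>K\<close> is the identity, so the
  kernel lies in its finite-dimensional range. Here A - A V A = A K has finite rank, and a
  generalized inverse makes the range closed and complemented.\<close>

lemma upper_parametrix_imp_split:
  fixes A :: "'e::complex_banach \<Rightarrow> 'x::complex_banach"
  assumes A: "bounded_clinear A" and V: "bounded_clinear V" and K: "finite_rank K"
    and VA: "\<And>x. V (A x) + K x = x"
  shows "upper_split_Fredholm A"
proof -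
  obtain B where B: "finite B" "range K \<subseteq> complex_vector.span B"
    using K by (auto simp: finite_rank_def)
  have "null_space A \<subseteq> complex_vector.span B"
  proof
    fix x assume "x \<in> null_space A"
    then have "x = K x" using VA[of x] by (simp add: null_space_def bounded_clinear_zero[OF V])
    then show "x \<in> complex_vector.span B" using B(2) by (metis rangeI subsetD)
  qed
  then have "cdimension (null_space A) \<noteq> \<infinity>" by (rule cdimension_finiteI[OF B(1)])
  moreover have "A x - A (V (A x)) = A (K x)" for x
  proof -
    have "x - V (A x) = K x" using VA[of x] by (simp add: diff_eq_eq add.commute)
    then show ?thesis by (metis bounded_clinear_diff[OF A])
  qed
  then have "finite_rank (\<lambda>x. A x - A (V (A x)))" using finite_rank_compose_left[OF A K] by simp
  then obtain G where "bounded_clinear G" "\<And>x. A (G (A x)) = A x"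
    using generalized_inverse_modulo_finite_rank[OF A V] by blast
  then have "has_direct_complement (range A)" "closed (range A)"
    by (rule generalized_inverse_complements[OF A])+
  ultimately show ?thesis by (simp add: upper_split_Fredholm_def)
qed

section \<open>Norms and coordinates of rows and columns\<close>

lemma norm_axis: "norm (axis i x) = norm x"
proof -
  have "(\<Sum>j\<in>UNIV. (norm (axis i x $ j))\<^sup>2) = (\<Sum>j\<in>UNIV. if j = i then (norm x)\<^sup>2 else 0)"
    by (intro sum.cong) (auto simp: axis_def)
  then show ?thesis by (simp add: norm_vec_def L2_set_def)
qed

lemma norm_component_le_col_op: "norm (T i x) \<le> norm (col_op T x)"
  using Finite_Cartesian_Product.norm_nth_le[of "col_op T x" i] by (simp add: col_op_def)

lemma norm_col_op_le: "norm (col_op T x) \<le> (\<Sum>i\<in>UNIV. norm (T i x))"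
  using L2_set_le_sum_abs[of "\<lambda>i. norm (T i x)" UNIV] by (simp add: norm_vec_def col_op_def)

lemma onorm_component_le_row_op:
  assumes "\<And>i. bounded_clinear (T i)" and "bounded_clinear w"
  shows "onorm (w \<circ> T i) \<le> onorm (w \<circ> row_op T)"
proof (rule onorm_bound)
  have wT: "bounded_clinear (w \<circ> row_op T)"
    by (rule bounded_clinear_comp[OF assms(2) bounded_clinear_row_op[OF assms(1)]])
  then show "0 \<le> onorm (w \<circ> row_op T)" by (rule bounded_clinear_onorm_nonneg)
  show "norm ((w \<circ> T i) x) \<le> onorm (w \<circ> row_op T) * norm x" for x
    using bounded_clinear_onorm[OF wT, of "axis i x"] by (simp add: row_op_axis[OF assms(1)] norm_axis)
qed

lemma onorm_row_op_le:
  assumes T: "\<And>i. bounded_clinear (T i)" and w: "bounded_clinear w"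
  shows "onorm (w \<circ> row_op T) \<le> (\<Sum>i\<in>UNIV. onorm (w \<circ> T i))"
proof (rule onorm_bound)
  have wT: "bounded_clinear (w \<circ> T i)" for i by (rule bounded_clinear_comp[OF w T])
  show "0 \<le> (\<Sum>i\<in>UNIV. onorm (w \<circ> T i))" by (intro sum_nonneg bounded_clinear_onorm_nonneg[OF wT])
  fix x
  have "norm ((w \<circ> row_op T) x) \<le> (\<Sum>i\<in>UNIV. norm ((w \<circ> T i) (x $ i)))"
    unfolding comp_def row_op_def bounded_clinear_sum[OF w] by (rule norm_sum)
  also have "\<dots> \<le> (\<Sum>i\<in>UNIV. onorm (w \<circ> T i) * norm x)"
  proof (rule sum_mono)
    fix i
    have "norm ((w \<circ> T i) (x $ i)) \<le> onorm (w \<circ> T i) * norm (x $ i)" by (rule bounded_clinear_onorm[OF wT])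
    also have "\<dots> \<le> onorm (w \<circ> T i) * norm x"
      by (intro mult_left_mono Finite_Cartesian_Product.norm_nth_le bounded_clinear_onorm_nonneg[OF wT])
    finally show "norm ((w \<circ> T i) (x $ i)) \<le> onorm (w \<circ> T i) * norm x" .
  qed
  finally show "norm ((w \<circ> row_op T) x) \<le> (\<Sum>i\<in>UNIV. onorm (w \<circ> T i)) * norm x"
    by (simp add: sum_distrib_right)
qed

lemma vec_eq_sum_axis: "x = (\<Sum>i\<in>UNIV. axis i (x $ i))"
proof -
  have "(\<Sum>i\<in>UNIV. axis i (x $ i) $ j) = (\<Sum>i\<in>UNIV. if j = i then x $ i else 0)" for j
    by (intro sum.cong) (auto simp: axis_def)
  then show ?thesis by (simp add: vec_eq_iff)
qed

lemma sum_UNIV_Plus: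
  fixes f :: "'n::finite + 'm::finite \<Rightarrow> 'a::comm_monoid_add"
  shows "(\<Sum>k\<in>UNIV. f k) = (\<Sum>i\<in>UNIV. f (Inl i)) + (\<Sum>j\<in>UNIV. f (Inr j))"
proof -
  have "(\<Sum>k\<in>UNIV <+> UNIV. f k) = (\<Sum>i\<in>UNIV. f (Inl i)) + (\<Sum>j\<in>UNIV. f (Inr j))"
    by (rule trans[OF sum.Plus]) (simp_all add: comp_def)
  then show ?thesis by (simp only: UNIV_Plus_UNIV)
qed

section \<open>Closed subspaces of Hilbert spaces\<close>

lemma hilbert_space_direct_complement:
  fixes M :: "'a::complex_banach set"
  assumes H: "hilbert_space TYPE('a)" and M: "complex_vector.subspace M" "closed M"
  shows "has_direct_complement M"
proof -
  obtain ip :: "'a \<Rightarrow> 'a \<Rightarrow> complex" where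
    ip_add: "\<And>x y z. ip (x + y) z = ip x z + ip y z" and
    ip_scale: "\<And>c x y. ip (c *\<^sub>C x) y = c * ip x y" and
    ip_cnj: "\<And>x y. ip y x = cnj (ip x y)" and
    ip_norm: "\<And>x. ip x x = complex_of_real ((norm x)\<^sup>2)"
    using H unfolding hilbert_space_def by blast
  have ip_add2: "ip z (x + y) = ip z x + ip z y" for x y z
    by (subst (1 2 3) ip_cnj) (simp add: ip_add)
  have ip_scale2: "ip x (c *\<^sub>C y) = cnj c * ip x y" for c x y
    by (subst (1 2) ip_cnj) (simp add: ip_scale)
  have norm_add: "(norm (x + y))\<^sup>2 = (norm x)\<^sup>2 + (norm y)\<^sup>2 + 2 * Re (ip x y)" for x y
  proof -
    have "Re (ip (x + y) (x + y)) = Re (ip x x) + Re (ip y y) + (Re (ip x y) + Re (ip y x))"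
      by (simp add: ip_add ip_add2)
    also have "Re (ip y x) = Re (ip x y)" by (subst ip_cnj) simp
    finally show ?thesis by (simp add: ip_norm)
  qed
  have ip_neg: "ip x (- y) = - ip x y" for x y
    using ip_scale2[of x "-1" y] by simp
  have parallelogram: "(norm (x + y))\<^sup>2 + (norm (x - y))\<^sup>2 = 2 * (norm x)\<^sup>2 + 2 * (norm y)\<^sup>2" for x y :: 'a
    using norm_add[of x y] norm_add[of x "- y"] by (simp add: ip_neg)
  have ne: "M \<noteq> {}" using complex_vector.subspace_0[OF M(1)] by blast

  \<comment> \<open>The orthogonal complement, described metrically: 0 is a nearest point of
    \<open>M\<close>. Closedness and the projection step are immediate in this form, while
    \<open>N_ip\<close> supplies the form in which \<open>N\<close> is seen to be a
    subspace.\<close>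
  define N where "N = {y. \<forall>m\<in>M. norm y \<le> norm (y - m)}"
  have N_ip: "N = {y. \<forall>m\<in>M. ip y m = 0}"
  proof
    show "{y. \<forall>m\<in>M. ip y m = 0} \<subseteq> N"
    proof
      fix y assume y: "y \<in> {y. \<forall>m\<in>M. ip y m = 0}"
      have "norm y \<le> norm (y - m)" if "m \<in> M" for m
      proof -
        have "ip y m = 0" using y that by blast
        then have "(norm y)\<^sup>2 \<le> (norm (y - m))\<^sup>2"
          using norm_add[of y "- m"] by (simp add: ip_neg)
        then show ?thesis by (rule power2_le_imp_le) simp
      qed
      then show "y \<in> N" by (simp add: N_def)
    qed
    show "N \<subseteq> {y. \<forall>m\<in>M. ip y m = 0}"
    proof safe
      fix y m assume y: "y \<in> N" and m: "m \<in> M"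
      let ?a = "ip y m"
      let ?s = "(cmod ?a)\<^sup>2"
      have le: "2 * ?s \<le> t * (?s * (norm m)\<^sup>2)" if t: "0 < t" for t
      proof -
        \<comment> \<open>Moving \<open>y\<close> by a small multiple of \<open>m\<close> in the
          direction of the phase of \<open>ip y m\<close> would shorten it to first order in
          \<open>t\<close>; minimality therefore bounds the first-order gain by the second-order
          loss.\<close>
        let ?c = "complex_of_real t * ?a"
        have "?c *\<^sub>C m \<in> M" by (rule complex_vector.subspace_scale[OF M(1) m])
        then have "(norm y)\<^sup>2 \<le> (norm (y - ?c *\<^sub>C m))\<^sup>2"
          using y by (intro power_mono) (auto simp: N_def)
        also have "\<dots> = (norm y)\<^sup>2 + (norm (?c *\<^sub>C m))\<^sup>2 - 2 * Re (ip y (?c *\<^sub>C m))"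
          using norm_add[of y "- (?c *\<^sub>C m)"] by (simp add: ip_neg)
        also have "ip y (?c *\<^sub>C m) = complex_of_real (t * ?s)"
        proof -
          have "complex_of_real ?s = ?a * cnj ?a" by (rule complex_norm_square)
          then show ?thesis by (simp only: ip_scale2 of_real_mult complex_cnj_mult complex_cnj_complex_of_real) (simp only: mult_ac)
        qed
        also have "(norm (?c *\<^sub>C m))\<^sup>2 = t * t * (?s * (norm m)\<^sup>2)"
          using t by (simp add: norm_scaleC norm_mult power_mult_distrib power2_eq_square)
        finally have "t * (2 * ?s) \<le> t * (t * (?s * (norm m)\<^sup>2))" by simp
        then show ?thesis using t by simp
      qed
      show "?a = 0"
      proof (rule ccontr)
        assume "?a \<noteq> 0"
        then have s: "0 < ?s" by simp
        \<comment> \<open>With this \<open>t\<close> one has t (norm m)^2 \<le> 1, and the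
          inequality becomes 2 s \<le> s.\<close>
        have "2 * ?s \<le> (1 / ((norm m)\<^sup>2 + 1)) * (?s * (norm m)\<^sup>2)"
          by (intro le) (simp add: add_nonneg_pos)
        also have "\<dots> \<le> ?s"
        proof -
          have "(norm m)\<^sup>2 / ((norm m)\<^sup>2 + 1) \<le> 1" by (simp add: divide_le_eq add_nonneg_pos)
          then have "?s * ((norm m)\<^sup>2 / ((norm m)\<^sup>2 + 1)) \<le> ?s * 1" by (rule mult_left_mono) simp
          then show ?thesis by simp
        qed
        finally show False using s by simp
      qed
    qed
  qed
  have subN: "complex_vector.subspace N"
  proof -
    have "ip 0 m = 0" for m using ip_scale[of 0 0 m] by simp
    then show ?thesis unfolding N_ip complex_vector.subspace_def by (simp add: ip_add ip_scale)
  qed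
  have clN: "closed N"
  proof -
    have "N = (\<Inter>m\<in>M. {y. norm y \<le> norm (y - m)})" by (auto simp: N_def)
    then show ?thesis by (auto intro!: closed_INT closed_Collect_le continuous_intros)
  qed
  have inter: "M \<inter> N = {0}"
  proof -
    have "x = 0" if "x \<in> M" "x \<in> N" for x
      using that ip_norm[of x] unfolding N_ip by auto
    then show ?thesis using complex_vector.subspace_0[OF M(1)] complex_vector.subspace_0[OF subN] by blast
  qed
  have "\<exists>m\<in>M. x - m \<in> N" for x
  proof -
    define d where "d = infdist x M"
    have d: "0 \<le> d" by (simp add: d_def infdist_nonneg)
    have d_le: "d \<le> norm (x - m)" if "m \<in> M" for m
      using infdist_le[OF that, of x] by (simp add: d_def dist_norm)
    have "\<exists>m\<in>M. (norm (x - m))\<^sup>2 < d\<^sup>2 + 1 / real (Suc k)" for k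
    proof (rule ccontr)
      assume neg: "\<not> ?thesis"
      let ?r = "sqrt (d\<^sup>2 + 1 / real (Suc k))"
      have "?r \<le> norm (x - m)" if "m \<in> M" for m
        using neg that by (intro real_le_lsqrt) (auto simp: not_less)
      then have "?r \<le> d"
        unfolding d_def infdist_notempty[OF ne] by (intro cINF_greatest ne) (simp add: dist_norm)
      then have "?r\<^sup>2 \<le> d\<^sup>2" by (intro power_mono) auto
      then have "d\<^sup>2 + 1 / real (Suc k) \<le> d\<^sup>2" by (simp add: add_nonneg_nonneg)
      then show False by simp
    qed
    then have "\<forall>k. \<exists>m. m \<in> M \<and> (norm (x - m))\<^sup>2 < d\<^sup>2 + 1 / real (Suc k)" by blast
    then obtain f where f: "\<And>k. f k \<in> M \<and> (norm (x - f k))\<^sup>2 < d\<^sup>2 + 1 / real (Suc k)"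
      using choice[of "\<lambda>k m. m \<in> M \<and> (norm (x - m))\<^sup>2 < d\<^sup>2 + 1 / real (Suc k)"] by blast
    \<comment> \<open>The midpoint of \<open>f j\<close> and \<open>f k\<close> lies in
      \<open>M\<close> and is at distance at least \<open>d\<close> from \<open>x\<close>, so by the
      parallelogram law the two excesses over the squared distance bound the squared gap. This is
      why the minimizing sequence was chosen with control of squares.\<close>
    have close: "(norm (f j - f k))\<^sup>2 \<le> 2 / real (Suc j) + 2 / real (Suc k)" for j k
    proof -
      let ?h = "(1/2) *\<^sub>R (f j + f k)"
      have "?h \<in> M"
        by (intro subspace_scale subspace_add subspace_real_of_complex M) (use f in auto)
      then have "d\<^sup>2 \<le> (norm (x - ?h))\<^sup>2" using d_le d by (intro power_mono) auto
      moreover have "(x - f j) + (x - f k) = 2 *\<^sub>R (x - ?h)" by (simp add: algebra_simps scaleR_2)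
      then have "(norm ((x - f j) + (x - f k)))\<^sup>2 = 4 * (norm (x - ?h))\<^sup>2"
        by (simp add: power_mult_distrib)
      moreover have "norm ((x - f j) - (x - f k)) = norm (f j - f k)"
        by (simp add: norm_minus_commute)
      ultimately have "(norm (f j - f k))\<^sup>2 \<le> 2 * (norm (x - f j))\<^sup>2 + 2 * (norm (x - f k))\<^sup>2 - 4 * d\<^sup>2"
        using parallelogram[of "x - f j" "x - f k"] by simp
      then show ?thesis using f[of j] f[of k] by simp
    qed
    have "Cauchy f"
      unfolding Cauchy_iff
    proof (intro allI impI)
      fix e :: real assume e: "0 < e"
      obtain K where K: "4 / e\<^sup>2 < real K" using reals_Archimedean2 by blast
      have "norm (f j - f k) < e" if "K \<le> j" "K \<le> k" for j k
      proof -
        have small: "1 / real (Suc l) < e\<^sup>2 / 4" if "K \<le> l" for l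
        proof -
          have "4 / e\<^sup>2 < real (Suc l)" using K that by simp
          then show ?thesis using e by (simp add: field_simps)
        qed
        have "(norm (f j - f k))\<^sup>2 < e\<^sup>2"
          using close[of j k] small[OF \<open>K \<le> j\<close>] small[OF \<open>K \<le> k\<close>] by simp
        then show ?thesis using e by (simp add: power2_less_imp_less)
      qed
      then show "\<exists>K. \<forall>j\<ge>K. \<forall>k\<ge>K. norm (f j - f k) < e" by blast
    qed
    then obtain m where lim: "f \<longlonglongrightarrow> m" using Cauchy_convergent convergent_def by blast
    have m: "m \<in> M" using closed_sequentially[OF M(2) _ lim] f by blast
    have "(norm (x - m))\<^sup>2 \<le> d\<^sup>2"
    proof (rule LIMSEQ_le)
      show "(\<lambda>k. (norm (x - f k))\<^sup>2) \<longlonglongrightarrow> (norm (x - m))\<^sup>2" by (intro tendsto_intros lim)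
      have "(\<lambda>k. d\<^sup>2 + 1 / real (Suc k)) \<longlonglongrightarrow> d\<^sup>2 + 0"
        by (intro tendsto_intros LIMSEQ_Suc[OF lim_1_over_n])
      then show "(\<lambda>k. d\<^sup>2 + 1 / real (Suc k)) \<longlonglongrightarrow> d\<^sup>2" by simp
      show "\<exists>n0. \<forall>k\<ge>n0. (norm (x - f k))\<^sup>2 \<le> d\<^sup>2 + 1 / real (Suc k)"
        using f less_imp_le by blast
    qed
    then have "norm (x - m) \<le> d" using d by (rule power2_le_imp_le)
    then have "norm (x - m) \<le> norm (x - m - m')" if "m' \<in> M" for m'
      using d_le[OF complex_vector.subspace_add[OF M(1) m that]] by (simp add: algebra_simps)
    then show ?thesis using m by (auto simp: N_def)
  qed
  then have "\<exists>m\<in>M. \<exists>n\<in>N. x = m + n" for x by (metis add.commute diff_add_cancel)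
  then have "{x + y |x y. x \<in> M \<and> y \<in> N} = UNIV" by blast
  then show ?thesis unfolding has_direct_complement_def using subN clN inter by blast
qed

text \<open>The norm of \<open>'a ^ 'n\<close> is the Euclidean one, hence it is induced by the sum
  of the inner products of the components. The kernels of rows and the ranges of columns live in
  this space.\<close>

lemma hilbert_space_vec:
  assumes "hilbert_space TYPE('a::complex_banach)"
  shows "hilbert_space TYPE('a ^ 'n::finite)"
proof -
  obtain ip :: "'a \<Rightarrow> 'a \<Rightarrow> complex" where ip:
    "\<And>x y z. ip (x + y) z = ip x z + ip y z" "\<And>c x y. ip (c *\<^sub>C x) y = c * ip x y"
    "\<And>x y. ip y x = cnj (ip x y)" "\<And>x. ip x x = complex_of_real ((norm x)\<^sup>2)"
    using assms unfolding hilbert_space_def by blast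
  show ?thesis
    unfolding hilbert_space_def
  proof (intro exI[of _ "\<lambda>x y. \<Sum>i\<in>UNIV. ip (x $ i) (y $ i)"] conjI allI)
    show "(\<Sum>i\<in>UNIV. ip (y $ i) (x $ i)) = cnj (\<Sum>i\<in>UNIV. ip (x $ i) (y $ i))" for x y :: "'a ^ 'n"
      unfolding cnj_sum by (intro sum.cong refl ip(3))
    show "(\<Sum>i\<in>UNIV. ip (x $ i) (x $ i)) = complex_of_real ((norm x)\<^sup>2)" for x :: "'a ^ 'n"
      by (simp add: ip(4) norm_vec_def L2_set_def sum_nonneg)
  qed (simp_all add: ip(1,2) scaleC_vec_def sum.distrib sum_distrib_left)
qed

section \<open>Tensor products\<close>

context banach_tensor_product
begin

text \<open>The axioms are symmetric in the two factors, so every argument below is carried out for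
  one factor and transferred to the other by this interpretation.\<close>

lemma flip: "banach_tensor_product (\<lambda>y x. tv x y) (\<lambda>B A. tp A B)"
proof (rule banach_tensor_product.intro)
  show "bounded_bilinear (\<lambda>y x. tv x y)" by (rule bounded_bilinear.flip[OF tv_bilinear])
  show "\<exists>K. \<forall>A B. bounded_clinear A \<longrightarrow> bounded_clinear B \<longrightarrow> onorm (tp B A) \<le> K * (onorm A * onorm B)"
    using tp_bounded by (metis mult.commute)
  show "norm (tv y x) = norm x * norm y" for x y by (simp add: T1)
qed (simp_all add: tv_scaleC_left tv_scaleC_right tp_bounded_clinear tp_add_left tp_add_right
  tp_scaleC_left tp_scaleC_right T2 T3_comp T3_id T4_left T4_right)

lemma bounded_clinear_tv_left: "bounded_clinear (\<lambda>x. tv x y)"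
  by (rule bounded_clinearI[where K="norm y"])
     (simp_all add: bounded_bilinear.add_left[OF tv_bilinear] tv_scaleC_left T1)

lemma tv_cancel_right: "tv x y = tv x' y \<Longrightarrow> y \<noteq> 0 \<Longrightarrow> x = x'"
  using T1[of "x - x'" y] by (simp add: bounded_clinear_diff[OF bounded_clinear_tv_left])

lemma tp_zero_left: "bounded_clinear B \<Longrightarrow> tp (\<lambda>x. 0) B = (\<lambda>z. 0)"
  using tp_scaleC_left[OF bounded_clinear_const_zero, of B 0] by simp

lemma tp_zero_right: "bounded_clinear A \<Longrightarrow> tp A (\<lambda>x. 0) = (\<lambda>z. 0)"
  using tp_scaleC_right[OF _ bounded_clinear_const_zero, of A 0] by simp

lemma tp_sum_left:
  assumes "\<And>i. bounded_clinear (A i)" "bounded_clinear B"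
  shows "tp (\<lambda>x. \<Sum>i\<in>I. A i x) B = (\<lambda>z. \<Sum>i\<in>I. tp (A i) B z)"
proof (induction I rule: infinite_finite_induct)
  case (insert i I)
  then show ?case
    using tp_add_left[OF assms(1)[of i] bounded_clinear_sums[of I A, OF assms(1)] assms(2)] by simp
qed (simp_all add: tp_zero_left[OF assms(2)])

lemma tp_sum_right:
  assumes "\<And>i. bounded_clinear (B i)" "bounded_clinear A"
  shows "tp A (\<lambda>x. \<Sum>i\<in>I. B i x) = (\<lambda>z. \<Sum>i\<in>I. tp A (B i) z)"
proof (induction I rule: infinite_finite_induct)
  case (insert i I)
  then show ?case
    using tp_add_right[OF assms(2) assms(1)[of i] bounded_clinear_sums[of I B, OF assms(1)]] by simp
qed (simp_all add: tp_zero_right[OF assms(2)])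

lemma tp_comp:
  assumes "bounded_clinear A1" "bounded_clinear B1" "bounded_clinear A2" "bounded_clinear B2"
  shows "tp A1 B1 (tp A2 B2 z) = tp (\<lambda>x. A1 (A2 x)) (\<lambda>y. B1 (B2 y)) z"
  using fun_cong[OF T3_comp[OF assms], of z] by (simp add: comp_def)

lemma tp_shift_left:
  assumes A: "bounded_clinear A"
  shows "tp (\<lambda>x. A x - c *\<^sub>C x) id z = tp A id z - c *\<^sub>C z"
proof -
  have "tp (\<lambda>x. A x + (- c) *\<^sub>C id x) id z = tp A id z + (- c) *\<^sub>C tp id id z"
    by (simp only: tp_add_left[OF A bounded_clinear_cmul[OF bounded_clinear_id] bounded_clinear_id]
        tp_scaleC_left[OF bounded_clinear_id bounded_clinear_id])
  then show ?thesis by (simp add: T3_id)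
qed

lemma tensor_tuple_shift:
  assumes S: "\<And>i. bounded_clinear (S i)" and T: "\<And>j. bounded_clinear (T j)"
  shows "shift_tuple (tensor_tuple tp S T) l =
    tensor_tuple tp (shift_tuple S (\<chi> i. l $ Inl i)) (shift_tuple T (\<chi> j. l $ Inr j))"
proof (rule ext)+
  fix k z
  interpret flipped: banach_tensor_product "\<lambda>y x. tv x y" "\<lambda>B A. tp A B" by (rule flip)
  show "shift_tuple (tensor_tuple tp S T) l k z =
    tensor_tuple tp (shift_tuple S (\<chi> i. l $ Inl i)) (shift_tuple T (\<chi> j. l $ Inr j)) k z"
    by (cases k) (simp_all add: shift_tuple_def tensor_tuple_def tp_shift_left[OF S] flipped.tp_shift_left[OF T])
qed

lemma bounded_clinear_tensor_tuple:
  assumes "\<And>i. bounded_clinear (S i)" "\<And>j. bounded_clinear (T j)"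
  shows "bounded_clinear (tensor_tuple tp S T k)"
  using assms by (cases k) (simp_all add: tensor_tuple_def tp_bounded_clinear bounded_clinear_id)

section \<open>First inclusions: slices and tests with an almost annihilated factor\<close>

text \<open>By (T4) the operator I (x) f_{y,v} takes values in X_1 (x) y, and by (T1) each value
  determines its factor in X_1; \<open>Q v z\<close> is this factor. The bound on tensor products of
  operators carries a factor norm y that cancels against the one from (T1). It is uniform in
  \<open>v\<close>: the proof of the first inclusions uses that a small functional gives a small
  slice.\<close>

lemma slice_map:
  assumes y: "y \<noteq> 0"
  obtains Q :: "('b \<Rightarrow> complex) \<Rightarrow> 'c \<Rightarrow> 'a" and K where "0 \<le> K"
    "\<forall>v. bounded_clinear v \<longrightarrow> bounded_clinear (Q v)"
    "\<forall>v z. bounded_clinear v \<longrightarrow> tv (Q v z) y = tp id (rank_one_op y v) z"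
    "\<forall>v z. bounded_clinear v \<longrightarrow> norm (Q v z) \<le> K * onorm v * norm z"
proof -
  have "\<exists>x. bounded_clinear v \<longrightarrow> tv x y = tp id (rank_one_op y v) z" for v z
  proof (cases "bounded_clinear v")
    case True
    have "tp id (rank_one_op y v) z \<in> range (\<lambda>x. tv x y)"
      by (rule subsetD[OF T4_right[OF True] rangeI])
    then show ?thesis by (auto dest: sym)
  qed simp
  then have "\<exists>x. bounded_clinear (fst p) \<longrightarrow> tv x y = tp id (rank_one_op y (fst p)) (snd p)" for p
    by simp
  then obtain q where q: "\<forall>p. bounded_clinear (fst p) \<longrightarrow> tv (q p) y = tp id (rank_one_op y (fst p)) (snd p)"
    using choice[of "\<lambda>p x. bounded_clinear (fst p) \<longrightarrow> tv x y = tp id (rank_one_op y (fst p)) (snd p)"] by blast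
  define Q where "Q v z = q (v, z)" for v z
  have Q: "\<forall>v z. bounded_clinear v \<longrightarrow> tv (Q v z) y = tp id (rank_one_op y v) z"
    using q by (simp add: Q_def)
  obtain K where K: "\<forall>A B. bounded_clinear A \<longrightarrow> bounded_clinear B \<longrightarrow> onorm (tp A B) \<le> K * (onorm A * onorm B)"
    using tp_bounded by blast
  have le: "norm (Q v z) \<le> \<bar>K\<bar> * onorm v * norm z" if v: "bounded_clinear v" for v z
  proof -
    have r: "bounded_clinear (rank_one_op y v)" by (rule bounded_clinear_rank_one[OF v])
    have t: "bounded_clinear (tp id (rank_one_op y v))" by (rule tp_bounded_clinear[OF bounded_clinear_id r])
    have id0: "0 \<le> onorm (id :: 'a \<Rightarrow> 'a)"
      by (rule bounded_clinear_onorm_nonneg[OF bounded_clinear_id])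
    have "onorm (rank_one_op y v) \<le> onorm v * norm y"
    proof (rule onorm_bound)
      show "norm (rank_one_op y v x) \<le> onorm v * norm y * norm x" for x
        using mult_right_mono[OF bounded_clinear_onorm[OF v, of x] norm_ge_zero[of y]]
        by (simp add: rank_one_op_def norm_scaleC mult_ac)
    qed (simp add: bounded_clinear_onorm_nonneg[OF v])
    moreover have "onorm (id :: 'a \<Rightarrow> 'a) \<le> 1" by (rule onorm_bound) auto
    ultimately have "onorm (id :: 'a \<Rightarrow> 'a) * onorm (rank_one_op y v) \<le> 1 * (onorm v * norm y)"
      using bounded_clinear_onorm_nonneg[OF r] by (intro mult_mono) auto
    then have "\<bar>K\<bar> * (onorm (id :: 'a \<Rightarrow> 'a) * onorm (rank_one_op y v)) \<le> \<bar>K\<bar> * (1 * (onorm v * norm y))"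
      by (rule mult_left_mono) simp
    moreover have "K * (onorm (id :: 'a \<Rightarrow> 'a) * onorm (rank_one_op y v)) \<le> \<bar>K\<bar> * (onorm (id :: 'a \<Rightarrow> 'a) * onorm (rank_one_op y v))"
      using bounded_clinear_onorm_nonneg[OF r] id0 by (intro mult_right_mono) auto
    ultimately have on: "onorm (tp id (rank_one_op y v)) \<le> \<bar>K\<bar> * (onorm v * norm y)"
      using spec[OF spec[OF K, of id], of "rank_one_op y v"] bounded_clinear_id r by (simp add: bounded_clinear_id)
    have "norm (Q v z) * norm y = norm (tp id (rank_one_op y v) z)"
      using Q v T1[of "Q v z" y] by simp
    also have "\<dots> \<le> onorm (tp id (rank_one_op y v)) * norm z" by (rule bounded_clinear_onorm[OF t])
    also have "\<dots> \<le> \<bar>K\<bar> * (onorm v * norm y) * norm z" using on by (rule mult_right_mono) simp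
    finally have "norm (Q v z) * norm y \<le> (\<bar>K\<bar> * onorm v * norm z) * norm y" by (simp add: mult_ac)
    then show ?thesis using y by simp
  qed
  have "bounded_clinear (Q v)" if v: "bounded_clinear v" for v
  proof (rule bounded_clinearI)
    have t: "bounded_clinear (tp id (rank_one_op y v))"
      by (rule tp_bounded_clinear[OF bounded_clinear_id bounded_clinear_rank_one[OF v]])
    have Qv: "tv (Q v z) y = tp id (rank_one_op y v) z" for z using Q v by blast
    show "Q v (a + b) = Q v a + Q v b" for a b
      by (rule tv_cancel_right[OF _ y])
         (simp add: Qv bounded_clinear_add[OF bounded_clinear_tv_left] bounded_clinear_add[OF t])
    show "Q v (c *\<^sub>C z) = c *\<^sub>C Q v z" for c z
      by (rule tv_cancel_right[OF _ y])
         (simp add: Qv tv_scaleC_left bounded_clinear_scaleC[OF t])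
    show "norm (Q v z) \<le> norm z * (\<bar>K\<bar> * onorm v)" for z
      using le[OF v, of z] by (simp add: mult.commute)
  qed
  then show ?thesis using Q le by (intro that[of "\<bar>K\<bar>" Q]) auto
qed

text \<open>The functional \<open>u \<otimes> v\<close> on the tensor product is \<open>u \<circ> Q v\<close>, where \<open>Q v\<close> slices along \<open>v\<close>.\<close>

lemma lower_estimate_left_factor:
  fixes S :: "'n::finite \<Rightarrow> 'a \<Rightarrow> 'a" and T :: "'m::finite \<Rightarrow> 'b \<Rightarrow> 'b"
  assumes S: "\<And>i. bounded_clinear (S i)" and T: "\<And>j. bounded_clinear (T j)"
    and B: "finite B" and C: "0 \<le> C"
    and est: "\<And>w::'c \<Rightarrow> complex. bounded_clinear w \<Longrightarrow> onorm w \<le> C * ((\<Sum>i\<in>UNIV. onorm (w \<circ> tp (S i) id))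
      + (\<Sum>j\<in>UNIV. onorm (w \<circ> tp id (T j))) + (\<Sum>b\<in>B. cmod (w b)))"
    and nT: "range (row_op T) \<noteq> UNIV"
  shows "ccodimension (range (row_op S)) \<noteq> \<infinity>"
proof -
  \<comment> \<open>A row that is not onto cannot act on the zero space. Any nonzero
    \<open>y\<close> will do: it only serves to read X_1 off from X_1 (x) y.\<close>
  have "\<exists>y::'b. y \<noteq> 0"
  proof (rule ccontr)
    assume "\<not> ?thesis"
    then have all0: "y = 0" for y :: 'b by blast
    have "y = row_op T 0" for y using all0[of y] all0[of "row_op T 0"] by simp
    then show False using nT by blast
  qed
  then obtain y :: 'b where y: "y \<noteq> 0" by blast
  obtain Q K where K: "0 \<le> K" and Qc: "\<forall>v. bounded_clinear v \<longrightarrow> bounded_clinear (Q v)"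
    and Q: "\<forall>v z. bounded_clinear v \<longrightarrow> tv (Q v z) y = tp id (rank_one_op y v) z"
    and Qle: "\<forall>v z. bounded_clinear v \<longrightarrow> norm (Q v z) \<le> K * onorm v * norm z"
    by (rule slice_map[OF y])
  define m where "m = real CARD('m)"
  \<comment> \<open>Chosen so that C K m \<epsilon> \<le> 1/2: the contribution of the
    \<open>m\<close> operators of \<open>T\<close> is then at most half of the left-hand side and is
    absorbed there. The summand 1 keeps the denominator positive.\<close>
  define \<epsilon> where "\<epsilon> = 1 / (2 * (C * K * m + 1))"
  have CKm: "0 \<le> C * K * m" using C K by (simp add: m_def)
  then have \<epsilon>: "0 < \<epsilon>" by (simp add: \<epsilon>_def)
  have CK\<epsilon>: "C * K * m * \<epsilon> \<le> 1 / 2" using CKm by (simp add: \<epsilon>_def field_simps)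
  have rowS: "bounded_clinear (row_op S)" and rowT: "bounded_clinear (row_op T)"
    by (rule bounded_clinear_row_op[OF S], rule bounded_clinear_row_op[OF T])
  obtain v :: "'b \<Rightarrow> complex" where v: "bounded_clinear v" "0 < onorm v" "onorm (v \<circ> row_op T) \<le> \<epsilon> * onorm v"
    using not_surjective_imp_small[OF rowT nT \<epsilon>] by blast
  have vT: "bounded_clinear (v \<circ> T j)" for j by (rule bounded_clinear_comp[OF v(1) T])
  have vT_le: "onorm (v \<circ> T j) \<le> \<epsilon> * onorm v" for j
    using onorm_component_le_row_op[of T v j, OF T v(1)] v(3) by linarith
  have Qv: "bounded_clinear (Q v)" using Qc v(1) by blast
  \<comment> \<open>On elementary tensors the slice evaluates \<open>v\<close> in the second factor,
    so a functional \<open>u\<close> after \<open>Q v\<close> acts there as u (x) v.\<close>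
  have Q_tv: "Q v (tv x y') = v y' *\<^sub>C x" for x y'
  proof (rule tv_cancel_right[OF _ y])
    have "tv (Q v (tv x y')) y = tp id (rank_one_op y v) (tv x y')" using Q v(1) by blast
    also have "\<dots> = tv x (rank_one_op y v y')"
      by (simp add: T2[OF bounded_clinear_id bounded_clinear_rank_one[OF v(1)]])
    finally show "tv (Q v (tv x y')) y = tv (v y' *\<^sub>C x) y"
      by (simp add: rank_one_op_def tv_scaleC_left tv_scaleC_right)
  qed
  have Q_S: "Q v (tp (S i) id z) = S i (Q v z)" for i z
  proof (rule tv_cancel_right[OF _ y])
    have r: "bounded_clinear (rank_one_op y v)" by (rule bounded_clinear_rank_one[OF v(1)])
    have "tv (Q v (tp (S i) id z)) y = tp id (rank_one_op y v) (tp (S i) id z)" using Q v(1) by blast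
    also have "\<dots> = tp (S i) id (tp id (rank_one_op y v) z)"
      by (simp add: tp_comp bounded_clinear_id S r)
    also have "\<dots> = tp (S i) id (tv (Q v z) y)" using Q v(1) by simp
    also have "\<dots> = tv (S i (Q v z)) y" by (simp add: T2 S bounded_clinear_id)
    finally show "tv (Q v (tp (S i) id z)) y = tv (S i (Q v z)) y" .
  qed
  \<comment> \<open>Operators on the second factor move into the functional, f_{y,v} T_j = f_{y, v
    T_j}, whereas those on the first factor commute with the slice. Smallness of
    \<open>v \<circ> T j\<close> thus becomes smallness of the slice.\<close>
  have Q_T: "Q v (tp id (T j) z) = Q (v \<circ> T j) z" for j z
  proof (rule tv_cancel_right[OF _ y])
    have r: "bounded_clinear (rank_one_op y v)" by (rule bounded_clinear_rank_one[OF v(1)])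
    have "tv (Q v (tp id (T j) z)) y = tp id (rank_one_op y v) (tp id (T j) z)" using Q v(1) by blast
    also have "\<dots> = tp id (rank_one_op y (v \<circ> T j)) z"
    proof -
      have "(\<lambda>x::'a. id (id x)) = id" "(\<lambda>x. rank_one_op y v (T j x)) = rank_one_op y (v \<circ> T j)"
        by (simp_all add: fun_eq_iff rank_one_op_def)
      then show ?thesis by (simp only: tp_comp[OF bounded_clinear_id r bounded_clinear_id T])
    qed
    also have "\<dots> = tv (Q (v \<circ> T j) z) y" using Q vT by simp
    finally show "tv (Q v (tp id (T j) z)) y = tv (Q (v \<circ> T j) z) y" .
  qed
  define n where "n = real CARD('n)"
  \<comment> \<open>What remains after absorption and division by \<open>onorm v\<close>, with the
    coefficients of the two terms added. \<open>D\<close> depends on \<open>v\<close>, which is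
    fixed before \<open>u\<close>.\<close>
  define D where "D = 2 * C * (K * n + 1 / onorm v)"
  have D: "0 \<le> D" using C K v(2) by (simp add: D_def n_def)
  have estS: "onorm u \<le> D * (onorm (u \<circ> row_op S) + (\<Sum>b\<in>B. cmod (u (Q v b))))"
    if u: "bounded_clinear u" for u :: "'a \<Rightarrow> complex"
  proof -
    let ?w = "u \<circ> Q v"
    let ?r = "onorm (u \<circ> row_op S)"
    let ?s = "\<Sum>b\<in>B. cmod (u (Q v b))"
    have w: "bounded_clinear ?w" by (rule bounded_clinear_comp[OF u Qv])
    have uS: "bounded_clinear (u \<circ> S i)" for i by (rule bounded_clinear_comp[OF u S])
    have r0: "0 \<le> ?r" by (rule bounded_clinear_onorm_nonneg[OF bounded_clinear_comp[OF u rowS]])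
    have s0: "0 \<le> ?s" by (rule sum_nonneg) simp
    have u0: "0 \<le> onorm u" by (rule bounded_clinear_onorm_nonneg[OF u])
    \<comment> \<open>Elementary tensors alone give this lower bound, since their norms are products
      by (T1): the supremum is taken first over the second factor with \<open>x\<close> fixed, then
      over \<open>x\<close>.\<close>
    have uv: "onorm u * onorm v \<le> onorm ?w"
    proof -
      have *: "cmod (u x) * onorm v \<le> onorm ?w * norm x" for x
      proof (cases "u x = 0")
        case True
        then show ?thesis using bounded_clinear_onorm_nonneg[OF w] by simp
      next
        case False
        have "onorm v \<le> onorm ?w * norm x / cmod (u x)"
        proof (rule onorm_bound)
          show "norm (v y') \<le> onorm ?w * norm x / cmod (u x) * norm y'" for y'
            using bounded_clinear_onorm[OF w, of "tv x y'"] False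
            by (simp add: Q_tv bounded_clinear_scaleC[OF u] scaleC_complex_def norm_mult T1 field_simps)
        qed (simp add: bounded_clinear_onorm_nonneg[OF w])
        then show ?thesis using False by (simp add: pos_le_divide_eq mult.commute)
      qed
      have "onorm u \<le> onorm ?w / onorm v"
        using * v(2) bounded_clinear_onorm_nonneg[OF w]
        by (intro onorm_bound) (simp_all add: pos_le_divide_eq)
      then show ?thesis using v(2) by (simp add: pos_le_divide_eq)
    qed
    have S_le: "(\<Sum>i\<in>UNIV. onorm (?w \<circ> tp (S i) id)) \<le> n * (K * onorm v * ?r)"
    proof -
      have "onorm (?w \<circ> tp (S i) id) \<le> K * onorm v * ?r" for i
      proof (rule onorm_bound)
        show "0 \<le> K * onorm v * ?r" using K v(2) r0 by simp
        fix z
        have "norm ((?w \<circ> tp (S i) id) z) \<le> onorm (u \<circ> S i) * norm (Q v z)"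
          using bounded_clinear_onorm[OF uS, of i "Q v z"] by (simp add: Q_S)
        also have "\<dots> \<le> ?r * (K * onorm v * norm z)"
          using Qle v(1) r0 by (intro mult_mono onorm_component_le_row_op[of S u, OF S u]) auto
        finally show "norm ((?w \<circ> tp (S i) id) z) \<le> K * onorm v * ?r * norm z" by (simp add: mult_ac)
      qed
      then have "(\<Sum>i\<in>(UNIV::'n set). onorm (?w \<circ> tp (S i) id)) \<le> (\<Sum>i\<in>(UNIV::'n set). K * onorm v * ?r)" by (intro sum_mono)
      then show ?thesis by (simp add: n_def)
    qed
    have T_le: "(\<Sum>j\<in>UNIV. onorm (?w \<circ> tp id (T j))) \<le> m * (K * (\<epsilon> * onorm v) * onorm u)"
    proof -
      have "onorm (?w \<circ> tp id (T j)) \<le> K * (\<epsilon> * onorm v) * onorm u" for j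
      proof (rule onorm_bound)
        show "0 \<le> K * (\<epsilon> * onorm v) * onorm u" using K v(2) u0 \<epsilon> by simp
        fix z
        have "norm ((?w \<circ> tp id (T j)) z) \<le> onorm u * norm (Q (v \<circ> T j) z)"
          using bounded_clinear_onorm[OF u, of "Q (v \<circ> T j) z"] by (simp add: Q_T)
        also have "\<dots> \<le> onorm u * (K * onorm (v \<circ> T j) * norm z)"
          using Qle vT u0 by (intro mult_left_mono) auto
        also have "\<dots> \<le> onorm u * (K * (\<epsilon> * onorm v) * norm z)"
          using vT_le[of j] u0 K by (intro mult_left_mono mult_right_mono) auto
        finally show "norm ((?w \<circ> tp id (T j)) z) \<le> K * (\<epsilon> * onorm v) * onorm u * norm z"
          by (simp add: mult_ac)
      qed
      then have "(\<Sum>j\<in>(UNIV::'m set). onorm (?w \<circ> tp id (T j))) \<le> (\<Sum>j\<in>(UNIV::'m set). K * (\<epsilon> * onorm v) * onorm u)" by (intro sum_mono)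
      then show ?thesis by (simp add: m_def)
    qed
    have "onorm u * onorm v \<le> C * (n * (K * onorm v * ?r) + m * (K * (\<epsilon> * onorm v) * onorm u) + ?s)"
      using uv est[OF w] mult_left_mono[OF add_right_mono[OF add_mono[OF S_le T_le]] C, of ?s] by simp
    also have "\<dots> = C * n * K * ?r * onorm v + (C * K * m * \<epsilon>) * (onorm u * onorm v) + C * ?s"
      by (simp add: algebra_simps)
    also have "\<dots> \<le> C * n * K * ?r * onorm v + (1 / 2) * (onorm u * onorm v) + C * ?s"
      using CK\<epsilon> u0 v(2) by (intro add_mono mult_right_mono order_refl) auto
    finally have "onorm u * onorm v \<le> 2 * (C * n * K * ?r * onorm v + C * ?s)" by simp
    then have "onorm u \<le> 2 * (C * n * K * ?r * onorm v + C * ?s) / onorm v"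
      using v(2) by (simp add: pos_le_divide_eq)
    also have "\<dots> = 2 * C * (K * n * ?r + ?s / onorm v)" using v(2) by (simp add: field_simps)
    also have "\<dots> \<le> 2 * C * ((K * n + 1 / onorm v) * (?r + ?s))"
    proof (rule mult_left_mono)
      have "0 \<le> K * n * ?s" "0 \<le> ?r / onorm v" using K s0 r0 v(2) by (simp_all add: n_def)
      then show "K * n * ?r + ?s / onorm v \<le> (K * n + 1 / onorm v) * (?r + ?s)"
        by (simp add: algebra_simps)
    qed (use C in simp)
    finally show ?thesis by (simp add: D_def mult.assoc)
  qed
  \<comment> \<open>The exceptional vectors for \<open>S\<close> are the slices of those for the
    tensor tuple, because the functional \<open>u\<close> after \<open>Q v\<close> takes at
    \<open>b\<close> the value of \<open>u\<close> at \<open>Q v b\<close>.\<close>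
  have "complex_vector.span (range (row_op S) \<union> (\<lambda>b. Q v b) ` B) = UNIV"
    by (rule estimate_imp_lower_semi_Fredholm[OF rowS B D estS])
  then show ?thesis
    using B by (intro ccodimension_finiteI[OF subspace_image[OF rowS complex_vector.subspace_UNIV]]) auto
qed

text \<open>No slices are needed on this side: the estimate is evaluated at x (x) y with
  \<open>y\<close> nearly annihilated by \<open>T\<close>, and the exceptional functionals become
  functionals of \<open>x\<close> by fixing \<open>y\<close>. The choice of \<epsilon> again lets
  half of the left-hand side absorb the terms of \<open>T\<close>.\<close>

lemma upper_estimate_left_factor:
  fixes S :: "'n::finite \<Rightarrow> 'a \<Rightarrow> 'a" and T :: "'m::finite \<Rightarrow> 'b \<Rightarrow> 'b" and \<phi> :: "'c \<Rightarrow> 'c \<Rightarrow> complex"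
  assumes S: "\<And>i. bounded_clinear (S i)" and T: "\<And>j. bounded_clinear (T j)"
    and B: "finite B" and C: "0 \<le> C" and \<phi>: "\<And>b. bounded_clinear (\<phi> b)"
    and est: "\<And>z. norm z \<le> C * ((\<Sum>i\<in>UNIV. norm (tp (S i) id z))
      + (\<Sum>j\<in>UNIV. norm (tp id (T j) z)) + (\<Sum>b\<in>B. cmod (\<phi> b z)))"
    and nT: "null_space (col_op T) \<noteq> {0} \<or> \<not> closed (range (col_op T))"
  shows "cdimension (null_space (col_op S)) \<noteq> \<infinity> \<and> closed (range (col_op S))"
proof -
  define m where "m = real CARD('m)"
  define n where "n = real CARD('n)"
  define \<epsilon> where "\<epsilon> = 1 / (2 * (C * m + 1))"
  have Cm: "0 \<le> C * m" using C by (simp add: m_def)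
  then have \<epsilon>: "0 < \<epsilon>" by (simp add: \<epsilon>_def)
  have C\<epsilon>: "C * m * \<epsilon> \<le> 1 / 2" using Cm by (simp add: \<epsilon>_def field_simps)
  have colS: "bounded_clinear (col_op S)" and colT: "bounded_clinear (col_op T)"
    by (rule bounded_clinear_col_op[OF S], rule bounded_clinear_col_op[OF T])
  obtain y where y: "y \<noteq> 0" "norm (col_op T y) \<le> \<epsilon> * norm y"
    using not_bounded_below_imp_small[OF colT nT \<epsilon>] by blast
  define D where "D = 2 * C * (n + 1 / norm y)"
  have est': "norm x \<le> D * (norm (col_op S x) + (\<Sum>b\<in>B. cmod (\<phi> b (tv x y))))" for x
  proof -
    let ?r = "norm (col_op S x)"
    let ?s = "\<Sum>b\<in>B. cmod (\<phi> b (tv x y))"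
    have s0: "0 \<le> ?s" by (rule sum_nonneg) simp
    have "(\<Sum>i\<in>UNIV. norm (tp (S i) id (tv x y))) \<le> (\<Sum>i\<in>(UNIV::'n set). ?r * norm y)"
      by (intro sum_mono)
         (simp add: T2 S bounded_clinear_id T1 mult_right_mono norm_component_le_col_op)
    then have S_le: "(\<Sum>i\<in>UNIV. norm (tp (S i) id (tv x y))) \<le> n * (?r * norm y)"
      by (simp add: n_def)
    have "(\<Sum>j\<in>UNIV. norm (tp id (T j) (tv x y))) \<le> (\<Sum>j\<in>(UNIV::'m set). norm x * (\<epsilon> * norm y))"
    proof (rule sum_mono)
      fix j
      have "norm (T j y) \<le> \<epsilon> * norm y" using norm_component_le_col_op[of T j y] y(2) by linarith
      then show "norm (tp id (T j) (tv x y)) \<le> norm x * (\<epsilon> * norm y)"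
        by (simp add: T2 T bounded_clinear_id T1 mult_left_mono)
    qed
    then have T_le: "(\<Sum>j\<in>UNIV. norm (tp id (T j) (tv x y))) \<le> m * (norm x * (\<epsilon> * norm y))"
      by (simp add: m_def)
    have "norm x * norm y \<le> C * (n * (?r * norm y) + m * (norm x * (\<epsilon> * norm y)) + ?s)"
      using est[of "tv x y"] mult_left_mono[OF add_right_mono[OF add_mono[OF S_le T_le]] C, of ?s]
      by (simp add: T1)
    also have "\<dots> = C * n * ?r * norm y + (C * m * \<epsilon>) * (norm x * norm y) + C * ?s"
      by (simp add: algebra_simps)
    also have "\<dots> \<le> C * n * ?r * norm y + (1 / 2) * (norm x * norm y) + C * ?s"
      using C\<epsilon> by (intro add_mono mult_right_mono order_refl) auto
    finally have "norm x * norm y \<le> 2 * (C * n * ?r * norm y + C * ?s)" by simp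
    then have "norm x \<le> 2 * (C * n * ?r * norm y + C * ?s) / norm y"
      using y(1) by (simp add: pos_le_divide_eq)
    also have "\<dots> = 2 * C * (n * ?r + ?s / norm y)" using y(1) by (simp add: field_simps)
    also have "\<dots> \<le> 2 * C * ((n + 1 / norm y) * (?r + ?s))"
    proof (rule mult_left_mono)
      have "0 \<le> n * ?s" "0 \<le> ?r / norm y" using s0 by (simp_all add: n_def)
      then show "n * ?r + ?s / norm y \<le> (n + 1 / norm y) * (?r + ?s)"
        by (simp add: algebra_simps)
    qed (use C in simp)
    finally show ?thesis by (simp add: D_def mult.assoc)
  qed
  have \<phi>': "bounded_clinear (\<lambda>x. \<phi> b (tv x y))" for b
    by (rule bounded_clinear_compose[OF \<phi> bounded_clinear_tv_left])
  show ?thesis using estimate_imp_upper_semi_Fredholm[OF colS B \<phi>' est'] by blast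
qed

text \<open>The norm of the whole row is first replaced by separate sums over the operators of
  \<open>S\<close> and of \<open>T\<close>. In this shape exchanging the factors only reorders
  summands, so both claims come from the same lemma.\<close>

lemma lower_semi_Fredholm_factors:
  fixes S :: "'n::finite \<Rightarrow> 'a \<Rightarrow> 'a" and T :: "'m::finite \<Rightarrow> 'b \<Rightarrow> 'b"
  assumes S: "\<And>i. bounded_clinear (S i)" and T: "\<And>j. bounded_clinear (T j)"
    and fin: "ccodimension (range (row_op (tensor_tuple tp S T))) \<noteq> \<infinity>"
  shows "range (row_op T) \<noteq> UNIV \<Longrightarrow> ccodimension (range (row_op S)) \<noteq> \<infinity>"
    and "range (row_op S) \<noteq> UNIV \<Longrightarrow> ccodimension (range (row_op T)) \<noteq> \<infinity>"
proof -
  let ?U = "tensor_tuple tp S T"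
  have U: "bounded_clinear (?U k)" for k by (rule bounded_clinear_tensor_tuple[OF S T])
  obtain B :: "'c set" and C where B: "finite B" "0 \<le> C"
    and est: "\<forall>w::'c \<Rightarrow> complex. bounded_clinear w \<longrightarrow>
       onorm w \<le> C * (onorm (w \<circ> row_op ?U) + (\<Sum>b\<in>B. cmod (w b)))"
    by (rule lower_semi_Fredholm_imp_estimate[OF bounded_clinear_row_op[OF U] fin])
  have est1: "onorm w \<le> C * ((\<Sum>i\<in>UNIV. onorm (w \<circ> tp (S i) id))
      + (\<Sum>j\<in>UNIV. onorm (w \<circ> tp id (T j))) + (\<Sum>b\<in>B. cmod (w b)))"
    if w: "bounded_clinear w" for w :: "'c \<Rightarrow> complex"
  proof -
    have "onorm (w \<circ> row_op ?U) \<le> (\<Sum>k\<in>UNIV. onorm (w \<circ> ?U k))"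
      by (rule onorm_row_op_le[of ?U w, OF U w])
    also have "\<dots> = (\<Sum>i\<in>UNIV. onorm (w \<circ> tp (S i) id)) + (\<Sum>j\<in>UNIV. onorm (w \<circ> tp id (T j)))"
      by (simp add: sum_UNIV_Plus tensor_tuple_def)
    finally have "C * (onorm (w \<circ> row_op ?U) + (\<Sum>b\<in>B. cmod (w b))) \<le> C * ((\<Sum>i\<in>UNIV. onorm (w \<circ> tp (S i) id))
      + (\<Sum>j\<in>UNIV. onorm (w \<circ> tp id (T j))) + (\<Sum>b\<in>B. cmod (w b)))"
      using B(2) by (intro mult_left_mono) auto
    then show ?thesis using est w by (meson order_trans)
  qed
  show "range (row_op T) \<noteq> UNIV \<Longrightarrow> ccodimension (range (row_op S)) \<noteq> \<infinity>"
    by (rule lower_estimate_left_factor[OF S T B est1])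
  interpret flipped: banach_tensor_product "\<lambda>y x. tv x y" "\<lambda>B A. tp A B" by (rule flip)
  have est2: "onorm w \<le> C * ((\<Sum>j\<in>UNIV. onorm (w \<circ> tp id (T j)))
      + (\<Sum>i\<in>UNIV. onorm (w \<circ> tp (S i) id)) + (\<Sum>b\<in>B. cmod (w b)))"
    if w: "bounded_clinear w" for w :: "'c \<Rightarrow> complex"
    using est1[OF w] by (simp only: add.commute)
  show "range (row_op S) \<noteq> UNIV \<Longrightarrow> ccodimension (range (row_op T)) \<noteq> \<infinity>"
    by (rule flipped.lower_estimate_left_factor[OF T S B est2])
qed

lemma upper_semi_Fredholm_factors:
  fixes S :: "'n::finite \<Rightarrow> 'a \<Rightarrow> 'a" and T :: "'m::finite \<Rightarrow> 'b \<Rightarrow> 'b"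
  assumes S: "\<And>i. bounded_clinear (S i)" and T: "\<And>j. bounded_clinear (T j)"
    and fin: "cdimension (null_space (col_op (tensor_tuple tp S T))) \<noteq> \<infinity>"
    and cl: "closed (range (col_op (tensor_tuple tp S T)))"
  shows "null_space (col_op T) \<noteq> {0} \<or> \<not> closed (range (col_op T)) \<Longrightarrow>
      cdimension (null_space (col_op S)) \<noteq> \<infinity> \<and> closed (range (col_op S))"
    and "null_space (col_op S) \<noteq> {0} \<or> \<not> closed (range (col_op S)) \<Longrightarrow>
      cdimension (null_space (col_op T)) \<noteq> \<infinity> \<and> closed (range (col_op T))"
proof -
  let ?U = "tensor_tuple tp S T"
  have U: "bounded_clinear (?U k)" for k by (rule bounded_clinear_tensor_tuple[OF S T])
  obtain B :: "'c set" and \<phi> :: "'c \<Rightarrow> 'c \<Rightarrow> complex" and C where B: "finite B" "0 \<le> C"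
    and \<phi>: "\<forall>b. bounded_clinear (\<phi> b)"
    and est: "\<forall>z. norm z \<le> C * (norm (col_op ?U z) + (\<Sum>b\<in>B. cmod (\<phi> b z)))"
    by (rule upper_semi_Fredholm_imp_estimate[OF bounded_clinear_col_op[OF U] fin cl])
  have est1: "norm z \<le> C * ((\<Sum>i\<in>UNIV. norm (tp (S i) id z))
      + (\<Sum>j\<in>UNIV. norm (tp id (T j) z)) + (\<Sum>b\<in>B. cmod (\<phi> b z)))" for z
  proof -
    have "norm (col_op ?U z) \<le> (\<Sum>k\<in>UNIV. norm (?U k z))" by (rule norm_col_op_le)
    also have "\<dots> = (\<Sum>i\<in>UNIV. norm (tp (S i) id z)) + (\<Sum>j\<in>UNIV. norm (tp id (T j) z))"
      by (simp add: sum_UNIV_Plus tensor_tuple_def)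
    finally have "C * (norm (col_op ?U z) + (\<Sum>b\<in>B. cmod (\<phi> b z))) \<le> C * ((\<Sum>i\<in>UNIV. norm (tp (S i) id z))
      + (\<Sum>j\<in>UNIV. norm (tp id (T j) z)) + (\<Sum>b\<in>B. cmod (\<phi> b z)))"
      using B(2) by (intro mult_left_mono) auto
    then show ?thesis using est by (meson order_trans)
  qed
  show "null_space (col_op T) \<noteq> {0} \<or> \<not> closed (range (col_op T)) \<Longrightarrow>
      cdimension (null_space (col_op S)) \<noteq> \<infinity> \<and> closed (range (col_op S))"
    by (rule upper_estimate_left_factor[OF S T B spec[OF \<phi>] est1])
  interpret flipped: banach_tensor_product "\<lambda>y x. tv x y" "\<lambda>B A. tp A B" by (rule flip)
  have est2: "norm z \<le> C * ((\<Sum>j\<in>UNIV. norm (tp id (T j) z))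
      + (\<Sum>i\<in>UNIV. norm (tp (S i) id z)) + (\<Sum>b\<in>B. cmod (\<phi> b z)))" for z
    using est1[of z] by (simp only: add.commute)
  show "null_space (col_op S) \<noteq> {0} \<or> \<not> closed (range (col_op S)) \<Longrightarrow>
      cdimension (null_space (col_op T)) \<noteq> \<infinity> \<and> closed (range (col_op T))"
    by (rule flipped.upper_estimate_left_factor[OF T S B spec[OF \<phi>] est2])
qed

section \<open>Last inclusions: parametrices of the tensor tuple\<close>

text \<open>For rank-one operators write f_{b,u} (x) f_{c,v} as (f_{b,u} (x) I)(I (x) f_{c,v}). By
  (T4) the inner operator sends any \<open>z\<close> to some x (x) c, and the outer one sends that
  to u(x) b (x) c. So the finitely many b (x) c span the range, including the values at
  \<open>z\<close> that are not built from elementary tensors.\<close>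

lemma finite_rank_tp:
  assumes P: "bounded_clinear P" "finite_rank P" and Q: "bounded_clinear Q" "finite_rank Q"
  shows "finite_rank (tp P Q)"
proof -
  obtain B and u :: "'a \<Rightarrow> 'a \<Rightarrow> complex" where B: "finite B" "B \<subseteq> range P"
    "\<forall>b. bounded_clinear (u b)" "P = (\<lambda>x. \<Sum>b\<in>B. u b x *\<^sub>C b)"
    by (rule finite_rank_representation[OF P])
  obtain B' and v :: "'b \<Rightarrow> 'b \<Rightarrow> complex" where B': "finite B'" "B' \<subseteq> range Q"
    "\<forall>b. bounded_clinear (v b)" "Q = (\<lambda>x. \<Sum>b\<in>B'. v b x *\<^sub>C b)"
    by (rule finite_rank_representation[OF Q])
  have u: "bounded_clinear (rank_one_op b (u b))" and v: "bounded_clinear (rank_one_op c (v c))" for b c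
    using B(3) B'(3) by (simp_all add: bounded_clinear_rank_one)
  have P_eq: "P = (\<lambda>x. \<Sum>b\<in>B. rank_one_op b (u b) x)" and Q_eq: "Q = (\<lambda>x. \<Sum>c\<in>B'. rank_one_op c (v c) x)"
    by (simp_all only: B(4) B'(4) rank_one_op_def)
  have tp_eq: "tp P Q z = (\<Sum>b\<in>B. \<Sum>c\<in>B'. tp (rank_one_op b (u b)) (rank_one_op c (v c)) z)" for z
  proof -
    have "tp P Q z = (\<Sum>b\<in>B. tp (rank_one_op b (u b)) Q z)"
      unfolding P_eq by (simp only: tp_sum_left[OF u Q(1)])
    also have "\<dots> = (\<Sum>b\<in>B. \<Sum>c\<in>B'. tp (rank_one_op b (u b)) (rank_one_op c (v c)) z)"
      unfolding Q_eq by (simp only: tp_sum_right[OF v u])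
    finally show ?thesis .
  qed
  let ?D = "(\<lambda>(b, c). tv b c) ` (B \<times> B')"
  have "tp (rank_one_op b (u b)) (rank_one_op c (v c)) z \<in> complex_vector.span ?D"
    if "b \<in> B" "c \<in> B'" for b c z
  proof -
    obtain x where x: "tp id (rank_one_op c (v c)) z = tv x c"
      using T4_right[OF spec[OF B'(3)], of c c] by blast
    have "tp (rank_one_op b (u b)) id (tp id (rank_one_op c (v c)) z) =
        tp (\<lambda>x. rank_one_op b (u b) (id x)) (\<lambda>y. id (rank_one_op c (v c) y)) z"
      by (rule tp_comp[OF u bounded_clinear_id bounded_clinear_id v])
    then have "tp (rank_one_op b (u b)) (rank_one_op c (v c)) z = tp (rank_one_op b (u b)) id (tv x c)"
      by (simp add: x)
    also have "\<dots> = u b x *\<^sub>C tv b c"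
      by (simp add: T2[OF u bounded_clinear_id]) (simp add: rank_one_op_def tv_scaleC_left)
    finally have eq: "tp (rank_one_op b (u b)) (rank_one_op c (v c)) z = u b x *\<^sub>C tv b c" .
    have "tv b c \<in> ?D" using that by (intro image_eqI[of _ _ "(b, c)"]) auto
    then show ?thesis
      unfolding eq by (intro complex_vector.span_scale complex_vector.span_base)
  qed
  then have "tp P Q z \<in> complex_vector.span ?D" for z
    unfolding tp_eq by (intro complex_vector.span_sum)
  then show ?thesis using B(1) B'(1) by (intro finite_rankI[of ?D]) auto
qed

text \<open>\<open>A \<otimes> 1 + P \<otimes> C = (1 - P) \<otimes> 1 + P \<otimes> (1 - Q) = 1 - P \<otimes> Q\<close> for \<open>A = 1 - P\<close>, \<open>C = 1 - Q\<close>.\<close>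

lemma tensor_parametrix:
  fixes A :: "'n::finite \<Rightarrow> 'a \<Rightarrow> 'a" and C :: "'m::finite \<Rightarrow> 'b \<Rightarrow> 'b"
  assumes A: "\<And>i. bounded_clinear (A i)" and C: "\<And>j. bounded_clinear (C j)"
    and P: "bounded_clinear P" and Q: "bounded_clinear Q"
    and AP: "\<And>x. (\<Sum>i\<in>UNIV. A i x) + P x = x" and CQ: "\<And>y. (\<Sum>j\<in>UNIV. C j y) + Q y = y"
  shows "(\<Sum>i\<in>UNIV. tp (A i) id z) + (\<Sum>j\<in>UNIV. tp P (C j) z) + tp P Q z = z"
proof -
  have "(\<lambda>x. (\<Sum>i\<in>UNIV. A i x) + P x) = id" using AP by (simp add: fun_eq_iff)
  then have "z = tp (\<lambda>x. (\<Sum>i\<in>UNIV. A i x) + P x) id z" by (simp add: T3_id)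
  also have "\<dots> = (\<Sum>i\<in>UNIV. tp (A i) id z) + tp P id z"
    by (simp only: tp_add_left[OF bounded_clinear_sums[OF A] P bounded_clinear_id] tp_sum_left[OF A bounded_clinear_id])
  finally have z: "z = (\<Sum>i\<in>UNIV. tp (A i) id z) + tp P id z" .
  have "(\<lambda>y. (\<Sum>j\<in>UNIV. C j y) + Q y) = id" using CQ by (simp add: fun_eq_iff)
  then have "tp P id z = tp P (\<lambda>y. (\<Sum>j\<in>UNIV. C j y) + Q y) z" by simp
  also have "\<dots> = (\<Sum>j\<in>UNIV. tp P (C j) z) + tp P Q z"
    by (simp only: tp_add_right[OF P bounded_clinear_sums[OF C] Q] tp_sum_right[OF C P])
  finally show ?thesis using z by (simp add: add.assoc)
qed

text \<open>The column with entries W_i (x) I and P (x) W'_j is a right inverse of the tensor row up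
  to P (x) Q. Finite rank is asked of P (x) Q and not of \<open>P\<close> and \<open>Q\<close>
  separately, which admits the trivial parametrix with remainder \<open>id\<close> for one of the
  tuples.\<close>

lemma lower_split_tensor:
  fixes S :: "'n::finite \<Rightarrow> 'a \<Rightarrow> 'a" and T :: "'m::finite \<Rightarrow> 'b \<Rightarrow> 'b"
  assumes S: "\<And>i. bounded_clinear (S i)" and T: "\<And>j. bounded_clinear (T j)"
    and W: "bounded_clinear W" "bounded_clinear P" "\<forall>x. row_op S (W x) + P x = x"
    and W': "bounded_clinear W'" "bounded_clinear Q" "\<forall>y. row_op T (W' y) + Q y = y"
    and fin: "finite_rank (tp P Q)"
  shows "lower_split_Fredholm (row_op (tensor_tuple tp S T))"
proof -
  let ?U = "tensor_tuple tp S T"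
  have Wi: "bounded_clinear (\<lambda>x. W x $ i)" for i
    by (rule bounded_clinear_compose[OF bounded_clinear_vec_nth W(1)])
  have W'j: "bounded_clinear (\<lambda>y. W' y $ j)" for j
    by (rule bounded_clinear_compose[OF bounded_clinear_vec_nth W'(1)])
  define V where "V z = (\<chi> k. (case k of Inl i \<Rightarrow> tp (\<lambda>x. W x $ i) id | Inr j \<Rightarrow> tp P (\<lambda>y. W' y $ j)) z)" for z
  have V: "bounded_clinear V"
    unfolding V_def
  proof (rule bounded_clinear_vec_lambda)
    show "bounded_clinear (case k of Inl i \<Rightarrow> tp (\<lambda>x. W x $ i) id | Inr j \<Rightarrow> tp P (\<lambda>y. W' y $ j))" for k
      by (cases k) (simp_all add: tp_bounded_clinear Wi W'j W(2) bounded_clinear_id)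
  qed
  have "row_op ?U (V z) + tp P Q z = z" for z
  proof -
    have left: "tp (S i) id (tp (\<lambda>x. W x $ i) id z) = tp (\<lambda>x. S i (W x $ i)) id z" for i
    proof -
      have "(\<lambda>y::'b. id (id y)) = id" by (simp add: fun_eq_iff)
      then show ?thesis by (simp only: tp_comp[OF S bounded_clinear_id Wi bounded_clinear_id])
    qed
    have right: "tp id (T j) (tp P (\<lambda>y. W' y $ j) z) = tp P (\<lambda>y. T j (W' y $ j)) z" for j
    proof -
      have "(\<lambda>x. id (P x)) = P" by (simp add: fun_eq_iff)
      then show ?thesis by (simp only: tp_comp[OF bounded_clinear_id T W(2) W'j])
    qed
    have "row_op ?U (V z) = (\<Sum>i\<in>UNIV. tp (\<lambda>x. S i (W x $ i)) id z) + (\<Sum>j\<in>UNIV. tp P (\<lambda>y. T j (W' y $ j)) z)"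
      by (simp add: row_op_def sum_UNIV_Plus tensor_tuple_def V_def left right)
    moreover have "(\<Sum>i\<in>UNIV. tp (\<lambda>x. S i (W x $ i)) id z) + (\<Sum>j\<in>UNIV. tp P (\<lambda>y. T j (W' y $ j)) z) + tp P Q z = z"
    proof (rule tensor_parametrix[OF _ _ W(2) W'(2)])
      show "bounded_clinear (\<lambda>x. S i (W x $ i))" for i by (rule bounded_clinear_compose[OF S Wi])
      show "bounded_clinear (\<lambda>y. T j (W' y $ j))" for j by (rule bounded_clinear_compose[OF T W'j])
    qed (use W(3) W'(3) in \<open>simp_all add: row_op_def\<close>)
    ultimately show ?thesis by simp
  qed
  then show ?thesis
    by (rule lower_parametrix_imp_split[OF bounded_clinear_row_op[OF bounded_clinear_tensor_tuple[OF S T]] V fin])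
qed

text \<open>The transposed construction: the row with entries W_i (x) I and P (x) W'_j is a left
  inverse of the tensor column up to P (x) Q, where W_i is \<open>W\<close> on the i-th coordinate
  axis.\<close>

lemma upper_split_tensor:
  fixes S :: "'n::finite \<Rightarrow> 'a \<Rightarrow> 'a" and T :: "'m::finite \<Rightarrow> 'b \<Rightarrow> 'b"
  assumes S: "\<And>i. bounded_clinear (S i)" and T: "\<And>j. bounded_clinear (T j)"
    and W: "bounded_clinear W" "bounded_clinear P" "\<forall>x. W (col_op S x) + P x = x"
    and W': "bounded_clinear W'" "bounded_clinear Q" "\<forall>y. W' (col_op T y) + Q y = y"
    and fin: "finite_rank (tp P Q)"
  shows "upper_split_Fredholm (col_op (tensor_tuple tp S T))"
proof -
  let ?U = "tensor_tuple tp S T"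
  have Wi: "bounded_clinear (\<lambda>x. W (axis i x))" for i
    by (rule bounded_clinear_compose[OF W(1) bounded_clinear_axis])
  have W'j: "bounded_clinear (\<lambda>y. W' (axis j y))" for j
    by (rule bounded_clinear_compose[OF W'(1) bounded_clinear_axis])
  define V where "V z = (\<Sum>k\<in>UNIV. (case k of Inl i \<Rightarrow> tp (\<lambda>x. W (axis i x)) id | Inr j \<Rightarrow> tp P (\<lambda>y. W' (axis j y))) (z $ k))" for z
  have V: "bounded_clinear V"
    unfolding V_def
  proof (rule bounded_clinear_sums)
    show "bounded_clinear (\<lambda>z. (case k of Inl i \<Rightarrow> tp (\<lambda>x. W (axis i x)) id | Inr j \<Rightarrow> tp P (\<lambda>y. W' (axis j y))) (z $ k))" for k :: "'n + 'm"
      by (rule bounded_clinear_compose[OF _ bounded_clinear_vec_nth], cases k)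
         (simp_all add: tp_bounded_clinear Wi W'j W(2) bounded_clinear_id)
  qed
  have colS: "W (col_op S x) = (\<Sum>i\<in>UNIV. W (axis i (S i x)))" for x
    by (subst vec_eq_sum_axis) (simp add: bounded_clinear_sum[OF W(1)] col_op_def)
  have colT: "W' (col_op T y) = (\<Sum>j\<in>UNIV. W' (axis j (T j y)))" for y
    by (subst vec_eq_sum_axis) (simp add: bounded_clinear_sum[OF W'(1)] col_op_def)
  have "V (col_op ?U z) + tp P Q z = z" for z
  proof -
    have left: "tp (\<lambda>x. W (axis i x)) id (tp (S i) id z) = tp (\<lambda>x. W (axis i (S i x))) id z" for i
    proof -
      have "(\<lambda>y::'b. id (id y)) = id" by (simp add: fun_eq_iff)
      then show ?thesis by (simp only: tp_comp[OF Wi bounded_clinear_id S bounded_clinear_id])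
    qed
    have right: "tp P (\<lambda>y. W' (axis j y)) (tp id (T j) z) = tp P (\<lambda>y. W' (axis j (T j y))) z" for j
    proof -
      have "(\<lambda>x. P (id x)) = P" by (simp add: fun_eq_iff)
      then show ?thesis by (simp only: tp_comp[OF W(2) W'j bounded_clinear_id T])
    qed
    have "V (col_op ?U z) = (\<Sum>i\<in>UNIV. tp (\<lambda>x. W (axis i (S i x))) id z) + (\<Sum>j\<in>UNIV. tp P (\<lambda>y. W' (axis j (T j y))) z)"
      by (simp add: col_op_def sum_UNIV_Plus tensor_tuple_def V_def left right)
    moreover have "(\<Sum>i\<in>UNIV. tp (\<lambda>x. W (axis i (S i x))) id z) + (\<Sum>j\<in>UNIV. tp P (\<lambda>y. W' (axis j (T j y))) z) + tp P Q z = z"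
    proof (rule tensor_parametrix[OF _ _ W(2) W'(2)])
      show "bounded_clinear (\<lambda>x. W (axis i (S i x)))" for i by (rule bounded_clinear_compose[OF Wi S])
      show "bounded_clinear (\<lambda>y. W' (axis j (T j y)))" for j by (rule bounded_clinear_compose[OF W'j T])
    qed (use W(3) W'(3) colS colT in simp_all)
    ultimately show ?thesis by simp
  qed
  then show ?thesis
    by (rule upper_parametrix_imp_split[OF bounded_clinear_col_op[OF bounded_clinear_tensor_tuple[OF S T]] V fin])
qed

text \<open>The three cases are what lies outside sp_{\<delta>e}(S) x sp_\<delta>(T) and
  sp_\<delta>(S) x sp_{\<delta>e}(T): negating the union and distributing leaves exactly these,
  because avoiding sp_\<delta> implies avoiding sp_{\<delta>e}.\<close>

lemma lower_split_Fredholm_tensor: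
  fixes S :: "'n::finite \<Rightarrow> 'a \<Rightarrow> 'a" and T :: "'m::finite \<Rightarrow> 'b \<Rightarrow> 'b"
  assumes S: "\<And>i. bounded_clinear (S i)" and T: "\<And>j. bounded_clinear (T j)"
    and split: "lower_split_Fredholm (row_op S) \<and> range (row_op S) = UNIV \<or>
      lower_split_Fredholm (row_op T) \<and> range (row_op T) = UNIV \<or>
      lower_split_Fredholm (row_op S) \<and> lower_split_Fredholm (row_op T)"
  shows "lower_split_Fredholm (row_op (tensor_tuple tp S T))"
proof -
  have rowS: "bounded_clinear (row_op S)" and rowT: "bounded_clinear (row_op T)"
    by (rule bounded_clinear_row_op[OF S], rule bounded_clinear_row_op[OF T])
  \<comment> \<open>The zero operator is a parametrix of any tuple, with remainder
    \<open>id\<close>. It is used for the tuple about which the case at hand says nothing.\<close>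
  have idS: "\<forall>x. row_op S ((\<lambda>_. 0) x) + id x = x" and idT: "\<forall>y. row_op T ((\<lambda>_. 0) y) + id y = y"
    by (simp_all add: bounded_clinear_zero[OF rowS] bounded_clinear_zero[OF rowT])
  note triv = bounded_clinear_const_zero bounded_clinear_id
  consider (S) "lower_split_Fredholm (row_op S)" "range (row_op S) = UNIV"
    | (T) "lower_split_Fredholm (row_op T)" "range (row_op T) = UNIV"
    | (ST) "lower_split_Fredholm (row_op S)" "lower_split_Fredholm (row_op T)"
    using split by blast
  then show ?thesis
  proof cases
    case S
    obtain W P where W: "bounded_clinear W" "bounded_clinear P" "finite_rank P"
      "\<forall>x. row_op S (W x) + P x = x" "range (row_op S) = UNIV \<longrightarrow> P = (\<lambda>x. 0)"
      by (rule lower_parametrix[OF rowS S(1)])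
    have "finite_rank (tp P id)"
      using W(5) S(2) by (simp add: tp_zero_left[OF bounded_clinear_id] finite_rank_zero)
    then show ?thesis
      by (rule lower_split_tensor[OF assms(1) assms(2) W(1,2,4) triv idT])
  next
    case T
    obtain W P where W: "bounded_clinear W" "bounded_clinear P" "finite_rank P"
      "\<forall>x. row_op T (W x) + P x = x" "range (row_op T) = UNIV \<longrightarrow> P = (\<lambda>x. 0)"
      by (rule lower_parametrix[OF rowT T(1)])
    have "finite_rank (tp id P)"
      using W(5) T(2) by (simp add: tp_zero_right[OF bounded_clinear_id] finite_rank_zero)
    then show ?thesis
      by (rule lower_split_tensor[OF assms(1) assms(2) triv idS W(1,2,4)])
  next
    case ST
    obtain W P where W: "bounded_clinear W" "bounded_clinear P" "finite_rank P"
      "\<forall>x. row_op S (W x) + P x = x" "range (row_op S) = UNIV \<longrightarrow> P = (\<lambda>x. 0)"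
      by (rule lower_parametrix[OF rowS ST(1)])
    obtain W' Q where W': "bounded_clinear W'" "bounded_clinear Q" "finite_rank Q"
      "\<forall>x. row_op T (W' x) + Q x = x" "range (row_op T) = UNIV \<longrightarrow> Q = (\<lambda>x. 0)"
      by (rule lower_parametrix[OF rowT ST(2)])
    show ?thesis
      by (rule lower_split_tensor[OF S T W(1,2,4) W'(1,2,4) finite_rank_tp[OF W(2,3) W'(2,3)]])
  qed
qed

text \<open>The case distinction is the one for rows, with a trivial kernel in place of
  surjectivity: it makes the finite-rank remainder of that column vanish, and with it the whole of P
  (x) Q.\<close>

lemma upper_split_Fredholm_tensor:
  fixes S :: "'n::finite \<Rightarrow> 'a \<Rightarrow> 'a" and T :: "'m::finite \<Rightarrow> 'b \<Rightarrow> 'b"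
  assumes S: "\<And>i. bounded_clinear (S i)" and T: "\<And>j. bounded_clinear (T j)"
    and split: "upper_split_Fredholm (col_op S) \<and> null_space (col_op S) = {0} \<or>
      upper_split_Fredholm (col_op T) \<and> null_space (col_op T) = {0} \<or>
      upper_split_Fredholm (col_op S) \<and> upper_split_Fredholm (col_op T)"
  shows "upper_split_Fredholm (col_op (tensor_tuple tp S T))"
proof -
  have colS: "bounded_clinear (col_op S)" and colT: "bounded_clinear (col_op T)"
    by (rule bounded_clinear_col_op[OF S], rule bounded_clinear_col_op[OF T])
  have idS: "\<forall>x. (\<lambda>_. 0) (col_op S x) + id x = x" and idT: "\<forall>y. (\<lambda>_. 0) (col_op T y) + id y = y"
    by simp_all
  note triv = bounded_clinear_const_zero bounded_clinear_id
  consider (S) "upper_split_Fredholm (col_op S)" "null_space (col_op S) = {0}"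
    | (T) "upper_split_Fredholm (col_op T)" "null_space (col_op T) = {0}"
    | (ST) "upper_split_Fredholm (col_op S)" "upper_split_Fredholm (col_op T)"
    using split by blast
  then show ?thesis
  proof cases
    case S
    obtain W P where W: "bounded_clinear W" "bounded_clinear P" "finite_rank P"
      "\<forall>x. W (col_op S x) + P x = x" "null_space (col_op S) = {0} \<longrightarrow> P = (\<lambda>x. 0)"
      by (rule upper_parametrix[OF colS S(1)])
    have "finite_rank (tp P id)"
      using W(5) S(2) by (simp add: tp_zero_left[OF bounded_clinear_id] finite_rank_zero)
    then show ?thesis
      by (rule upper_split_tensor[OF assms(1) assms(2) W(1,2,4) triv idT])
  next
    case T
    obtain W P where W: "bounded_clinear W" "bounded_clinear P" "finite_rank P"
      "\<forall>x. W (col_op T x) + P x = x" "null_space (col_op T) = {0} \<longrightarrow> P = (\<lambda>x. 0)"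
      by (rule upper_parametrix[OF colT T(1)])
    have "finite_rank (tp id P)"
      using W(5) T(2) by (simp add: tp_zero_right[OF bounded_clinear_id] finite_rank_zero)
    then show ?thesis
      by (rule upper_split_tensor[OF assms(1) assms(2) triv idS W(1,2,4)])
  next
    case ST
    obtain W P where W: "bounded_clinear W" "bounded_clinear P" "finite_rank P"
      "\<forall>x. W (col_op S x) + P x = x" "null_space (col_op S) = {0} \<longrightarrow> P = (\<lambda>x. 0)"
      by (rule upper_parametrix[OF colS ST(1)])
    obtain W' Q where W': "bounded_clinear W'" "bounded_clinear Q" "finite_rank Q"
      "\<forall>x. W' (col_op T x) + Q x = x" "null_space (col_op T) = {0} \<longrightarrow> Q = (\<lambda>x. 0)"
      by (rule upper_parametrix[OF colT ST(2)])
    show ?thesis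
      by (rule upper_split_tensor[OF S T W(1,2,4) W'(1,2,4) finite_rank_tp[OF W(2,3) W'(2,3)]])
  qed
qed

end

section \<open>Spectra\<close>

lemma mem_vec_times_iff:
  "l \<in> A \<times>\<^sub>v B \<longleftrightarrow> (\<chi> i. l $ Inl i) \<in> A \<and> (\<chi> j. l $ Inr j) \<in> B"
proof
  assume "l \<in> A \<times>\<^sub>v B"
  then obtain a b where ab: "l = (\<chi> k. case k of Inl i \<Rightarrow> a $ i | Inr j \<Rightarrow> b $ j)" "a \<in> A" "b \<in> B"
    unfolding vec_times_def by blast
  then have "(\<chi> i. l $ Inl i) = a" "(\<chi> j. l $ Inr j) = b" by (simp_all add: vec_eq_iff)
  then show "(\<chi> i. l $ Inl i) \<in> A \<and> (\<chi> j. l $ Inr j) \<in> B" using ab by simp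
next
  assume *: "(\<chi> i. l $ Inl i) \<in> A \<and> (\<chi> j. l $ Inr j) \<in> B"
  have "l = (\<chi> k. case k of Inl i \<Rightarrow> (\<chi> i. l $ Inl i) $ i | Inr j \<Rightarrow> (\<chi> j. l $ Inr j) $ j)"
    by (simp add: vec_eq_iff split: sum.split)
  then show "l \<in> A \<times>\<^sub>v B" unfolding vec_times_def using * by blast
qed

lemma bounded_clinear_shift_tuple:
  "(\<And>i. bounded_clinear (T i)) \<Longrightarrow> bounded_clinear (shift_tuple T l i)"
  unfolding shift_tuple_def by (intro bounded_clinear_minus bounded_clinear_scaleC_right)

text \<open>Surjectivity and injectivity contain the finiteness conditions, so the two split spectra
  differ from their essential versions only by one extra condition on a split Fredholm
  operator.\<close>

lemma mem_spectra_iff: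
  shows "l \<in> sp\<delta>e T \<longleftrightarrow> \<not> lower_split_Fredholm (row_op (shift_tuple T l))"
    and "l \<in> sp\<pi>e T \<longleftrightarrow> \<not> upper_split_Fredholm (col_op (shift_tuple T l))"
    and "l \<in> sp\<delta> T \<longleftrightarrow> \<not> (lower_split_Fredholm (row_op (shift_tuple T l)) \<and> range (row_op (shift_tuple T l)) = UNIV)"
    and "l \<in> sp\<pi> T \<longleftrightarrow> \<not> (upper_split_Fredholm (col_op (shift_tuple T l)) \<and> null_space (col_op (shift_tuple T l)) = {0})"
proof -
  show "l \<in> sp\<pi> T \<longleftrightarrow> \<not> (upper_split_Fredholm (col_op (shift_tuple T l)) \<and> null_space (col_op (shift_tuple T l)) = {0})"
    unfolding sp\<pi>_def \<sigma>\<pi>_def C_plus_def upper_split_Fredholm_def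
    by (cases "null_space (col_op (shift_tuple T l)) = {0}")
       (simp_all add: cdimension_zero_finite del: not_infinity_eq)
  show "l \<in> sp\<delta> T \<longleftrightarrow> \<not> (lower_split_Fredholm (row_op (shift_tuple T l)) \<and> range (row_op (shift_tuple T l)) = UNIV)"
    unfolding sp\<delta>_def \<sigma>\<delta>_def C_minus_def lower_split_Fredholm_def
    by (cases "range (row_op (shift_tuple T l)) = UNIV")
       (simp_all add: ccodimension_UNIV_finite del: not_infinity_eq)
  show "l \<in> sp\<delta>e T \<longleftrightarrow> \<not> lower_split_Fredholm (row_op (shift_tuple T l))"
    unfolding sp\<delta>e_def \<sigma>\<Phi>_minus_def C_minus_def lower_split_Fredholm_def by simp
  show "l \<in> sp\<pi>e T \<longleftrightarrow> \<not> upper_split_Fredholm (col_op (shift_tuple T l))"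
    unfolding sp\<pi>e_def \<sigma>\<Phi>_plus_def C_plus_def upper_split_Fredholm_def by simp
qed

text \<open>The kernel of a row is always closed, so \<open>C_minus T\<close> is empty. The range of
  a column may fail to be closed and then need not be complemented, but such points already belong
  to both \<open>\<sigma>\<pi> T\<close> and \<open>\<sigma>\<Phi>_plus T\<close>.\<close>

lemma hilbert_space_spectra:
  fixes T :: "'n::finite \<Rightarrow> 'a::complex_banach \<Rightarrow> 'a"
  assumes H: "hilbert_space TYPE('a)" and T: "\<And>i. bounded_clinear (T i)"
  shows "sp\<delta> T = \<sigma>\<delta> T" "sp\<delta>e T = \<sigma>\<Phi>_minus T" "sp\<pi> T = \<sigma>\<pi> T" "sp\<pi>e T = \<sigma>\<Phi>_plus T"
proof -
  have T': "bounded_clinear (shift_tuple T l i)" for l i by (rule bounded_clinear_shift_tuple[OF T])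
  have row: "bounded_clinear (row_op (shift_tuple T l))" for l by (rule bounded_clinear_row_op[OF T'])
  have col: "bounded_clinear (col_op (shift_tuple T l))" for l by (rule bounded_clinear_col_op[OF T'])
  have "has_direct_complement (null_space (row_op (shift_tuple T l)))" for l
    by (rule hilbert_space_direct_complement[OF hilbert_space_vec[OF H]
          subspace_null_space[OF row] closed_null_space[OF row]])
  then have "C_minus T = {}" by (simp add: C_minus_def)
  then show "sp\<delta> T = \<sigma>\<delta> T" "sp\<delta>e T = \<sigma>\<Phi>_minus T" by (simp_all add: sp\<delta>_def sp\<delta>e_def)
  have "has_direct_complement (range (col_op (shift_tuple T l)))" if "closed (range (col_op (shift_tuple T l)))" for l
    by (rule hilbert_space_direct_complement[OF hilbert_space_vec[OF H]
          subspace_image[OF col complex_vector.subspace_UNIV] that])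
  then have "C_plus T \<subseteq> \<sigma>\<pi> T" "C_plus T \<subseteq> \<sigma>\<Phi>_plus T"
    by (auto simp: C_plus_def \<sigma>\<pi>_def \<sigma>\<Phi>_plus_def)
  then show "sp\<pi> T = \<sigma>\<pi> T" "sp\<pi>e T = \<sigma>\<Phi>_plus T" by (auto simp: sp\<pi>_def sp\<pi>e_def)
qed

theorem proposition4p2:
  fixes tv :: "'a::complex_banach \<Rightarrow> 'b::complex_banach \<Rightarrow> 'c::complex_banach"
    and tp :: "('a \<Rightarrow> 'a) \<Rightarrow> ('b \<Rightarrow> 'b) \<Rightarrow> 'c \<Rightarrow> 'c"
    and S :: "'n::finite \<Rightarrow> 'a \<Rightarrow> 'a"
    and T :: "'m::finite \<Rightarrow> 'b \<Rightarrow> 'b"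
  assumes "banach_tensor_product tv tp"
    and "commuting_tuple S"
    and "commuting_tuple T"
  shows "let U = tensor_tuple tp S T in
    (\<sigma>\<Phi>_minus S \<times>\<^sub>v \<sigma>\<delta> T \<union> \<sigma>\<delta> S \<times>\<^sub>v \<sigma>\<Phi>_minus T \<subseteq> \<sigma>\<Phi>_minus U \<and>
     \<sigma>\<Phi>_minus U \<subseteq> sp\<delta>e U \<and>
     sp\<delta>e U \<subseteq> sp\<delta>e S \<times>\<^sub>v sp\<delta> T \<union> sp\<delta> S \<times>\<^sub>v sp\<delta>e T) \<and>
    (\<sigma>\<Phi>_plus S \<times>\<^sub>v \<sigma>\<pi> T \<union> \<sigma>\<pi> S \<times>\<^sub>v \<sigma>\<Phi>_plus T \<subseteq> \<sigma>\<Phi>_plus U \<and>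
     \<sigma>\<Phi>_plus U \<subseteq> sp\<pi>e U \<and>
     sp\<pi>e U \<subseteq> sp\<pi>e S \<times>\<^sub>v sp\<pi> T \<union> sp\<pi> S \<times>\<^sub>v sp\<pi>e T) \<and>
    (hilbert_space TYPE('a) \<and> hilbert_space TYPE('b) \<longrightarrow>
     (\<sigma>\<Phi>_minus S \<times>\<^sub>v \<sigma>\<delta> T \<union> \<sigma>\<delta> S \<times>\<^sub>v \<sigma>\<Phi>_minus T = \<sigma>\<Phi>_minus U \<and>
      \<sigma>\<Phi>_minus U = sp\<delta>e U \<and>
      sp\<delta>e U = sp\<delta>e S \<times>\<^sub>v sp\<delta> T \<union> sp\<delta> S \<times>\<^sub>v sp\<delta>e T) \<and>
     (\<sigma>\<Phi>_plus S \<times>\<^sub>v \<sigma>\<pi> T \<union> \<sigma>\<pi> S \<times>\<^sub>v \<sigma>\<Phi>_plus T = \<sigma>\<Phi>_plus U \<and>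
      \<sigma>\<Phi>_plus U = sp\<pi>e U \<and>
      sp\<pi>e U = sp\<pi>e S \<times>\<^sub>v sp\<pi> T \<union> sp\<pi> S \<times>\<^sub>v sp\<pi>e T))"
proof -
  interpret banach_tensor_product tv tp by (rule assms(1))
  define U where "U = tensor_tuple tp S T"
  have S: "bounded_clinear (S i)" and T: "bounded_clinear (T j)" for i j
    using assms(2,3) by (simp_all add: commuting_tuple_def)
  have S': "bounded_clinear (shift_tuple S l i)" and T': "bounded_clinear (shift_tuple T l' j)" for l l' i j
    by (rule bounded_clinear_shift_tuple[OF S], rule bounded_clinear_shift_tuple[OF T])
  note shift = tensor_tuple_shift[of S T, OF S T, folded U_def]
  have minus1: "\<sigma>\<Phi>_minus S \<times>\<^sub>v \<sigma>\<delta> T \<union> \<sigma>\<delta> S \<times>\<^sub>v \<sigma>\<Phi>_minus T \<subseteq> \<sigma>\<Phi>_minus U"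
  proof
    fix l
    let ?S = "shift_tuple S (\<chi> i. l $ Inl i)" and ?T = "shift_tuple T (\<chi> j. l $ Inr j)"
    assume l: "l \<in> \<sigma>\<Phi>_minus S \<times>\<^sub>v \<sigma>\<delta> T \<union> \<sigma>\<delta> S \<times>\<^sub>v \<sigma>\<Phi>_minus T"
    show "l \<in> \<sigma>\<Phi>_minus U"
    proof (rule ccontr)
      assume "l \<notin> \<sigma>\<Phi>_minus U"
      then have fin: "ccodimension (range (row_op (tensor_tuple tp ?S ?T))) \<noteq> \<infinity>"
        by (simp add: \<sigma>\<Phi>_minus_def shift)
      show False
        using l lower_semi_Fredholm_factors[of ?S ?T, OF S' T' fin]
        unfolding Un_iff mem_vec_times_iff \<sigma>\<Phi>_minus_def \<sigma>\<delta>_def mem_Collect_eq by argo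
    qed
  qed
  have plus1: "\<sigma>\<Phi>_plus S \<times>\<^sub>v \<sigma>\<pi> T \<union> \<sigma>\<pi> S \<times>\<^sub>v \<sigma>\<Phi>_plus T \<subseteq> \<sigma>\<Phi>_plus U"
  proof
    fix l
    let ?S = "shift_tuple S (\<chi> i. l $ Inl i)" and ?T = "shift_tuple T (\<chi> j. l $ Inr j)"
    assume l: "l \<in> \<sigma>\<Phi>_plus S \<times>\<^sub>v \<sigma>\<pi> T \<union> \<sigma>\<pi> S \<times>\<^sub>v \<sigma>\<Phi>_plus T"
    show "l \<in> \<sigma>\<Phi>_plus U"
    proof (rule ccontr)
      assume "l \<notin> \<sigma>\<Phi>_plus U"
      then have fin: "cdimension (null_space (col_op (tensor_tuple tp ?S ?T))) \<noteq> \<infinity>"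
        and cl: "closed (range (col_op (tensor_tuple tp ?S ?T)))"
        by (simp_all add: \<sigma>\<Phi>_plus_def shift)
      show False
        using l upper_semi_Fredholm_factors[of ?S ?T, OF S' T' fin cl]
        unfolding Un_iff mem_vec_times_iff \<sigma>\<Phi>_plus_def \<sigma>\<pi>_def mem_Collect_eq by argo
    qed
  qed
  have minus2: "\<sigma>\<Phi>_minus U \<subseteq> sp\<delta>e U" and plus2: "\<sigma>\<Phi>_plus U \<subseteq> sp\<pi>e U"
    by (simp_all add: sp\<delta>e_def sp\<pi>e_def)
  have minus3: "sp\<delta>e U \<subseteq> sp\<delta>e S \<times>\<^sub>v sp\<delta> T \<union> sp\<delta> S \<times>\<^sub>v sp\<delta>e T"
  proof
    fix l assume "l \<in> sp\<delta>e U"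
    then show "l \<in> sp\<delta>e S \<times>\<^sub>v sp\<delta> T \<union> sp\<delta> S \<times>\<^sub>v sp\<delta>e T"
      using lower_split_Fredholm_tensor[of "shift_tuple S (\<chi> i. l $ Inl i)"
          "shift_tuple T (\<chi> j. l $ Inr j)", OF S' T']
      unfolding Un_iff mem_vec_times_iff mem_spectra_iff shift by argo
  qed
  have plus3: "sp\<pi>e U \<subseteq> sp\<pi>e S \<times>\<^sub>v sp\<pi> T \<union> sp\<pi> S \<times>\<^sub>v sp\<pi>e T"
  proof
    fix l assume "l \<in> sp\<pi>e U"
    then show "l \<in> sp\<pi>e S \<times>\<^sub>v sp\<pi> T \<union> sp\<pi> S \<times>\<^sub>v sp\<pi>e T"
      using upper_split_Fredholm_tensor[of "shift_tuple S (\<chi> i. l $ Inl i)"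
          "shift_tuple T (\<chi> j. l $ Inr j)", OF S' T']
      unfolding Un_iff mem_vec_times_iff mem_spectra_iff shift by argo
  qed
  \<comment> \<open>The Hilbert assumption concerns the two factors, so it identifies only the
    outermost sets of each chain. Equality of the sets belonging to \<open>U\<close> follows because
    they lie in between.\<close>
  have hilbert: "sp\<delta>e S \<times>\<^sub>v sp\<delta> T \<union> sp\<delta> S \<times>\<^sub>v sp\<delta>e T = \<sigma>\<Phi>_minus S \<times>\<^sub>v \<sigma>\<delta> T \<union> \<sigma>\<delta> S \<times>\<^sub>v \<sigma>\<Phi>_minus T"
    "sp\<pi>e S \<times>\<^sub>v sp\<pi> T \<union> sp\<pi> S \<times>\<^sub>v sp\<pi>e T = \<sigma>\<Phi>_plus S \<times>\<^sub>v \<sigma>\<pi> T \<union> \<sigma>\<pi> S \<times>\<^sub>v \<sigma>\<Phi>_plus T"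
    if "hilbert_space TYPE('a) \<and> hilbert_space TYPE('b)"
    using hilbert_space_spectra[of S, OF _ S] hilbert_space_spectra[of T, OF _ T] that by simp_all
  show ?thesis
    unfolding Let_def U_def[symmetric]
  proof (intro conjI impI)
    assume H: "hilbert_space TYPE('a) \<and> hilbert_space TYPE('b)"
    have squeeze: "A = B \<and> B = C \<and> C = D" if "A \<subseteq> B" "B \<subseteq> C" "C \<subseteq> D" "D = A" for A B C D :: "'x set"
      using that by blast
    note eqs = squeeze[OF minus1 minus2 minus3 hilbert(1)[OF H]] squeeze[OF plus1 plus2 plus3 hilbert(2)[OF H]]
    show "\<sigma>\<Phi>_minus S \<times>\<^sub>v \<sigma>\<delta> T \<union> \<sigma>\<delta> S \<times>\<^sub>v \<sigma>\<Phi>_minus T = \<sigma>\<Phi>_minus U"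
      "\<sigma>\<Phi>_minus U = sp\<delta>e U"
      "sp\<delta>e U = sp\<delta>e S \<times>\<^sub>v sp\<delta> T \<union> sp\<delta> S \<times>\<^sub>v sp\<delta>e T"
      "\<sigma>\<Phi>_plus S \<times>\<^sub>v \<sigma>\<pi> T \<union> \<sigma>\<pi> S \<times>\<^sub>v \<sigma>\<Phi>_plus T = \<sigma>\<Phi>_plus U"
      "\<sigma>\<Phi>_plus U = sp\<pi>e U"
      "sp\<pi>e U = sp\<pi>e S \<times>\<^sub>v sp\<pi> T \<union> sp\<pi> S \<times>\<^sub>v sp\<pi>e T"
      using eqs by blast+
  qed (fact minus1 minus2 minus3 plus1 plus2 plus3)+
qed

end
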